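(* If a smooth quintic surface $X_5\subset\mathbb{P}^3$ contains five coplanar lines, then it contains at most $125$ lines.
   Context: The base field is algebraically closed of characteristic zero. *)

theory Defs
  imports
    "HOL-Analysis.Analysis"
    "HOL-Library.Poly_Mapping"
    "HOL-Computational_Algebra.Polynomial"
begin

text \<open>
  Projective space over a field \<open>'k\<close> is the set of one-dimensional subspaces of the coordinate space
  \<open>'k ^ 'n\<close>, so \<open>'k ^ 4\<close> gives projective three-space. Dimension and subspaces are those of
  the vector space \<open>'k ^ 'n\<close> over \<open>'k\<close> (prefix \<open>vec\<close>), not the real ones.
\<close>

definition proj_space :: "('k::field ^ 'n) set set" where
  "proj_space = {P. vec.subspace P \<and> vec.dim P = 1}"

definition projectivization :: "('k::field ^ 'n) set \<Rightarrow> ('k ^ 'n) set set" where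
  "projectivization W = {P \<in> proj_space. P \<subseteq> W}"

definition proj_linear_subspace :: "nat \<Rightarrow> ('k::field ^ 'n) set set \<Rightarrow> bool" where
  "proj_linear_subspace d \<Lambda> \<longleftrightarrow>
     (\<exists>W. vec.subspace W \<and> vec.dim W = d + 1 \<and> \<Lambda> = projectivization W)"

abbreviation proj_line :: "('k::field ^ 'n) set set \<Rightarrow> bool" where
  "proj_line \<equiv> proj_linear_subspace 1"

abbreviation proj_plane :: "('k::field ^ 'n) set set \<Rightarrow> bool" where
  "proj_plane \<equiv> proj_linear_subspace 2"

text \<open>
  A polynomial in the variables \<open>x\<^sub>i\<close>, \<open>i :: 'n\<close>, is a finitely supported map from
  exponent vectors to coefficients.
\<close>

type_synonym ('n, 'k) mpolynomial = "('n \<Rightarrow>\<^sub>0 nat) \<Rightarrow>\<^sub>0 'k"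

definition mpoly_eval :: "('n::finite, 'k::field) mpolynomial \<Rightarrow> 'k ^ 'n \<Rightarrow> 'k" where
  "mpoly_eval F v =
     (\<Sum>m\<in>Poly_Mapping.keys F. Poly_Mapping.lookup F m * (\<Prod>i\<in>UNIV. (v $ i) ^ Poly_Mapping.lookup m i))"

text \<open>
  The truncated subtraction of exponents is harmless: it only truncates when the exponent
  of \<open>x\<^sub>i\<close> is zero, and then the coefficient vanishes.
\<close>

definition mpoly_pderiv :: "'n \<Rightarrow> ('n::finite, 'k::field) mpolynomial \<Rightarrow> ('n, 'k) mpolynomial" where
  "mpoly_pderiv i F =
     (\<Sum>m\<in>Poly_Mapping.keys F.
        Poly_Mapping.single (m - Poly_Mapping.single i 1)
          (of_nat (Poly_Mapping.lookup m i) * Poly_Mapping.lookup F m))"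

definition homogeneous_form :: "nat \<Rightarrow> ('n::finite, 'k::field) mpolynomial \<Rightarrow> bool" where
  "homogeneous_form d F \<longleftrightarrow>
     (\<forall>m\<in>Poly_Mapping.keys F. (\<Sum>i\<in>UNIV. Poly_Mapping.lookup m i) = d)"

definition zero_locus :: "('n::finite, 'k::field) mpolynomial \<Rightarrow> ('k ^ 'n) set set" where
  "zero_locus F = {P \<in> proj_space. \<forall>v\<in>P. mpoly_eval F v = 0}"

text \<open>
  Smoothness is the Jacobian criterion at every point of the zero locus. It forces the form
  \<open>F\<close> to be reduced, so \<open>F\<close> is determined by the point set \<open>X\<close> up to a scalar and the degree
  of \<open>X\<close> is unambiguous. The base field is meant to be algebraically closed, so that closed
  points are coordinate points.
\<close>

definition smooth_hypersurface :: "nat \<Rightarrow> ('k::field ^ 'n::finite) set set \<Rightarrow> bool" where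
  "smooth_hypersurface d X \<longleftrightarrow>
     (\<exists>F :: ('n, 'k) mpolynomial. F \<noteq> 0 \<and> homogeneous_form d F \<and> X = zero_locus F \<and>
        (\<forall>P\<in>X. \<forall>v\<in>P. v \<noteq> 0 \<longrightarrow> (\<exists>i. mpoly_eval (mpoly_pderiv i F) v \<noteq> 0)))"

definition lines_in :: "('k::field ^ 'n) set set \<Rightarrow> ('k ^ 'n) set set set" where
  "lines_in X = {L. proj_line L \<and> L \<subseteq> X}"

definition coplanar_lines :: "('k::field ^ 'n) set set set \<Rightarrow> bool" where
  "coplanar_lines S \<longleftrightarrow> (\<exists>H. proj_plane H \<and> (\<forall>L\<in>S. L \<subseteq> H))"

end

theory Submission
  imports Defs
begin

text \<open>
  Fix a line \<open>U\<close> on the surface and let \<open>M(U)\<close> be the number of lines of the surface that meet it. At a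
  point \<open>p\<close> of \<open>U\<close>, a further line lies in the tangent plane and is given by its slope \<open>a\<close>. The
  second-order term of the quintic along it is linear in the slope, \<open>Q(p) + a W(p)\<close>, where \<open>W\<close> is the
  Wronskian of the pencil of binary quartics spanned on \<open>U\<close> by the partial derivatives transverse to \<open>U\<close>.
  Off the roots of \<open>W\<close> the slope is therefore \<open>- Q / W\<close>, and the terms of higher order become polynomials
  in \<open>p\<close>, whose zeros are counted; at a root of \<open>W\<close>, the order of the root bounds the number of lines.
  This gives \<open>M(U) \<le> 29\<close>, and \<open>M(U) \<le> 27\<close> if \<open>W\<close> has a simple root. If \<open>M(U) \<ge> 28\<close>, then all roots of \<open>W\<close>
  have order 2 or all have order 3, and the quadratic or the cubic invariant of binary quartics
  vanishes on the pencil.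

  Five coplanar lines of the surface make up its whole section by their plane, and their intersections
  with one of them, \<open>U\<close>, are the zeros of a member of its pencil, whose cross-ratio is thus special if
  \<open>M(U) \<ge> 28\<close>. Comparing the cross-ratios on several of the five lines and treating concurrent lines
  separately, one obtains \<open>\<Sum> M(U) \<le> 140\<close> over the five lines. As every line meets the plane, the surface
  has at most \<open>5 + \<Sum> (M(U) - 4) \<le> 125\<close> lines.
\<close>

text \<open>The bound \<open>M(U) \<le> 29\<close> alone gives only 5 + 5 * 25 = 130 lines, so the
  sum over the five lines has to be lowered by 5. This is why the local estimates keep track of
  every unit. Which higher-order term is counted depends on \<open>U\<close>: it is the first one,
  of order 3, 4 or 5, that does not vanish identically along the inflectional tangents; these cases
  give 26, 29 and 28. If all three vanished, the tangents would sweep out the quintic, which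
  smoothness forbids. Two obstacles shape the count. Where the slope becomes infinite, the
  inflectional tangent degenerates into \<open>U\<close> itself; the slope is therefore put in
  lowest terms \<open>- N / D\<close>, and the growth of the degrees with that of \<open>D\<close>
  is compensated by the few lines at the zeros of \<open>D\<close>. Moreover the slope refers to an
  affine chart, and a termwise degree count is too large by n - 1 at order n; comparing the
  expansions in \<open>x\<close> and in \<open>y\<close> removes this excess.\<close>

lemmas numeral_sums = atMost_Suc lessThan_Suc eval_nat_numeral

section \<open>Hasse derivatives of polynomials and of binary forms\<close>

definition hder :: "nat \<Rightarrow> 'a::comm_semiring_1 poly \<Rightarrow> 'a poly" where
  "hder j p = (\<Sum>i\<le>degree p. monom (of_nat (i choose j) * coeff p i) (i - j))"

lemma coeff_hder: "coeff (hder j p) m = of_nat ((m + j) choose j) * coeff p (m + j)"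
proof -
  have "coeff (hder j p) m =
      (\<Sum>i\<le>degree p. if i = m + j then of_nat ((m + j) choose j) * coeff p (m + j) else 0)"
    unfolding hder_def coeff_sum
  proof (rule sum.cong)
    fix i
    assume "i \<in> {..degree p}"
    show "coeff (monom (of_nat (i choose j) * coeff p i) (i - j)) m =
        (if i = m + j then of_nat ((m + j) choose j) * coeff p (m + j) else 0)"
      by (cases "i < j") (auto simp: binomial_eq_0)
  qed auto
  also have "\<dots> = of_nat ((m + j) choose j) * coeff p (m + j)"
    by (auto simp: sum.delta coeff_eq_0)
  finally show ?thesis .
qed

lemma hder_0 [simp]: "hder 0 p = p"
  by (rule poly_eqI) (simp add: coeff_hder)

lemma hder_1: "hder (Suc 0) p = pderiv p"
  by (rule poly_eqI) (simp add: coeff_hder coeff_pderiv)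

lemma hder_zero [simp]: "hder j 0 = 0"
  by (rule poly_eqI) (simp add: coeff_hder)

lemma pderiv_hder: "pderiv (hder j p) = smult (of_nat (Suc j)) (hder (Suc j) p)"
proof (rule poly_eqI)
  fix m
  have "Suc m * (Suc (m + j) choose j) = Suc j * (Suc (m + j) choose Suc j)"
    using binomial_absorption[of j "Suc (m + j)"] binomial_absorb_comp[of "Suc (m + j)" j]
    by simp
  then have "(of_nat (Suc m) * of_nat (Suc (m + j) choose j) :: 'a) =
      of_nat (Suc j) * of_nat (Suc (m + j) choose Suc j)"
    by (metis of_nat_mult)
  then show "coeff (pderiv (hder j p)) m = coeff (smult (of_nat (Suc j)) (hder (Suc j) p)) m"
    by (simp add: coeff_hder coeff_pderiv mult.assoc[symmetric] del: of_nat_Suc)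
qed

lemma poly_hder:
  assumes "degree p \<le> n"
  shows "poly (hder j p) x = (\<Sum>i\<le>n. of_nat (i choose j) * coeff p i * x ^ (i - j))"
proof -
  have "poly (hder j p) x = (\<Sum>i\<le>degree p. of_nat (i choose j) * coeff p i * x ^ (i - j))"
    by (simp add: hder_def poly_sum poly_monom)
  also have "\<dots> = (\<Sum>i\<le>n. of_nat (i choose j) * coeff p i * x ^ (i - j))"
    by (rule sum.mono_neutral_left) (use assms in \<open>auto simp: coeff_eq_0\<close>)
  finally show ?thesis .
qed

text \<open>The \<open>j\<close>-th Hasse derivative in \<open>y\<close>, at \<open>y = 1\<close>, of the form of degree \<open>e\<close> with
  dehomogenization \<open>p\<close>.\<close>

definition hder_y :: "nat \<Rightarrow> nat \<Rightarrow> 'a::comm_semiring_1 poly \<Rightarrow> 'a poly" where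
  "hder_y e j p = (\<Sum>i\<le>e. monom (of_nat ((e - i) choose j) * coeff p i) i)"

lemma degree_hder_y: "degree (hder_y e j p) \<le> e - j"
  unfolding hder_y_def
proof (rule degree_sum_le)
  fix i
  assume "i \<in> {..e}"
  show "degree (monom (of_nat ((e - i) choose j) * coeff p i) i) \<le> e - j"
  proof (cases "i \<le> e - j")
    case True
    then show ?thesis
      using degree_monom_le order_trans by blast
  next
    case False
    then have "e - i < j"
      using \<open>i \<in> {..e}\<close> by auto
    then show ?thesis by (simp add: binomial_eq_0)
  qed
qed simp

lemma poly_hder_y: "poly (hder_y e j p) x = (\<Sum>i\<le>e. of_nat ((e - i) choose j) * coeff p i * x ^ i)"
  by (simp add: hder_y_def poly_sum poly_monom)

section \<open>Jets of a quintic along a line\<close>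

text \<open>In coordinates \<open>(x, y, z, w)\<close> with the line \<open>z = w = 0\<close> on the quintic, \<open>\<phi> k l\<close> is the coefficient
  of \<open>z\<^sup>k w\<^sup>l\<close> at \<open>y = 1\<close>, a polynomial in \<open>x\<close>. The tangent plane at \<open>(p, 1, 0, 0)\<close> consists of the
  directions \<open>(a, b, B(p), - A(p))\<close> and the line itself; \<open>jet n p a\<close> is the coefficient of \<open>t\<^sup>n\<close> in
  the quintic at \<open>(p + a t, 1, B(p) t, - A(p) t)\<close>. So the pairs in \<open>lines\<close> are the further lines of the
  surface that meet the given one off \<open>y = 0\<close>. \<open>S n N D\<close> is \<open>jet n\<close> at the slope \<open>- N / D\<close>, cleared of
  denominators.\<close>

locale quintic_chart =
  fixes \<phi> :: "nat \<Rightarrow> nat \<Rightarrow> 'k::{alg_closed_field,field_char_0} poly"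
  assumes degree_\<phi>: "1 \<le> k + l \<Longrightarrow> k + l \<le> 5 \<Longrightarrow> degree (\<phi> k l) \<le> 5 - k - l"
begin

abbreviation A where "A \<equiv> \<phi> 1 0"
abbreviation B where "B \<equiv> \<phi> 0 1"

definition T :: "nat \<Rightarrow> nat \<Rightarrow> 'k poly" where
  "T j K = (\<Sum>k\<le>K. hder j (\<phi> k (K - k)) * B ^ k * (- A) ^ (K - k))"

definition U :: "nat \<Rightarrow> nat \<Rightarrow> 'k poly" where
  "U j K = (\<Sum>k\<le>K. hder_y (5 - K) j (\<phi> k (K - k)) * B ^ k * (- A) ^ (K - k))"

abbreviation W where "W \<equiv> T 1 1"
abbreviation Q where "Q \<equiv> T 0 2"

definition jet :: "nat \<Rightarrow> 'k \<Rightarrow> 'k \<Rightarrow> 'k" where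
  "jet n p a = (\<Sum>j<n. poly (T j (n - j)) p * a ^ j)"

definition lines :: "('k \<times> 'k) set" where
  "lines = {(p, a). \<forall>n\<in>{2..5}. jet n p a = 0}"

definition S :: "nat \<Rightarrow> 'k poly \<Rightarrow> 'k poly \<Rightarrow> 'k poly" where
  "S n N D = (\<Sum>j<n. T j (n - j) * (- N) ^ j * D ^ (n - 1 - j))"

text \<open>The slope \<open>- N / D\<close> in \<open>x\<close> corresponds to
  \<open>N / (p * D)\<close> in \<open>y\<close>, whence the additional factor
  \<open>[:0, 1:]\<close> in the denominator.\<close>

definition S_y :: "nat \<Rightarrow> 'k poly \<Rightarrow> 'k poly \<Rightarrow> 'k poly" where
  "S_y n N D = (\<Sum>j<n. U j (n - j) * N ^ j * ([:0, 1:] * D) ^ (n - 1 - j))"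

lemma poly_S:
  assumes "poly D p \<noteq> 0"
  shows "poly (S n N D) p = poly D p ^ (n - 1) * jet n p (- poly N p / poly D p)"
proof -
  have "poly (S n N D) p = (\<Sum>j<n. poly (T j (n - j)) p * (- poly N p) ^ j * poly D p ^ (n - 1 - j))"
    by (simp add: S_def poly_sum)
  also have "\<dots> = (\<Sum>j<n. poly D p ^ (n - 1) * (poly (T j (n - j)) p * (- poly N p / poly D p) ^ j))"
  proof (rule sum.cong)
    fix j
    assume "j \<in> {..<n}"
    then have "poly D p ^ (n - 1) = poly D p ^ (n - 1 - j) * poly D p ^ j"
      by (simp flip: power_add)
    then show "poly (T j (n - j)) p * (- poly N p) ^ j * poly D p ^ (n - 1 - j) =
        poly D p ^ (n - 1) * (poly (T j (n - j)) p * (- poly N p / poly D p) ^ j)"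
      unfolding power_divide using assms by simp
  qed simp
  finally show ?thesis
    by (simp add: jet_def sum_distrib_left)
qed

text \<open>For fixed \<open>p\<close> this is the coefficient of \<open>x^i y^(5 - K - i)\<close>
  once \<open>z\<close> and \<open>w\<close> are replaced by \<open>B(p)\<close> and
  \<open>- A(p)\<close> in the part of degree \<open>K\<close> in them. The values of
  \<open>T\<close> and \<open>U\<close> at \<open>p\<close> are read off from these same numbers,
  which makes the two expansions comparable.\<close>

definition cf :: "'k \<Rightarrow> nat \<Rightarrow> nat \<Rightarrow> 'k" where
  "cf p K i = (\<Sum>k\<le>K. coeff (\<phi> k (K - k)) i * poly B p ^ k * (- poly A p) ^ (K - k))"

lemma poly_T:
  assumes "1 \<le> K" "K \<le> 5"
  shows "poly (T j K) p = (\<Sum>i\<le>5 - K. of_nat (i choose j) * cf p K i * p ^ (i - j))"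
proof -
  have "poly (T j K) p = (\<Sum>k\<le>K. (\<Sum>i\<le>5 - K. of_nat (i choose j) * coeff (\<phi> k (K - k)) i * p ^ (i - j))
      * poly B p ^ k * (- poly A p) ^ (K - k))"
    unfolding T_def poly_sum
  proof (rule sum.cong)
    fix k
    assume "k \<in> {..K}"
    then have "degree (\<phi> k (K - k)) \<le> 5 - K"
      using degree_\<phi>[of k "K - k"] assms by auto
    then show "poly (hder j (\<phi> k (K - k)) * B ^ k * (- A) ^ (K - k)) p =
       (\<Sum>i\<le>5 - K. of_nat (i choose j) * coeff (\<phi> k (K - k)) i * p ^ (i - j))
      * poly B p ^ k * (- poly A p) ^ (K - k)"
      by (simp add: poly_hder)
  qed simp
  also have "\<dots> = (\<Sum>k\<le>K. \<Sum>i\<le>5 - K. of_nat (i choose j) * p ^ (i - j) *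
      (coeff (\<phi> k (K - k)) i * poly B p ^ k * (- poly A p) ^ (K - k)))"
    by (simp add: sum_distrib_left sum_distrib_right mult_ac)
  also have "\<dots> = (\<Sum>i\<le>5 - K. \<Sum>k\<le>K. of_nat (i choose j) * p ^ (i - j) *
      (coeff (\<phi> k (K - k)) i * poly B p ^ k * (- poly A p) ^ (K - k)))"
    by (rule sum.swap)
  finally show ?thesis
    by (simp add: cf_def sum_distrib_left mult_ac)
qed

lemma poly_U: "poly (U j K) p = (\<Sum>i\<le>5 - K. of_nat ((5 - K - i) choose j) * cf p K i * p ^ i)"
proof -
  have "poly (U j K) p = (\<Sum>k\<le>K. \<Sum>i\<le>5 - K. of_nat ((5 - K - i) choose j) * p ^ i *
      (coeff (\<phi> k (K - k)) i * poly B p ^ k * (- poly A p) ^ (K - k)))"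
    by (simp add: U_def poly_sum poly_hder_y sum_distrib_left sum_distrib_right mult_ac)
  also have "\<dots> = (\<Sum>i\<le>5 - K. \<Sum>k\<le>K. of_nat ((5 - K - i) choose j) * p ^ i *
      (coeff (\<phi> k (K - k)) i * poly B p ^ k * (- poly A p) ^ (K - k)))"
    by (rule sum.swap)
  finally show ?thesis
    by (simp add: cf_def sum_distrib_left mult_ac)
qed

text \<open>The counterpart of \<open>jet\<close>: the coefficient of \<open>t^n\<close> in the
  quintic at \<open>(p, 1 + b t, B(p) t, - A(p) t)\<close>.\<close>

definition jet_y :: "nat \<Rightarrow> 'k \<Rightarrow> 'k \<Rightarrow> 'k" where
  "jet_y n p b = (\<Sum>j<n. poly (U j (n - j)) p * b ^ j)"

lemma poly_S_y:
  assumes "poly D p \<noteq> 0" "p \<noteq> 0"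
  shows "poly (S_y n N D) p = (p * poly D p) ^ (n - 1) * jet_y n p (poly N p / (p * poly D p))"
proof -
  have "poly (S_y n N D) p = (\<Sum>j<n. poly (U j (n - j)) p * (poly N p) ^ j * (p * poly D p) ^ (n - 1 - j))"
    by (simp add: S_y_def poly_sum)
  also have "\<dots> = (\<Sum>j<n. (p * poly D p) ^ (n - 1) * (poly (U j (n - j)) p * (poly N p / (p * poly D p)) ^ j))"
  proof (rule sum.cong)
    fix j
    assume "j \<in> {..<n}"
    then have "(p * poly D p) ^ (n - 1) = (p * poly D p) ^ (n - 1 - j) * (p * poly D p) ^ j"
      by (simp flip: power_add)
    then show "poly (U j (n - j)) p * (poly N p) ^ j * (p * poly D p) ^ (n - 1 - j) =
        (p * poly D p) ^ (n - 1) * (poly (U j (n - j)) p * (poly N p / (p * poly D p)) ^ j)"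
      using assms by (simp add: power_divide)
  qed simp
  finally show ?thesis
    by (simp add: jet_y_def sum_distrib_left)
qed

lemma jet_1: "jet 1 p a = 0"
  by (simp add: jet_def T_def)


text \<open>Moving the direction vector \<open>v\<close> to \<open>v - \<mu> P\<close> rescales the line parameter, which makes the
  jets with respect to \<open>x\<close> and with respect to \<open>y\<close> unitriangular in each other.\<close>

lemma jet_y_1: "jet_y 1 p (- m) = jet 1 p (m * p)"
  by (simp add: jet_def jet_y_def poly_U poly_T)

lemma jet_2_y: "jet 2 p (m * p) = jet_y 2 p (- m) + 4 * m * jet_y 1 p (- m)"
  by (simp add: jet_def jet_y_def poly_U poly_T numeral_sums) (simp add: algebra_simps)

lemma jet_3_y: "jet 3 p (m * p) = jet_y 3 p (- m) + 3 * m * jet_y 2 p (- m) + 6 * m^2 * jet_y 1 p (- m)"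
  by (simp add: jet_def jet_y_def poly_U poly_T numeral_sums) (simp add: algebra_simps)

lemma jet_4_y: "jet 4 p (m * p) = jet_y 4 p (- m) + 2 * m * jet_y 3 p (- m) + 3 * m^2 * jet_y 2 p (- m)
    + 4 * m^3 * jet_y 1 p (- m)"
  by (simp add: jet_def jet_y_def poly_U poly_T numeral_sums) (simp add: algebra_simps)

lemma jet_5_y: "jet 5 p (m * p) = jet_y 5 p (- m) + m * jet_y 4 p (- m) + m^2 * jet_y 3 p (- m)
    + m^3 * jet_y 2 p (- m) + m^4 * jet_y 1 p (- m)"
  by (simp add: jet_def jet_y_def poly_U poly_T numeral_sums) (simp add: algebra_simps)

end

section \<open>Orders of vanishing and roots of polynomials\<close>

lemma hder_Suc_linear_mult:
  fixes r :: "'a::comm_ring_1 poly"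
  shows "hder (Suc j) ([:- c, 1:] * r) = [:- c, 1:] * hder (Suc j) r + hder j r"
proof (rule poly_eqI)
  fix m
  show "coeff (hder (Suc j) ([:- c, 1:] * r)) m = coeff ([:- c, 1:] * hder (Suc j) r + hder j r) m"
    by (cases m) (simp_all add: coeff_hder coeff_pCons algebra_simps)
qed

lemma poly_hder_less:
  fixes q :: "'a::comm_ring_1 poly"
  assumes "j < m"
  shows "poly (hder j ([:- c, 1:] ^ m * q)) c = 0"
  using assms
proof (induction m arbitrary: j)
  case (Suc m)
  show ?case
  proof (cases j)
    case 0
    then show ?thesis by simp
  next
    case (Suc i)
    then show ?thesis
      using Suc.IH[of i] Suc.prems hder_Suc_linear_mult[of i c "[:- c, 1:] ^ m * q"]
      by (simp add: mult.assoc del: mult_pCons_left)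
  qed
qed simp

lemma poly_hder_eq:
  fixes q :: "'a::comm_ring_1 poly"
  shows "poly (hder m ([:- c, 1:] ^ m * q)) c = poly q c"
proof (induction m)
  case (Suc m)
  then show ?case
    using hder_Suc_linear_mult[of m c "[:- c, 1:] ^ m * q"]
    by (simp add: mult.assoc del: mult_pCons_left)
qed simp

lemma poly_eq_if_eq_off_zeros:
  fixes f g h :: "'a::{idom,ring_char_0} poly"
  assumes "h \<noteq> 0" "\<And>x. poly h x \<noteq> 0 \<Longrightarrow> poly f x = poly g x"
  shows "f = g"
proof -
  have "poly (h * (f - g)) x = 0" for x
    using assms(2)[of x] by (cases "poly h x = 0") auto
  then have "h * (f - g) = 0"
    using poly_all_0_iff_0 by blast
  then show ?thesis
    using assms(1) by simp
qed

lemma sum_order_eq_degree: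
  fixes p :: "'a::alg_closed_field poly"
  assumes "p \<noteq> 0"
  shows "(\<Sum>x | poly p x = 0. order x p) = degree p"
  using assms
proof (induction "degree p" arbitrary: p)
  case 0
  then obtain c where "p = [:c:]"
    by (metis degree_eq_zeroE)
  with 0 show ?case by simp
next
  case (Suc n)
  then obtain c where c: "poly p c = 0"
    using alg_closed_imp_poly_has_root[of p] by auto
  then obtain q where q: "p = [:- c, 1:] * q"
    by (metis dvdE poly_eq_0_iff_dvd)
  with Suc have q0: "q \<noteq> 0" and dq: "degree q = n"
    by (auto simp: degree_mult_eq simp del: mult_pCons_left)
  have ord: "order x p = (if x = c then 1 else 0) + order x q" for x
  proof -
    have "order x [:- c, 1:] = (if x = c then 1 else 0)"
      using order_power_n_n[of c 1] by (auto intro: order_0I)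
    then show ?thesis
      using order_mult[of "[:- c, 1:]" q x] q Suc by auto
  qed
  have fin: "finite {x. poly p x = 0}"
    using Suc by (intro poly_roots_finite) auto
  have "(\<Sum>x | poly p x = 0. order x p) = (\<Sum>x | poly p x = 0. if x = c then 1 else 0) +
      (\<Sum>x | poly p x = 0. order x q)"
    by (simp add: ord sum.distrib)
  also have "(\<Sum>x | poly p x = 0. if x = c then 1 else 0) = (1::nat)"
    using c fin by (simp add: sum.delta)
  also have "(\<Sum>x | poly p x = 0. order x q) = (\<Sum>x | poly q x = 0. order x q)"
    by (rule sum.mono_neutral_right) (use fin q q0 order_root in \<open>auto\<close>)
  finally show ?case
    using Suc.hyps(1)[of q] dq q0 Suc.hyps(2) by simp
qed

text \<open>Brings the fraction \<open>Q / W\<close> to lowest terms, by removing common linear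
  factors one at a time.\<close>

lemma split_common_roots:
  fixes p q :: "'a::field poly"
  assumes "p \<noteq> 0"
  obtains g p' q' where "p = g * p'" "q = g * q'" "\<And>x. poly p' x \<noteq> 0 \<or> poly q' x \<noteq> 0"
proof -
  have "\<exists>g p' q'. p = g * p' \<and> q = g * q' \<and> (\<forall>x. poly p' x \<noteq> 0 \<or> poly q' x \<noteq> 0)"
    using assms
  proof (induction "degree p" arbitrary: p q rule: less_induct)
    case less
    show ?case
    proof (cases "\<exists>x. poly p x = 0 \<and> poly q x = 0")
      case False
      then show ?thesis
        by (metis mult_1)
    next
      case True
      then obtain x where "poly p x = 0" "poly q x = 0"
        by blast
      then obtain p1 q1 where eq: "p = [:- x, 1:] * p1" "q = [:- x, 1:] * q1"
        by (metis dvdE poly_eq_0_iff_dvd)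
      with less.prems have "p1 \<noteq> 0" and "degree p = Suc (degree p1)"
        by (auto simp: degree_mult_eq simp del: mult_pCons_left)
      with less.hyps[of p1 q1] obtain g p' q' where
        "p1 = g * p'" "q1 = g * q'" "\<forall>x. poly p' x \<noteq> 0 \<or> poly q' x \<noteq> 0"
        by auto
      then have "p = ([:- x, 1:] * g) * p'" "q = ([:- x, 1:] * g) * q'"
        using eq by (simp_all only: mult.assoc)
      with \<open>\<forall>x. poly p' x \<noteq> 0 \<or> poly q' x \<noteq> 0\<close> show ?thesis
        by blast
    qed
  qed
  then show ?thesis
    using that by blast
qed

lemma order_factor:
  assumes "p \<noteq> (0 :: 'a::idom poly)"
  obtains q where "p = [:- c, 1:] ^ order c p * q" "poly q c \<noteq> 0"
  using order_decomp[OF assms, of c] by (auto simp: poly_eq_0_iff_dvd)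

lemma order_factor_unique:
  fixes q :: "'a::idom poly"
  assumes "poly q c \<noteq> 0"
  shows "order c ([:- c, 1:] ^ n * q) = n"
proof -
  have "[:- c, 1:] ^ n * q \<noteq> 0"
    using assms by auto
  then have "order c ([:- c, 1:] ^ n * q) = order c ([:- c, 1:] ^ n) + order c q"
    by (rule order_mult)
  then show ?thesis
    using assms by (simp add: order_power_n_n order_0I)
qed

lemma pderiv_linear_power_mult:
  fixes q :: "'a::{idom,ring_char_0} poly"
  shows "pderiv ([:- c, 1:] ^ Suc n * q) =
    [:- c, 1:] ^ n * (smult (of_nat (Suc n)) q + [:- c, 1:] * pderiv q)"
proof -
  define L where "L = [:- c, 1:]"
  have "pderiv L = 1"
    by (simp add: L_def pderiv_pCons)
  then have "pderiv (L ^ Suc n * q) = L ^ n * (smult (of_nat (Suc n)) q + L * pderiv q)"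
    unfolding pderiv_mult pderiv_power_Suc by (simp add: algebra_simps)
  then show ?thesis
    by (simp only: L_def)
qed

section \<open>Degrees of the higher-order terms\<close>

context quintic_chart
begin

lemma degree_A: "degree A \<le> 4" and degree_B: "degree B \<le> 4"
  using degree_\<phi>[of 1 0] degree_\<phi>[of 0 1] by auto

lemma degree_U:
  assumes "K \<le> 5"
  shows "degree (U j K) \<le> 5 - K - j + 4 * K"
  unfolding U_def
proof (rule degree_sum_le)
  fix k
  assume "k \<in> {..K}"
  have "degree (hder_y (5 - K) j (\<phi> k (K - k)) * B ^ k * (- A) ^ (K - k)) \<le>
      degree (hder_y (5 - K) j (\<phi> k (K - k))) + degree (B ^ k) + degree ((- A) ^ (K - k))"
    by (meson add_le_mono1 degree_mult_le order_trans)
  also have "\<dots> \<le> (5 - K - j) + 4 * k + 4 * (K - k)"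
  proof (intro add_mono)
    show "degree (B ^ k) \<le> 4 * k"
      using degree_power_le[of B k] mult_le_mono1[OF degree_B, of k] by linarith
    show "degree ((- A) ^ (K - k)) \<le> 4 * (K - k)"
      using degree_power_le[of "- A" "K - k"] mult_le_mono1[OF degree_A, of "K - k"]
      by (simp add: le_trans)
  qed (rule degree_hder_y)
  finally show "degree (hder_y (5 - K) j (\<phi> k (K - k)) * B ^ k * (- A) ^ (K - k)) \<le>
      5 - K - j + 4 * K"
    using \<open>k \<in> {..K}\<close> by auto
qed simp

text \<open>All summands obey the same bound: raising \<open>j\<close> by 1 lowers the bound for
  \<open>U\<close> by 4 and that for the power of the denominator by 1 + d, while the power of
  \<open>N\<close> gains 5 + d.\<close>

lemma degree_S_y:
  assumes "n \<le> 5" "degree N \<le> 5 + d" "degree D \<le> d"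
  shows "degree (S_y n N D) \<le> 5 + 3 * n + d * (n - 1) + (n - 1)"
  unfolding S_y_def
proof (rule degree_sum_le)
  fix j
  assume j: "j \<in> {..<n}"
  have 1: "degree (U j (n - j)) \<le> 5 - n + 4 * (n - j)"
    using degree_U[of "n - j" j] assms j by auto
  have 2: "degree (N ^ j) \<le> (5 + d) * j"
    by (meson assms(2) degree_power_le mult_le_mono1 order_trans)
  have "degree ([:0, 1:] * D) \<le> 1 + d"
    using degree_mult_le[of "[:0, 1:]" D] assms(3) by (simp del: mult_pCons_left)
  then have 3: "degree (([:0, 1:] * D) ^ (n - 1 - j)) \<le> (1 + d) * (n - 1 - j)"
    by (meson degree_power_le mult_le_mono1 order_trans)
  have "degree (U j (n - j) * N ^ j * ([:0, 1:] * D) ^ (n - 1 - j)) \<le>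
      degree (U j (n - j)) + degree (N ^ j) + degree (([:0, 1:] * D) ^ (n - 1 - j))"
    by (meson add_le_mono1 degree_mult_le order_trans)
  also have "\<dots> \<le> 5 - n + 4 * (n - j) + (5 + d) * j + (1 + d) * (n - 1 - j)"
    using 1 2 3 by linarith
  also have "\<dots> = 5 + 3 * n + d * (n - 1) + (n - 1)"
  proof -
    obtain i where "n = Suc (j + i)"
      using j less_imp_Suc_add by blast
    then show ?thesis
      using assms(1) by (simp add: algebra_simps)
  qed
  finally show "degree (U j (n - j) * N ^ j * ([:0, 1:] * D) ^ (n - 1 - j)) \<le>
      5 + 3 * n + d * (n - 1) + (n - 1)" .
qed simp

text \<open>Termwise, \<open>S n N D\<close> is only known to satisfy the bound of
  \<open>degree_S_y\<close>. When the lower terms vanish, the unitriangular relations identify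
  \<open>jet n\<close> with \<open>jet_y n\<close>, so \<open>x^(n - 1) * S n N D\<close> equals
  \<open>S_y n N D\<close>, and dividing by the power of \<open>x\<close> saves n - 1.\<close>

lemma degree_S:
  assumes n: "n \<in> {3, 4, 5}" and N: "degree N \<le> 5 + d" and D: "degree D \<le> d" "D \<noteq> 0"
    and S: "\<And>m. 2 \<le> m \<Longrightarrow> m < n \<Longrightarrow> S m N D = 0"
  shows "degree (S n N D) \<le> 5 + 3 * n + d * (n - 1)"
proof -
  have "[:0, 1:] ^ (n - 1) * S n N D = S_y n N D"
  proof (rule poly_eq_if_eq_off_zeros)
    show "[:0, 1:] * D \<noteq> 0"
      using D by simp
    fix p
    assume "poly ([:0, 1:] * D) p \<noteq> 0"
    then have p: "p \<noteq> 0" "poly D p \<noteq> 0"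
      by auto
    define m where "m = - poly N p / (p * poly D p)"
    have mp: "m * p = - poly N p / poly D p"
      using p by (simp add: m_def)
    have "jet i p (m * p) = 0" if "2 \<le> i" "i < n" for i
      using poly_S[of D p i N] S[OF that] p mp by simp
    then have "jet n p (m * p) = jet_y n p (- m)"
      using n jet_1[of p "m * p"] jet_y_1[of p m] jet_2_y[of p m] jet_3_y[of p m] jet_4_y[of p m]
        jet_5_y[of p m] by auto
    then have "jet n p (- poly N p / poly D p) = jet_y n p (poly N p / (p * poly D p))"
      unfolding mp by (simp add: m_def)
    then show "poly ([:0, 1:] ^ (n - 1) * S n N D) p = poly (S_y n N D) p"
      using p by (simp add: poly_S poly_S_y power_mult_distrib)
  qed
  moreover have "degree ([:0, 1:] ^ (n - 1) * S n N D) = n - 1 + degree (S n N D)"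
    if "S n N D \<noteq> 0"
    using that by (simp add: degree_mult_eq degree_power_eq)
  ultimately show ?thesis
    using degree_S_y[of n N d D] n N D by (cases "S n N D = 0") auto
qed

end

section \<open>Ramification of the pencil and poles of the slope\<close>

lemma hder_smult: "hder j (smult c p) = smult c (hder j p)"
  by (rule poly_eqI) (simp add: coeff_hder algebra_simps)

lemma hder_diff: "hder j (p - q) = hder j p - hder j (q :: 'a::comm_ring_1 poly)"
  by (rule poly_eqI) (simp add: coeff_hder algebra_simps)

text \<open>As a binary form \<open>W\<close> has degree 6. That the polynomial attains this degree
  says that the point \<open>y = 0\<close> is unramified, so that the affine chart sees all the
  ramification.\<close>

locale quintic_line = quintic_chart \<phi>
  for \<phi> :: "nat \<Rightarrow> nat \<Rightarrow> 'k::{alg_closed_field,field_char_0} poly" +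
  assumes no_common_zero: "poly A p \<noteq> 0 \<or> poly B p \<noteq> 0"
    and degree_W: "degree W = 6"
begin

lemma T_1: "T j 1 = hder j A * B - hder j B * A"
  by (simp add: T_def)

lemma W_eq: "W = pderiv A * B - pderiv B * A"
  using T_1[of 1] by (simp add: hder_1)

lemma W_nonzero: "W \<noteq> 0"
  using degree_W by auto

lemma Q_eq: "Q = \<phi> 2 0 * B^2 - \<phi> 1 1 * A * B + \<phi> 0 2 * A^2"
  by (simp add: T_def eval_nat_numeral algebra_simps)

lemma T_1_2_eq: "T 1 2 = pderiv (\<phi> 2 0) * B^2 - pderiv (\<phi> 1 1) * A * B + pderiv (\<phi> 0 2) * A^2"
  by (simp add: T_def eval_nat_numeral algebra_simps hder_1)

lemma pderiv_W: "pderiv W = smult 2 (T 2 1)"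
proof -
  have "pderiv (pderiv p) = smult 2 (hder 2 p)" for p :: "'k poly"
    using pderiv_hder[of 1 p] by (simp add: hder_1 numeral_2_eq_2)
  then show ?thesis
    unfolding W_eq unfolding T_1 pderiv_diff pderiv_mult by (simp add: algebra_simps smult_diff_right)
qed

lemma S_3: "S 3 N D = T 2 1 * N^2 - T 1 2 * N * D + T 0 3 * D^2"
  by (simp add: S_def eval_nat_numeral algebra_simps)

text \<open>Here \<open>\<alpha>\<close> is the member of the pencil that vanishes at
  \<open>P\<close>, and \<open>T j 1\<close> takes at \<open>P\<close> the value of its
  \<open>j\<close>-th Taylor coefficient. Up to a nonzero constant, \<open>W\<close> is the
  Wronskian of \<open>\<alpha>\<close> and a member \<open>C\<close> with
  \<open>C(P) \<noteq> 0\<close>, so \<open>\<alpha>\<close> vanishes at \<open>P\<close> to one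
  order more than \<open>W\<close>; its degree is at most 4.\<close>

lemma T_at_ramification:
  fixes P
  defines "w \<equiv> order P W"
  shows "w \<le> 3" and "\<And>j. j \<le> w \<Longrightarrow> poly (T j 1) P = 0" and "poly (T (Suc w) 1) P \<noteq> 0"
proof -
  define \<alpha> where "\<alpha> = smult (poly B P) A - smult (poly A P) B"
  have T: "poly (T j 1) P = poly (hder j \<alpha>) P" for j
    unfolding T_1 by (simp add: \<alpha>_def hder_diff hder_smult algebra_simps)
  obtain C where C: "poly C P \<noteq> 0" "smult (poly C P) W = pderiv \<alpha> * C - pderiv C * \<alpha>"
  proof (cases "poly B P = 0")
    case False
    show ?thesis
      by (rule that[of B, OF False])
        (unfold W_eq, simp add: \<alpha>_def pderiv_diff pderiv_smult algebra_simps smult_diff_right)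
  next
    case True
    then have "poly A P \<noteq> 0"
      using no_common_zero by auto
    then show ?thesis
      by (rule that[of A])
        (unfold W_eq, simp add: \<alpha>_def pderiv_diff pderiv_smult algebra_simps smult_diff_right)
  qed
  have \<alpha>0: "\<alpha> \<noteq> 0"
    using C W_nonzero by auto
  define L where "L = [:- P, 1:]"
  obtain q where q: "\<alpha> = L ^ order P \<alpha> * q" "poly q P \<noteq> 0"
    unfolding L_def by (rule order_factor[OF \<alpha>0])
  have "poly \<alpha> P = 0"
    by (simp add: \<alpha>_def)
  then obtain m where m: "order P \<alpha> = Suc m"
    using \<alpha>0 order_root not0_implies_Suc by metis
  have "degree \<alpha> \<le> 4"
    using degree_A degree_B by (simp add: \<alpha>_def degree_diff_le)
  then have "m \<le> 3"
    using order_degree[OF \<alpha>0, of P] m by linarith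
  have d\<alpha>: "pderiv \<alpha> = L ^ m * (smult (of_nat (Suc m)) q + L * pderiv q)"
    using q(1) pderiv_linear_power_mult[of P m q] unfolding m L_def by simp
  have \<alpha>: "\<alpha> = L ^ Suc m * q"
    using q(1) unfolding m .
  have "smult (poly C P) W = L ^ m * ((smult (of_nat (Suc m)) q + L * pderiv q) * C - L * pderiv C * q)"
    unfolding C(2) d\<alpha> unfolding \<alpha> by (simp add: algebra_simps)
  moreover have "poly ((smult (of_nat (Suc m)) q + L * pderiv q) * C - L * pderiv C * q) P \<noteq> 0"
    using q(2) C(1) of_nat_neq_0[of m, where 'a = 'k] by (simp add: L_def del: of_nat_Suc)
  ultimately have "order P (smult (poly C P) W) = m"
    using order_factor_unique unfolding L_def by metis
  then have w: "w = m"
    using C(1) by (simp add: w_def order_smult)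
  show "w \<le> 3"
    using w \<open>m \<le> 3\<close> by simp
  show "poly (T j 1) P = 0" if "j \<le> w" for j
    using that poly_hder_less[of j "Suc m" P q] q(1) unfolding T w m L_def by simp
  show "poly (T (Suc w) 1) P \<noteq> 0"
    using poly_hder_eq[of "Suc m" P q] q unfolding T w m L_def by simp
qed

text \<open>The derivative of \<open>Q\<close> differs from \<open>T 1 2\<close> by terms with the
  derivatives of \<open>A\<close> and \<open>B\<close>. After multiplication by one of
  \<open>A\<close>, \<open>B\<close> that is nonzero at \<open>P\<close>, these terms are
  combinations of \<open>Q\<close> and \<open>W\<close>. Near a common zero of \<open>Q\<close> and
  \<open>W\<close>, \<open>T 1 2\<close> can thus be computed from the derivative of
  \<open>Q\<close>.\<close>

lemma T_1_2_rel:
  obtains C \<mu> \<kappa> where "poly C P \<noteq> 0" "C * T 1 2 = C * pderiv Q - \<mu> * Q - \<kappa> * W"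
proof (cases "poly B P = 0")
  case False
  show ?thesis
    by (rule that[of B "2 * pderiv B" "2 * \<phi> 0 2 * A - \<phi> 1 1 * B", OF False])
      (unfold W_eq Q_eq T_1_2_eq, simp add: pderiv_add pderiv_diff pderiv_mult power2_eq_square algebra_simps)
next
  case True
  then have "poly A P \<noteq> 0"
    using no_common_zero by auto
  then show ?thesis
    by (rule that[of A "2 * pderiv A" "\<phi> 1 1 * A - 2 * \<phi> 2 0 * B"])
      (unfold W_eq Q_eq T_1_2_eq, simp add: pderiv_add pderiv_diff pderiv_mult power2_eq_square algebra_simps)
qed

text \<open>Near a ramification point \<open>P\<close> the slope \<open>- N / D\<close> of the inflectional tangent has at most a
  simple pole.\<close>

lemma slope_pole:
  assumes W: "W = g * D" and Q: "Q = g * N" and nc: "\<And>x. poly N x \<noteq> 0 \<or> poly D x \<noteq> 0"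
    and R: "S 3 N D = 0" and D: "poly D P = 0"
  shows "order P D = 1 \<and> (order P W = 2 \<and> poly (T 1 2) P \<noteq> 0 \<or>
    order P W = 3 \<and> poly (T 1 2) P = 0 \<and> poly (T 0 3) P \<noteq> 0)"
proof -
  define L where "L = [:- P, 1:]"
  have L: "poly L P = 0" "L \<noteq> 0"
    by (auto simp: L_def)
  have g0: "g \<noteq> 0" and D0: "D \<noteq> 0"
    using W W_nonzero by auto
  have N: "poly N P \<noteq> 0"
    using nc D by auto
  define m e where "m = order P g" and "e = order P D"
  obtain \<gamma> where \<gamma>: "g = L ^ m * \<gamma>" "poly \<gamma> P \<noteq> 0"
    unfolding L_def m_def by (rule order_factor[OF g0])
  obtain \<delta> where \<delta>: "D = L ^ e * \<delta>" "poly \<delta> P \<noteq> 0"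
    unfolding L_def e_def by (rule order_factor[OF D0])
  have e: "e \<ge> 1"
    using D D0 order_root[of D P] by (auto simp: e_def)
  have w: "order P W = m + e"
    unfolding W m_def e_def using g0 D0 by (intro order_mult) auto
  then have le: "m + e \<le> 3"
    using T_at_ramification(1)[of P] by simp
  define V where "V = smult (of_nat (m + e)) (\<gamma> * \<delta>) + L * pderiv (\<gamma> * \<delta>)"
  have VP: "poly V P = of_nat (m + e) * poly \<gamma> P * poly \<delta> P"
    by (simp add: V_def L)
  have W': "W = L ^ Suc (m + e - 1) * (\<gamma> * \<delta>)"
    unfolding W \<gamma>(1) \<delta>(1) using e by (simp add: power_add mult_ac)
  have "pderiv W = L ^ (m + e - 1) * V"
    unfolding V_def using pderiv_linear_power_mult[of P "m + e - 1" "\<gamma> * \<delta>"] W' e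
    by (simp add: L_def)
  then have V: "L ^ (m + e - 1) * V = 2 * T 2 1"
    unfolding pderiv_W by (simp add: numeral_mult_conv_smult)
  have "L ^ (m + e - 1) * V * N^2 - 2 * T 1 2 * N * D + 2 * T 0 3 * D^2 = 2 * S 3 N D"
    unfolding V S_3 by (simp add: algebra_simps)
  then have E: "L ^ (m + e - 1) * V * N^2 - 2 * T 1 2 * N * (L ^ e * \<delta>) + 2 * T 0 3 * (L ^ e * \<delta>)^2 = 0"
    using R unfolding \<delta>(1)[symmetric] by simp
  have cancel: "poly X P = 0" if "L ^ k * X = 0" for k X
    using that L by simp
  obtain C \<mu> \<kappa> where rel: "poly C P \<noteq> 0" "C * T 1 2 = C * pderiv Q - \<mu> * Q - \<kappa> * W"
    by (rule T_1_2_rel)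
  \<comment> \<open>In each case the lowest power of \<open>L\<close> occurring in \<open>E\<close>
    is cancelled, and the rest is evaluated at \<open>P\<close>.\<close>
  consider "m = 0" | "m = 1" "e = 1" | "m = 1" "e = 2" | "m = 2" "e = 1"
    using le e by linarith
  then show ?thesis
  proof cases
    case 1
    obtain i where i: "e = Suc i"
      using e by (cases e) auto
    have "L ^ i * (V * N^2 - 2 * T 1 2 * N * L * \<delta> + 2 * T 0 3 * (L ^ i * L * L) * \<delta>^2) = 0"
      unfolding E[symmetric] 1 i by (simp add: algebra_simps power2_eq_square)
    from cancel[OF this] have "poly V P * poly N P ^ 2 = 0"
      using L by simp
    then show ?thesis
      using VP N \<gamma> \<delta> e 1 by simp
  next
    case 2
    have "L ^ 1 * (V * N^2 - 2 * T 1 2 * N * \<delta> + 2 * T 0 3 * L * \<delta>^2) = 0"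
      unfolding E[symmetric] 2 by (simp add: algebra_simps power2_eq_square)
    from cancel[OF this] have "poly V P * poly N P ^ 2 = 2 * poly (T 1 2) P * poly N P * poly \<delta> P"
      using L by simp
    then have "poly (T 1 2) P \<noteq> 0"
      using VP N \<gamma> \<delta> 2 by auto
    then show ?thesis
      using w 2 by (simp add: e_def)
  next
    case 3
    have "L ^ 2 * (V * N^2 - 2 * T 1 2 * N * \<delta> + 2 * T 0 3 * L ^ 2 * \<delta>^2) = 0"
      unfolding E[symmetric] 3 by (simp add: algebra_simps power2_eq_square)
    from cancel[OF this] have "poly V P * poly N P ^ 2 = 2 * poly (T 1 2) P * poly N P * poly \<delta> P"
      using L by simp
    \<comment> \<open>The 3 is the order of \<open>W\<close>. As \<open>Q\<close> has a simple zero
      here, \<open>T_1_2_rel\<close> gives \<open>T 1 2 = \<gamma> * N\<close> at \<open>P\<close>,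
      and the equation would read 3 = 2.\<close>
    then have 1: "3 * poly \<gamma> P * poly N P = 2 * poly (T 1 2) P"
      using VP N \<delta>(2) 3 by (simp add: power2_eq_square mult.assoc)
    have QL: "Q = L ^ Suc 0 * (\<gamma> * N)"
      using Q \<gamma>(1) 3 by (simp add: mult_ac)
    then have "pderiv Q = smult 1 (\<gamma> * N) + L * pderiv (\<gamma> * N)"
      using pderiv_linear_power_mult[of P 0 "\<gamma> * N"] by (simp add: L_def)
    then have "poly (pderiv Q) P = poly \<gamma> P * poly N P"
      by (simp add: L)
    moreover have "poly Q P = 0" "poly W P = 0"
      using QL W' by (simp_all add: L)
    moreover have "poly C P * poly (T 1 2) P = poly C P * poly (pderiv Q) P - poly \<mu> P * poly Q P - poly \<kappa> P * poly W P"
      using arg_cong[OF rel(2), of "\<lambda>p. poly p P"] by simp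
    ultimately have "poly (T 1 2) P = poly \<gamma> P * poly N P"
      using rel(1) by simp
    then have False
      using 1 N \<gamma> by simp
    then show ?thesis ..
  next
    case 4
    have "L ^ 1 * (L * V * N^2 - 2 * T 1 2 * N * \<delta> + 2 * T 0 3 * L * \<delta>^2) = 0"
      unfolding E[symmetric] 4 by (simp add: algebra_simps power2_eq_square)
    from cancel[OF this] have T12: "poly (T 1 2) P = 0"
      using L N \<delta> by simp
    then obtain \<tau> where \<tau>: "T 1 2 = L * \<tau>"
      unfolding L_def by (metis dvdE poly_eq_0_iff_dvd)
    have "L ^ 2 * (V * N^2 - 2 * \<tau> * N * \<delta> + 2 * T 0 3 * \<delta>^2) = 0"
      unfolding E[symmetric] 4 \<tau> by (simp add: algebra_simps power2_eq_square)
    from cancel[OF this] have 1: "3 * poly \<gamma> P * poly \<delta> P * poly N P ^ 2 - 2 * poly \<tau> P * poly N P * poly \<delta> P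
        + 2 * poly (T 0 3) P * poly \<delta> P ^ 2 = 0"
      using VP 4 by simp
    have QL: "Q = L ^ Suc 1 * (\<gamma> * N)"
      using Q \<gamma>(1) 4 by (simp add: mult_ac power2_eq_square)
    then have dQ: "pderiv Q = L * (smult 2 (\<gamma> * N) + L * pderiv (\<gamma> * N))"
      using pderiv_linear_power_mult[of P 1 "\<gamma> * N"] by (simp add: L_def)
    have WL: "W = L ^ 3 * (\<gamma> * \<delta>)"
      using W' 4 by (simp add: numeral_3_eq_3)
    have "L * (C * \<tau>) = L * (C * (smult 2 (\<gamma> * N) + L * pderiv (\<gamma> * N)) - \<mu> * L * \<gamma> * N - \<kappa> * L^2 * \<gamma> * \<delta>)"
      using rel(2) unfolding dQ \<tau> unfolding QL WL
      by (simp add: algebra_simps power2_eq_square power3_eq_cube)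
    then have "C * \<tau> = C * (smult 2 (\<gamma> * N) + L * pderiv (\<gamma> * N)) - \<mu> * L * \<gamma> * N - \<kappa> * L^2 * \<gamma> * \<delta>"
      using L by (simp only: mult_cancel_left) simp
    from arg_cong[OF this, of "\<lambda>p. poly p P"] have "poly \<tau> P = 2 * poly \<gamma> P * poly N P"
      using rel(1) L by simp
    \<comment> \<open>Now \<open>Q\<close> has a double zero, which makes \<open>\<tau>\<close>
      equal to \<open>2 * \<gamma> * N\<close> at \<open>P\<close>. The two terms without
      \<open>T 0 3\<close> have coefficients 3 and -4 and do not cancel.\<close>
    with 1 have "poly \<delta> P * (2 * poly (T 0 3) P * poly \<delta> P - poly \<gamma> P * poly N P ^ 2) = 0"
      by (simp add: algebra_simps power2_eq_square)
    then have "poly (T 0 3) P \<noteq> 0"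
      using N \<gamma> \<delta> by auto
    then show ?thesis
      using w 4 T12 by (simp add: e_def)
  qed
qed

end

section \<open>Lines through one point; the count at third order\<close>

context quintic_line
begin

definition fib :: "'k \<Rightarrow> 'k set" where
  "fib P = {a. (P, a) \<in> lines}"

lemma fib_jet: "a \<in> fib P \<Longrightarrow> n \<in> {2..5} \<Longrightarrow> jet n P a = 0"
  by (auto simp: fib_def lines_def)

lemma jet_roots:
  assumes k: "k < n" "poly (T k (n - k)) P \<noteq> 0"
    and z: "\<And>j. k < j \<Longrightarrow> j < n \<Longrightarrow> poly (T j (n - j)) P = 0"
  shows "finite {a. jet n P a = 0}" "card {a. jet n P a = 0} \<le> k"
proof -
  define r where "r = (\<Sum>j\<le>k. monom (poly (T j (n - j)) P) j)"
  have r: "poly r a = jet n P a" for a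
  proof -
    have "jet n P a = (\<Sum>j\<le>k. poly (T j (n - j)) P * a ^ j)"
      unfolding jet_def by (rule sum.mono_neutral_right) (use k z in auto)
    then show ?thesis
      by (simp add: r_def poly_sum poly_monom)
  qed
  have "coeff r k = poly (T k (n - k)) P"
    by (simp add: r_def coeff_sum)
  then have "r \<noteq> 0"
    using k by auto
  then have "finite {a. poly r a = 0}" "card {a. poly r a = 0} \<le> degree r"
    by (auto intro: poly_roots_finite card_poly_roots_bound)
  moreover have "degree r \<le> k"
    unfolding r_def by (intro degree_sum_le) (auto intro: order_trans[OF degree_monom_le])
  ultimately show "finite {a. jet n P a = 0}" "card {a. jet n P a = 0} \<le> k"
    unfolding r by auto
qed

text \<open>With \<open>w\<close> the order of \<open>W\<close>, the jet of order
  \<open>w + 2\<close> is the one whose top coefficient in the slope is \<open>T (w + 1) 1\<close>,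
  known to be nonzero.\<close>

lemma jet_roots_lead:
  shows "finite {a. jet (order P W + 2) P a = 0}"
    and "card {a. jet (order P W + 2) P a = 0} \<le> order P W + 1"
  using jet_roots[of "order P W + 1" "order P W + 2" P] T_at_ramification(3)[of P] by auto

lemma fib_subset: "n \<in> {2..5} \<Longrightarrow> fib P \<subseteq> {a. jet n P a = 0}"
  using fib_jet by auto

lemma finite_fib: "finite (fib P)" and card_fib: "card (fib P) \<le> order P W + 1"
proof -
  have sub: "fib P \<subseteq> {a. jet (order P W + 2) P a = 0}"
    using T_at_ramification(1)[of P] by (intro fib_subset) auto
  show "finite (fib P)"
    using sub jet_roots_lead(1) by (rule finite_subset)
  show "card (fib P) \<le> order P W + 1"
    using card_mono[OF jet_roots_lead(1) sub] jet_roots_lead(2)[of P] by simp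
qed

lemma lines_finite_support:
  assumes "finite Z" "\<And>P. fib P \<noteq> {} \<Longrightarrow> P \<in> Z"
  shows "finite lines" "card lines = (\<Sum>P\<in>Z. card (fib P))"
proof -
  have eq: "lines = Sigma Z fib"
    using assms(2) by (fastforce simp: fib_def)
  show "finite lines"
    unfolding eq using assms(1) finite_fib by auto
  show "card lines = (\<Sum>P\<in>Z. card (fib P))"
    unfolding eq using assms(1) finite_fib by (intro card_SigmaI) auto
qed

lemma degree_Q: "degree Q \<le> 11"
proof -
  have "degree (\<phi> 2 0) \<le> 3" "degree (\<phi> 1 1) \<le> 3" "degree (\<phi> 0 2) \<le> 3"
    using degree_\<phi>[of 2 0] degree_\<phi>[of 1 1] degree_\<phi>[of 0 2] by auto
  moreover have "degree (A ^ 2) \<le> 8" "degree (B ^ 2) \<le> 8" "degree (A * B) \<le> 8"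
    using degree_power_le[of A 2] degree_power_le[of B 2] degree_mult_le[of A B] degree_A degree_B
    by auto
  moreover have "degree (p * q) \<le> 11" if "degree p \<le> 3" "degree q \<le> 8" for p q :: "'k poly"
    using degree_mult_le[of p q] that by linarith
  ultimately show ?thesis
    unfolding Q_eq mult.assoc by (intro degree_add_le degree_diff_le) auto
qed

lemma S_2: "S 2 N D = Q * D - W * N"
  by (simp add: S_def eval_nat_numeral algebra_simps)

lemma degree_R: "degree (S 3 Q W) \<le> 26"
proof -
  have "S m Q W = 0" if "2 \<le> m" "m < 3" for m
  proof -
    have "m = 2"
      using that by simp
    then show ?thesis
      by (simp add: S_2)
  qed
  then show ?thesis
    using degree_S[of 3 Q 6 W] degree_Q degree_W W_nonzero by simp
qed

text \<open>At a root of \<open>W\<close> of order w > 0, a line can exist only if \<open>Q\<close>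
  vanishes too. Then each term of \<open>S 3 Q W\<close>, in particular the one with the derivative
  of \<open>W\<close> and \<open>Q^2\<close>, has order at least w + 1, the bound for the number of
  slopes.\<close>

lemma card_fib_le_order_R:
  assumes R: "S 3 Q W \<noteq> 0"
  shows "card (fib P) \<le> order P (S 3 Q W)"
proof (cases "fib P = {}")
  case False
  then obtain a where a: "a \<in> fib P"
    by blast
  have j2: "poly Q P + poly W P * a = 0"
    using fib_jet[OF a, of 2] by (simp add: jet_def eval_nat_numeral)
  show ?thesis
  proof (cases "order P W")
    case 0
    then have WP: "poly W P \<noteq> 0"
      using W_nonzero order_root[of W P] by auto
    have "a = - poly Q P / poly W P"
      using j2 WP by (simp add: field_simps add_eq_0_iff)
    then have "poly (S 3 Q W) P = 0"
      using poly_S[OF WP, of 3 Q] fib_jet[OF a, of 3] by simp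
    then show ?thesis
      using R card_fib[of P] 0 order_root[of "S 3 Q W" P] by auto
  next
    case (Suc w)
    define L where "L = [:- P, 1:]"
    obtain W1 where W1: "W = L ^ Suc w * W1"
      using order_factor[OF W_nonzero, of P] Suc unfolding L_def by metis
    then have "poly W P = 0"
      by (simp add: L_def)
    then have "poly Q P = 0"
      using j2 by simp
    then obtain Q1 where Q1: "Q = L * Q1"
      unfolding L_def by (metis dvdE poly_eq_0_iff_dvd)
    define V where "V = smult (of_nat (Suc w)) W1 + L * pderiv W1"
    have "L ^ w * V = smult 2 (T 2 1)"
      unfolding V_def pderiv_W[symmetric]
      using pderiv_linear_power_mult[of P w W1] W1 by (simp add: L_def)
    then have V: "L ^ w * V = 2 * T 2 1"
      by (simp add: numeral_mult_conv_smult)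
    have "2 * S 3 Q W = L ^ w * V * Q^2 - 2 * T 1 2 * Q * W + 2 * T 0 3 * W^2"
      unfolding V S_3 by (simp add: algebra_simps)
    also have "\<dots> = L ^ (w + 2) * (V * Q1^2 - 2 * T 1 2 * Q1 * W1 + 2 * T 0 3 * L ^ w * W1^2)"
      unfolding Q1 unfolding W1 by (simp add: algebra_simps power2_eq_square power_add)
    finally have "L ^ (w + 2) dvd smult 2 (S 3 Q W)"
      by (metis dvd_triv_left numeral_mult_conv_smult)
    then have "L ^ (w + 2) dvd S 3 Q W"
      by (metis dvd_smult_cancel zero_neq_numeral)
    then have "w + 2 \<le> order P (S 3 Q W)"
      using R unfolding L_def order_divides by auto
    then show ?thesis
      using card_fib[of P] Suc by simp
  qed
qed simp

lemma card_lines_first_kind: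
  assumes R: "S 3 Q W \<noteq> 0"
  shows "finite lines" "card lines \<le> 26"
proof -
  define Z where "Z = {P. poly (S 3 Q W) P = 0}"
  have Z: "finite Z"
    unfolding Z_def using R by (rule poly_roots_finite)
  have supp: "P \<in> Z" if "fib P \<noteq> {}" for P
    using card_fib_le_order_R[OF R, of P] that finite_fib[of P] R order_root[of "S 3 Q W" P]
    by (auto simp: Z_def card_gt_0_iff)
  show "finite lines"
    using lines_finite_support(1)[OF Z supp] .
  have "card lines = (\<Sum>P\<in>Z. card (fib P))"
    by (rule lines_finite_support(2)[OF Z supp])
  also have "\<dots> \<le> (\<Sum>P\<in>Z. order P (S 3 Q W))"
    by (intro sum_mono card_fib_le_order_R R)
  also have "\<dots> \<le> degree (S 3 Q W)"
    unfolding Z_def by (rule sum_order_le_degree[OF R])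
  finally show "card lines \<le> 26"
    using degree_R by simp
qed

end

text \<open>To be applied with \<open>a\<close> the inflectional slope: it is a known one among the
  at most \<open>Suc k\<close> candidates, and it counts only if it really belongs to a
  line.\<close>

lemma card_le_minus_if_extra:
  assumes "finite Z" "card Z \<le> Suc k" "F \<subseteq> Z" "a \<in> Z"
  shows "card F \<le> k + (if a \<in> F then 1 else 0)"
proof (cases "a \<in> F")
  case True
  then show ?thesis
    using card_mono[OF assms(1,3)] assms(2) by simp
next
  case False
  then have "F \<subset> Z"
    using assms by blast
  then show ?thesis
    using psubset_card_mono[OF assms(1), of F] assms(2) False by simp
qed

lemma card_roots_le_degree_double:
  fixes p :: "'a::idom poly"
  assumes p: "p \<noteq> 0" and "[:- c, 1:] ^ 2 dvd p"
  shows "card {x. poly p x = 0} + 1 \<le> degree p"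
proof -
  let ?Z = "{x. poly p x = 0}"
  have fin: "finite ?Z"
    using p by (rule poly_roots_finite)
  have c2: "2 \<le> order c p"
    using assms order_divides by blast
  then have c: "c \<in> ?Z"
    using order_root[of p c] by auto
  have "card ?Z + 1 = card (?Z - {c}) + 2"
    using card_Suc_Diff1[OF fin c] by simp
  also have "\<dots> \<le> (\<Sum>x\<in>?Z - {c}. order x p) + order c p"
  proof -
    have "(\<Sum>x\<in>?Z - {c}. 1) \<le> (\<Sum>x\<in>?Z - {c}. order x p)"
    proof (rule sum_mono)
      fix x
      assume "x \<in> ?Z - {c}"
      then show "1 \<le> order x p"
        using order_root[of p x] p by auto
    qed
    then show ?thesis
      using c2 by simp
  qed
  also have "\<dots> = (\<Sum>x\<in>?Z. order x p)"
    using fin c by (simp add: sum.remove)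
  also have "\<dots> \<le> degree p"
    by (rule sum_order_le_degree[OF p])
  finally show ?thesis .
qed

section \<open>Lines of the second kind: the counts at orders 4 and 5\<close>

context quintic_line
begin

text \<open>These are roots of \<open>W\<close> at which the estimate \<open>local_bound_4\<close>
  has a unit to spare. A root of order 2 with \<open>T 1 2\<close> nonzero may be a pole of the
  slope, where the estimate leaves no slack.\<close>

definition tame :: "'k set" where
  "tame = {P. poly W P = 0 \<and> \<not> (order P W = 2 \<and> poly (T 1 2) P \<noteq> 0)}"

lemma order_W_pos: "poly W P = 0 \<longleftrightarrow> order P W > 0"
  using order_root[of W P] W_nonzero by simp

lemma sum_order_W: "(\<Sum>P | poly W P = 0. order P W) = 6"
  using sum_order_eq_degree[OF W_nonzero] degree_W by simp

lemma finite_roots_W: "finite {P. poly W P = 0}"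
  using W_nonzero by (rule poly_roots_finite)

end

text \<open>All inflectional tangents have contact of higher order, so the third-order term says
  nothing. The slope must be in lowest terms, since a common factor of \<open>N\<close> and
  \<open>D\<close> would add zeros to the next terms that come from no line.\<close>

locale second_kind_line = quintic_line \<phi>
  for \<phi> :: "nat \<Rightarrow> nat \<Rightarrow> 'k::{alg_closed_field,field_char_0} poly" +
  fixes g N D :: "'k poly"
  assumes W_fac: "W = g * D" and Q_fac: "Q = g * N"
    and ND: "poly N x \<noteq> 0 \<or> poly D x \<noteq> 0"
    and R_zero: "S 3 N D = 0"
begin

lemma D_nonzero: "D \<noteq> 0" and g_nonzero: "g \<noteq> 0"
  using W_fac W_nonzero by auto

lemma S_2_zero: "S 2 N D = 0"
  unfolding S_2 W_fac Q_fac by simp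

lemma degree_N: "degree N \<le> 5 + degree D"
proof (cases "N = 0")
  case False
  have "degree g + degree D = 6"
    using degree_W degree_mult_eq[OF g_nonzero D_nonzero] W_fac by simp
  moreover have "degree g + degree N \<le> 11"
    using degree_Q degree_mult_eq[OF g_nonzero False] Q_fac by simp
  ultimately show ?thesis
    by simp
qed simp

lemma degree_S_4: "degree (S 4 N D) \<le> 17 + 3 * degree D"
proof -
  have "S m N D = 0" if "2 \<le> m" "m < 4" for m
  proof -
    have "m = 2 \<or> m = 3"
      using that by auto
    then show ?thesis
      using S_2_zero R_zero by auto
  qed
  then show ?thesis
    using degree_S[of 4 N "degree D" D] degree_N D_nonzero by (simp add: mult.commute)
qed

lemma degree_S_5:
  assumes "S 4 N D = 0"
  shows "degree (S 5 N D) \<le> 20 + 4 * degree D"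
proof -
  have "S m N D = 0" if "2 \<le> m" "m < 5" for m
  proof -
    have "m = 2 \<or> m = 3 \<or> m = 4"
      using that by auto
    then show ?thesis
      using S_2_zero R_zero assms by auto
  qed
  then show ?thesis
    using degree_S[of 5 N "degree D" D] degree_N D_nonzero by (simp add: mult.commute)
qed

definition slope :: "'k \<Rightarrow> 'k" where
  "slope P = - poly N P / poly D P"

lemma jet_slope:
  assumes "poly D P \<noteq> 0"
  shows "jet n P (slope P) = 0 \<longleftrightarrow> poly (S n N D) P = 0"
  unfolding slope_def using poly_S[OF assms, of n N] assms by simp

lemma slope_in_fib:
  assumes "poly D P \<noteq> 0" "slope P \<in> fib P"
  shows "poly (S 4 N D) P = 0" "poly (S 5 N D) P = 0"
  using fib_jet[OF assms(2)] jet_slope[OF assms(1)] by auto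

lemma pole:
  assumes "poly D P = 0"
  shows "order P D = 1 \<and> (order P W = 2 \<and> poly (T 1 2) P \<noteq> 0 \<or>
    order P W = 3 \<and> poly (T 1 2) P = 0 \<and> poly (T 0 3) P \<noteq> 0)"
  using W_fac Q_fac ND R_zero assms by (rule slope_pole)

lemma order_D_0: "poly D P \<noteq> 0 \<Longrightarrow> order P D = 0"
  by (rule order_0I)

text \<open>At a pole \<open>T 2 1\<close> vanishes, so \<open>jet 3\<close> has degree 1 in the
  slope if \<open>T 1 2\<close> is nonzero, and is otherwise the nonzero constant
  \<open>T 0 3\<close>.\<close>

lemma card_fib_pole:
  assumes "poly D P = 0"
  shows "card (fib P) \<le> 3 - order P W"
proof -
  have T21: "poly (T 2 1) P = 0"
    using pole[OF assms] T_at_ramification(2)[of 2 P] by auto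
  consider "order P W = 2" "poly (T 1 2) P \<noteq> 0"
    | "order P W = 3" "poly (T 1 2) P = 0" "poly (T 0 3) P \<noteq> 0"
    using pole[OF assms] by blast
  then show ?thesis
  proof cases
    case 1
    have z: "poly (T j (3 - j)) P = 0" if "1 < j" "j < 3" for j
    proof -
      have "j = 2"
        using that by simp
      then show ?thesis
        using T21 by simp
    qed
    have *: "finite {a. jet 3 P a = 0}" "card {a. jet 3 P a = 0} \<le> 1"
      using jet_roots[of 1 3 P, OF _ _ z] 1 by auto
    show ?thesis
      using card_mono[OF *(1) fib_subset[of 3 P]] *(2) 1 by simp
  next
    case 2
    have z: "poly (T j (3 - j)) P = 0" if "0 < j" "j < 3" for j
    proof -
      have "j = 1 \<or> j = 2"
        using that by auto
      then show ?thesis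
        using T21 2 by auto
    qed
    have *: "finite {a. jet 3 P a = 0}" "card {a. jet 3 P a = 0} \<le> 0"
      using jet_roots[of 0 3 P, OF _ _ z] 2 by auto
    show ?thesis
      using card_mono[OF *(1) fib_subset[of 3 P]] *(2) 2 by simp
  qed
qed

text \<open>Under the hypothesis on \<open>S\<close>, the inflectional slope is one of the at most
  \<open>order P W + 1\<close> roots of the jet that bounds the fibre. If it belongs to a line, then
  \<open>S 4 N D\<close> and \<open>S 5 N D\<close> vanish at \<open>P\<close> as well.\<close>

lemma card_fib_regular:
  assumes D: "poly D P \<noteq> 0" and S: "S (order P W + 2) N D = 0"
  shows "card (fib P) \<le> order P W + (if poly (S 4 N D) P = 0 \<and> poly (S 5 N D) P = 0 then 1 else 0)"
proof -
  have "card (fib P) \<le> order P W + (if slope P \<in> fib P then 1 else 0)"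
  proof (rule card_le_minus_if_extra)
    show "finite {a. jet (order P W + 2) P a = 0}" "card {a. jet (order P W + 2) P a = 0} \<le> Suc (order P W)"
      using jet_roots_lead by auto
    show "fib P \<subseteq> {a. jet (order P W + 2) P a = 0}"
      using T_at_ramification(1)[of P] by (intro fib_subset) auto
    show "slope P \<in> {a. jet (order P W + 2) P a = 0}"
      using jet_slope[OF D] S by simp
  qed
  then show ?thesis
    using slope_in_fib[OF D] by (auto split: if_splits)
qed

text \<open>The shape is made for summation: the orders of \<open>W\<close> add up to 6, those of
  \<open>D\<close> to its degree, and \<open>S 4 N D\<close> has at most
  \<open>17 + 3 * degree D\<close> roots. The degree of \<open>D\<close> cancels and 12 + 17 = 29
  bounds the lines together with the tame roots.\<close>

lemma local_bound_4:
  "card (fib P) + 3 * order P D + (if P \<in> tame then 1 else 0) \<le>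
    2 * order P W + (if poly (S 4 N D) P = 0 then 1 else 0)"
proof (cases "poly D P = 0")
  case True
  have "P \<notin> tame" if "order P W = 2"
    using pole[OF True] that by (auto simp: tame_def)
  then show ?thesis
    using pole[OF True] card_fib_pole[OF True] by auto
next
  case False
  have w: "order P W \<le> 3"
    by (rule T_at_ramification(1))
  show ?thesis
  proof (cases "order P W \<le> 1")
    case True
    then have "order P W + 2 = 2 \<or> order P W + 2 = 3"
      by auto
    then have "S (order P W + 2) N D = 0"
      using S_2_zero R_zero by metis
    from card_fib_regular[OF False this] show ?thesis
      using True order_W_pos[of P] order_D_0[OF False] by (auto simp: tame_def split: if_splits)
  next
    case w2: False
    then show ?thesis
      using card_fib[of P] w order_D_0[OF False] by auto
  qed
qed

text \<open>At a pole \<open>S 4 N D\<close> reduces to \<open>T 3 1 * (- N) ^ 3\<close>, which is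
  nonzero if \<open>W\<close> has order 2 there; so only poles at roots of order 3 remain. A root of
  order 3 costs one unit because its decisive jet has order 5, and \<open>S 5 N D\<close> is not
  assumed to vanish.\<close>

lemma local_bound_5:
  assumes S4: "S 4 N D = 0"
  shows "card (fib P) + 4 * order P D \<le>
    order P W + (if order P W = 3 then 1 else 0) + (if poly (S 5 N D) P = 0 then 1 else 0)"
proof (cases "poly D P = 0")
  case True
  have "order P W \<noteq> 2"
  proof
    assume w: "order P W = 2"
    have "poly (S 4 N D) P = poly (T 3 1) P * (- poly N P) ^ 3"
      using True by (simp add: S_def eval_nat_numeral)
    moreover have "poly (T 3 1) P \<noteq> 0"
      using T_at_ramification(3)[of P] w by (simp add: numeral_3_eq_3)
    moreover have "poly N P \<noteq> 0"
      using ND[of P] True by simp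
    ultimately show False
      using S4 by simp
  qed
  then show ?thesis
    using pole[OF True] card_fib_pole[OF True] by auto
next
  case False
  have w: "order P W \<le> 3"
    by (rule T_at_ramification(1))
  show ?thesis
  proof (cases "order P W \<le> 2")
    case True
    then have "order P W + 2 = 2 \<or> order P W + 2 = 3 \<or> order P W + 2 = 4"
      by auto
    then have "S (order P W + 2) N D = 0"
      using S_2_zero R_zero S4 by metis
    from card_fib_regular[OF False this] show ?thesis
      using True order_D_0[OF False] by (auto split: if_splits)
  next
    case w2: False
    then show ?thesis
      using card_fib[of P] w order_D_0[OF False] by auto
  qed
qed

lemma total_bounds:
  assumes S: "S n N D \<noteq> 0" and n: "n = 4 \<or> n = 5 \<and> S 4 N D = 0"
  defines "Z \<equiv> {P. poly W P = 0} \<union> {P. poly (S n N D) P = 0}"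
  shows "finite lines" "finite Z" "card lines = (\<Sum>P\<in>Z. card (fib P))"
    "(\<Sum>P\<in>Z. order P W) = 6" "(\<Sum>P\<in>Z. order P D) = degree D"
    "(\<Sum>P\<in>Z. if poly (S n N D) P = 0 then 1 else (0::nat)) = card {P. poly (S n N D) P = 0}"
proof -
  show Z: "finite Z"
    unfolding Z_def using finite_roots_W S poly_roots_finite by auto
  have supp: "P \<in> Z" if "fib P \<noteq> {}" for P
  proof (rule ccontr)
    assume P: "P \<notin> Z"
    then have "order P W = 0"
      using order_W_pos[of P] by (auto simp: Z_def)
    moreover have "poly (S n N D) P \<noteq> 0"
      using P by (auto simp: Z_def)
    ultimately have "card (fib P) = 0"
      using n local_bound_4[of P] local_bound_5[of P] by auto
    then show False
      using that finite_fib[of P] by simp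
  qed
  show "finite lines"
    by (rule lines_finite_support(1)[OF Z supp])
  show "card lines = (\<Sum>P\<in>Z. card (fib P))"
    by (rule lines_finite_support(2)[OF Z supp])
  have "(\<Sum>P\<in>Z. order P W) = (\<Sum>P | poly W P = 0. order P W)"
    by (rule sum.mono_neutral_right) (use Z order_W_pos in \<open>auto simp: Z_def\<close>)
  then show "(\<Sum>P\<in>Z. order P W) = 6"
    using sum_order_W by simp
  have "(\<Sum>P\<in>Z. order P D) = (\<Sum>P | poly D P = 0. order P D)"
    by (rule sum.mono_neutral_right) (use Z order_D_0 W_fac in \<open>auto simp: Z_def\<close>)
  then show "(\<Sum>P\<in>Z. order P D) = degree D"
    using sum_order_eq_degree[OF D_nonzero] by simp
  have "(\<Sum>P\<in>Z. if poly (S n N D) P = 0 then 1 else (0::nat)) = (\<Sum>P | poly (S n N D) P = 0. 1)"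
    by (rule sum.mono_neutral_cong_right) (use Z in \<open>auto simp: Z_def\<close>)
  then show "(\<Sum>P\<in>Z. if poly (S n N D) P = 0 then 1 else (0::nat)) = card {P. poly (S n N D) P = 0}"
    by simp
qed

lemma card_lines_4:
  assumes S: "S 4 N D \<noteq> 0"
  shows "finite lines" "card lines + card tame + 3 * degree D \<le> 12 + card {P. poly (S 4 N D) P = 0}"
proof -
  let ?Z = "{P. poly W P = 0} \<union> {P. poly (S 4 N D) P = 0}"
  have n: "(4::nat) = 4 \<or> (4::nat) = 5 \<and> S 4 N D = 0"
    by simp
  note tb = total_bounds[OF S n]
  show "finite lines"
    by (rule tb(1))
  have "(\<Sum>P\<in>?Z. if P \<in> tame then 1 else (0::nat)) = (\<Sum>P\<in>tame. 1)"
    by (rule sum.mono_neutral_cong_right) (use tb(2) in \<open>auto simp: tame_def\<close>)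
  then have ct: "(\<Sum>P\<in>?Z. if P \<in> tame then 1 else (0::nat)) = card tame"
    by simp
  have "(\<Sum>P\<in>?Z. card (fib P) + 3 * order P D + (if P \<in> tame then 1 else 0)) \<le>
      (\<Sum>P\<in>?Z. 2 * order P W + (if poly (S 4 N D) P = 0 then 1 else 0))"
    by (intro sum_mono local_bound_4)
  then show "card lines + card tame + 3 * degree D \<le> 12 + card {P. poly (S 4 N D) P = 0}"
    unfolding sum.distrib tb(6) ct tb(3)[symmetric] sum_distrib_left[symmetric] tb(4) tb(5) by simp
qed

lemma card_lines_5:
  assumes S: "S 5 N D \<noteq> 0" and S4: "S 4 N D = 0"
  shows "finite lines" "card lines \<le> 26 + card {P. order P W = 3}"
proof -
  let ?Z = "{P. poly W P = 0} \<union> {P. poly (S 5 N D) P = 0}"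
  have n: "(5::nat) = 4 \<or> (5::nat) = 5 \<and> S 4 N D = 0"
    using S4 by simp
  note tb = total_bounds[OF S n]
  show "finite lines"
    by (rule tb(1))
  have "(\<Sum>P\<in>?Z. if order P W = 3 then 1 else (0::nat)) = (\<Sum>P | order P W = 3. 1)"
  proof (rule sum.mono_neutral_cong_right)
    show "{P. order P W = 3} \<subseteq> ?Z"
    proof
      fix P
      assume "P \<in> {P. order P W = 3}"
      then show "P \<in> ?Z"
        using order_W_pos[of P] by simp
    qed
  qed (use tb(2) in auto)
  then have ct: "(\<Sum>P\<in>?Z. if order P W = 3 then 1 else (0::nat)) = card {P. order P W = 3}"
    by simp
  have "(\<Sum>P\<in>?Z. card (fib P) + 4 * order P D) \<le>
      (\<Sum>P\<in>?Z. order P W + (if order P W = 3 then 1 else 0) + (if poly (S 5 N D) P = 0 then 1 else 0))"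
    by (intro sum_mono local_bound_5 S4)
  then have "card lines + 4 * degree D \<le> 6 + card {P. order P W = 3} + card {P. poly (S 5 N D) P = 0}"
    unfolding sum.distrib tb(6) ct tb(3)[symmetric] sum_distrib_left[symmetric] tb(4) tb(5) by simp
  moreover have "card {P. poly (S 5 N D) P = 0} \<le> 20 + 4 * degree D"
    using card_poly_roots_bound[OF S] degree_S_5[OF S4] by simp
  ultimately show "card lines \<le> 26 + card {P. order P W = 3}"
    by simp
qed

text \<open>At a pole \<open>S 4 N D\<close> and \<open>S 5 N D\<close> are powers of
  \<open>N\<close> times \<open>T 3 1\<close> and \<open>T 4 1\<close>, one of which is nonzero.
  Hence there is no pole, \<open>D\<close> is constant, and the slope is a polynomial.\<close>

lemma ruled:
  assumes "S 4 N D = 0" "S 5 N D = 0"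
  obtains a P where "poly W P = 0" "\<And>p n. n \<in> {2..5} \<Longrightarrow> jet n p (poly a p) = 0"
proof -
  have D: "poly D P \<noteq> 0" for P
  proof
    assume D: "poly D P = 0"
    have N: "poly N P \<noteq> 0"
      using ND[of P] D by simp
    have "poly (S 4 N D) P = poly (T 3 1) P * (- poly N P) ^ 3"
      "poly (S 5 N D) P = poly (T 4 1) P * (- poly N P) ^ 4"
      using D by (simp_all add: S_def eval_nat_numeral)
    then have "poly (T 3 1) P = 0" "poly (T 4 1) P = 0"
      using N assms by auto
    moreover have "poly (T 3 1) P \<noteq> 0 \<or> poly (T 4 1) P \<noteq> 0"
      using pole[OF D] T_at_ramification(3)[of P] by (auto simp: eval_nat_numeral)
    ultimately show False
      by simp
  qed
  then have "degree D = 0"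
    using alg_closed_imp_poly_has_root[of D] by auto
  then obtain d where d: "D = [:d:]"
    by (rule degree_eq_zeroE)
  obtain P where P: "poly W P = 0"
    using alg_closed_imp_poly_has_root[of W] degree_W by auto
  have "jet n p (poly (smult (- inverse d) N) p) = 0" if n: "n \<in> {2..5}" for n p
  proof -
    have "n = 2 \<or> n = 3 \<or> n = 4 \<or> n = 5"
      using n by auto
    then have "S n N D = 0"
      using S_2_zero R_zero assms by auto
    then have "jet n p (slope p) = 0"
      using jet_slope[OF D] by simp
    then show ?thesis
      unfolding slope_def unfolding d by (simp add: divide_inverse mult.commute)
  qed
  with P show ?thesis
    using that by blast
qed

end

context quintic_line
begin

text \<open>In the application the plane \<open>w = 0\<close> cuts out, besides the given line, four
  lines through the third basis point. This makes the listed \<open>\<phi> k 0\<close> vanish, and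
  \<open>P\<close> is the point where one of the four meets the given line.\<close>

definition inflected :: bool where
  "inflected \<longleftrightarrow> (\<exists>P. poly A P = 0 \<and> poly W P \<noteq> 0 \<and> \<phi> 2 0 = 0 \<and> \<phi> 3 0 = 0 \<and> \<phi> 4 0 = 0 \<and>
     poly (\<phi> 3 1) P = 0)"

end

text \<open>At \<open>P\<close> the vanishing of \<open>A\<close> and \<open>\<phi> 2 0\<close>
  forces \<open>Q\<close>, hence \<open>N\<close>, to vanish. Each of the four terms of
  \<open>S 4 N D\<close> then contains two factors vanishing at \<open>P\<close>, taken from
  \<open>A\<close>, \<open>N\<close> and \<open>\<phi> 3 1\<close>. The double root lowers the
  number of distinct roots by one.\<close>

lemma (in second_kind_line) double_root_S_4:
  assumes inflected
  obtains P where "[:- P, 1:] ^ 2 dvd S 4 N D"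
proof -
  obtain P where P: "poly A P = 0" "poly W P \<noteq> 0" "poly (\<phi> 3 1) P = 0"
    and \<phi>: "\<phi> 2 0 = 0" "\<phi> 3 0 = 0" "\<phi> 4 0 = 0"
    using assms unfolding inflected_def by blast
  define L where "L = [:- P, 1:]"
  obtain A1 where A1: "A = L * A1"
    using P unfolding L_def by (metis dvdE poly_eq_0_iff_dvd)
  obtain \<psi> where \<psi>: "\<phi> 3 1 = L * \<psi>"
    using P unfolding L_def by (metis dvdE poly_eq_0_iff_dvd)
  have "poly Q P = 0"
    unfolding Q_eq using P \<phi> by simp
  moreover have "poly g P \<noteq> 0"
    using P(2) unfolding W_fac by auto
  ultimately have "poly N P = 0"
    unfolding Q_fac by simp
  then obtain N1 where N1: "N = L * N1"
    unfolding L_def by (metis dvdE poly_eq_0_iff_dvd)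
  have T04: "T 0 4 = L^2 * (\<phi> 2 2 * B^2 * A1^2 - \<psi> * B^3 * A1 - \<phi> 1 3 * B * L * A1^3 + \<phi> 0 4 * L^2 * A1^4)"
    unfolding T_def using \<phi> \<psi> by (simp add: A1[simplified] eval_nat_numeral algebra_simps)
  have T13: "T 1 3 = L * (pderiv (\<phi> 1 2) * B * L * A1^2 - pderiv (\<phi> 2 1) * B^2 * A1 - pderiv (\<phi> 0 3) * L^2 * A1^3)"
    unfolding T_def using \<phi> by (simp add: A1[simplified] eval_nat_numeral hder_1 algebra_simps)
  have "S 4 N D = T 0 4 * D^3 - T 1 3 * N * D^2 + T 2 2 * N^2 * D - T 3 1 * N^3"
    by (simp add: S_def eval_nat_numeral algebra_simps)
  also have "\<dots> = L^2 * ((\<phi> 2 2 * B^2 * A1^2 - \<psi> * B^3 * A1 - \<phi> 1 3 * B * L * A1^3 + \<phi> 0 4 * L^2 * A1^4) * D^3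
      - (pderiv (\<phi> 1 2) * B * L * A1^2 - pderiv (\<phi> 2 1) * B^2 * A1 - pderiv (\<phi> 0 3) * L^2 * A1^3) * N1 * D^2
      + T 2 2 * N1^2 * D - T 3 1 * L * N1^3)"
    unfolding T04 T13 N1 by (simp add: power2_eq_square power3_eq_cube algebra_simps)
  finally show ?thesis
    using that unfolding L_def by (metis dvd_triv_left)
qed

locale smooth_line = quintic_line \<phi>
  for \<phi> :: "nat \<Rightarrow> nat \<Rightarrow> 'k::{alg_closed_field,field_char_0} poly" +
  assumes not_ruled: "poly W P = 0 \<Longrightarrow> \<exists>p. \<exists>n\<in>{2..5}. jet n p (poly a p) \<noteq> 0"
begin

text \<open>The three bounds belong to the first of the terms of order 3, 4 and 5 that is not
  identically zero; \<open>not_ruled\<close> ensures that there is one.\<close>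

lemma trichotomy:
  "finite lines \<and> (card lines \<le> 26 \<or>
     card lines + card tame \<le> 29 \<and> (inflected \<longrightarrow> card lines \<le> 28) \<or>
     card lines \<le> 26 + card {P. order P W = 3})"
proof (cases "S 3 Q W = 0")
  case False
  then show ?thesis
    using card_lines_first_kind by simp
next
  case True
  obtain g D N where fac: "W = g * D" "Q = g * N" "\<And>x. poly D x \<noteq> 0 \<or> poly N x \<noteq> 0"
    using split_common_roots[OF W_nonzero] by metis
  have "g^2 * S 3 N D = S 3 Q W"
    unfolding S_3 fac by (simp add: power2_eq_square algebra_simps)
  moreover have "g \<noteq> 0"
    using fac(1) W_nonzero by auto
  ultimately have R: "S 3 N D = 0"
    using True by simp
  interpret second_kind_line \<phi> g N D
    using fac R by unfold_locales auto
  show ?thesis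
  proof (cases "S 4 N D = 0")
    case S4: False
    have c: "card {P. poly (S 4 N D) P = 0} + (if inflected then 1 else 0) \<le> 17 + 3 * degree D"
    proof (cases inflected)
      case True
      then obtain P where "[:- P, 1:] ^ 2 dvd S 4 N D"
        by (rule double_root_S_4)
      then show ?thesis
        using card_roots_le_degree_double[OF S4] degree_S_4 by fastforce
    next
      case False
      then show ?thesis
        using card_poly_roots_bound[OF S4] degree_S_4 by simp
    qed
    show ?thesis
      using card_lines_4[OF S4] c by (auto split: if_splits)
  next
    case S4: True
    have "S 5 N D \<noteq> 0"
    proof
      assume "S 5 N D = 0"
      then obtain a P where "poly W P = 0" "\<And>p n. n \<in> {2..5} \<Longrightarrow> jet n p (poly a p) = 0"
        using ruled[OF S4] by metis
      then show False
        using not_ruled[of P a] by blast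
    qed
    then show ?thesis
      using card_lines_5 S4 by simp
  qed
qed

lemma finite_lines: "finite lines"
  using trichotomy by simp

lemma order_3_subset: "{P. order P W = 3} \<subseteq> {P. poly W P = 0}"
proof
  fix P
  assume "P \<in> {P. order P W = 3}"
  then show "P \<in> {P. poly W P = 0}"
    using order_W_pos[of P] by simp
qed

lemma order_3_bound: "3 * card {P. order P W = 3} + (\<Sum>P\<in>{P. poly W P = 0} - {P. order P W = 3}. order P W) = 6"
proof -
  have "(\<Sum>P | order P W = 3. order P W) = 3 * card {P. order P W = 3}"
    by simp
  then show ?thesis
    using sum.subset_diff[OF order_3_subset finite_roots_W, of "\<lambda>P. order P W"] sum_order_W by simp
qed

lemma card_lines_le_29: "card lines \<le> 29"
  using trichotomy order_3_bound by linarith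

lemma tame_subset: "tame \<subseteq> {P. poly W P = 0}" and finite_tame: "finite tame"
proof -
  show "tame \<subseteq> {P. poly W P = 0}"
    by (auto simp: tame_def)
  then show "finite tame"
    using finite_roots_W by (rule finite_subset)
qed

lemma tame_sum: "2 * card ({P. poly W P = 0} - tame) + (\<Sum>P\<in>tame. order P W) = 6"
proof -
  have "(\<Sum>P\<in>{P. poly W P = 0} - tame. order P W) = (\<Sum>P\<in>{P. poly W P = 0} - tame. 2)"
    by (rule sum.cong) (auto simp: tame_def)
  then show ?thesis
    using sum.subset_diff[OF tame_subset finite_roots_W, of "\<lambda>P. order P W"] sum_order_W by simp
qed

text \<open>A simple root is tame. By parity in \<open>tame_sum\<close> it is not the only tame
  root, so the second alternative gives 29 - 2; in the third one, the degree left over admits at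
  most one root of order 3.\<close>

lemma simple_ramification:
  assumes "order P W = 1"
  shows "card lines \<le> 27"
proof -
  have P: "poly W P = 0"
    using assms order_W_pos[of P] by simp
  have "P \<in> tame"
    using P assms by (simp add: tame_def)
  have "card tame \<noteq> 1"
  proof
    assume "card tame = 1"
    then have "tame = {P}"
      using \<open>P \<in> tame\<close> by (metis card_1_singletonE singletonD)
    then have "2 * card ({P. poly W P = 0} - tame) + 1 = 6"
      using tame_sum assms by simp
    then show False
      by presburger
  qed
  moreover have "card tame \<noteq> 0"
    using \<open>P \<in> tame\<close> finite_tame by auto
  moreover have "card {P. order P W = 3} \<le> 1"
  proof -
    have "order P W \<le> (\<Sum>P\<in>{P. poly W P = 0} - {P. order P W = 3}. order P W)"
      using P assms finite_roots_W by (intro member_le_sum) auto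
    then show ?thesis
      using order_3_bound assms by linarith
  qed
  ultimately show ?thesis
    using trichotomy by linarith
qed

text \<open>Two roots of order 3 exhaust the degree 6 of \<open>W\<close>. Otherwise only the second
  alternative reaches 28, with at most one tame root, and the order of that root is even by
  \<open>tame_sum\<close>.\<close>

lemma many_lines:
  assumes "28 \<le> card lines"
  shows "(\<forall>P. poly W P = 0 \<longrightarrow> order P W = 2) \<or> (\<forall>P. poly W P = 0 \<longrightarrow> order P W = 3)"
proof (cases "card {P. order P W = 3} \<ge> 2")
  case True
  then have "(\<Sum>P\<in>{P. poly W P = 0} - {P. order P W = 3}. order P W) = 0"
    using order_3_bound by linarith
  then have *: "\<forall>P\<in>{P. poly W P = 0} - {P. order P W = 3}. order P W = 0"
    unfolding sum_eq_0_iff[OF finite_Diff[OF finite_roots_W]] .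
  have "order P W = 3" if "poly W P = 0" for P
  proof (rule ccontr)
    assume "order P W \<noteq> 3"
    then have "P \<in> {P. poly W P = 0} - {P. order P W = 3}"
      using that by simp
    with * have "order P W = 0"
      by (rule bspec)
    moreover have "order P W > 0"
      using that unfolding order_W_pos .
    ultimately show False
      by simp
  qed
  then show ?thesis
    by blast
next
  case False
  then have c: "card tame \<le> 1"
    using trichotomy assms by linarith
  have "order P W = 2" if P: "poly W P = 0" for P
  proof (cases "P \<in> tame")
    case True
    then have "tame = {P}"
      using c card_le_Suc0_iff_eq[OF finite_tame] by auto
    then have "2 * card ({P. poly W P = 0} - tame) + order P W = 6"
      using tame_sum by simp
    moreover have "order P W \<le> 3" "order P W \<ge> 1"
      using T_at_ramification(1)[of P] order_W_pos[of P] P by auto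
    ultimately show ?thesis
      by presburger
  next
    case False
    then show ?thesis
      using P by (simp add: tame_def)
  qed
  then show ?thesis
    by blast
qed

text \<open>Only the second alternative of \<open>trichotomy\<close> reaches 29, and only without
  tame roots.\<close>

lemma most_lines:
  assumes "29 \<le> card lines"
  shows "poly W P = 0 \<Longrightarrow> order P W = 2" "poly W P = 0 \<Longrightarrow> poly (T 1 2) P \<noteq> 0" "\<not> inflected"
proof -
  have "card {P. order P W = 3} \<le> 2"
    using order_3_bound by linarith
  then have "card lines + card tame \<le> 29 \<and> (inflected \<longrightarrow> card lines \<le> 28)"
    using trichotomy assms by auto
  then have c: "card tame = 0" and i: "\<not> inflected"
    using assms by auto
  then have "tame = {}"
    using finite_tame by simp
  then show "poly W P = 0 \<Longrightarrow> order P W = 2" "poly W P = 0 \<Longrightarrow> poly (T 1 2) P \<noteq> 0" "\<not> inflected"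
    using i by (auto simp: tame_def)
qed

end

section \<open>Invariants of binary quartics on the pencil\<close>

definition quartic_I :: "'a::comm_ring_1 poly \<Rightarrow> 'a" where
  "quartic_I p = 12 * coeff p 4 * coeff p 0 - 3 * coeff p 3 * coeff p 1 + coeff p 2 ^ 2"

definition quartic_I_polar :: "'a::comm_ring_1 poly \<Rightarrow> 'a poly \<Rightarrow> 'a" where
  "quartic_I_polar p q = 12 * (coeff p 4 * coeff q 0 + coeff p 0 * coeff q 4)
     - 3 * (coeff p 3 * coeff q 1 + coeff p 1 * coeff q 3) + 2 * coeff p 2 * coeff q 2"

text \<open>Together with \<open>quartic_I\<close> these are the classical invariants of degrees 2
  and 3. For four distinct roots, \<open>quartic_I\<close> vanishes when their cross-ratio is
  equianharmonic and \<open>quartic_J\<close> when it is harmonic.\<close>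

definition quartic_J :: "'a::comm_ring_1 poly \<Rightarrow> 'a" where
  "quartic_J p = 72 * coeff p 4 * coeff p 2 * coeff p 0 + 9 * coeff p 3 * coeff p 2 * coeff p 1
     - 27 * coeff p 4 * coeff p 1 ^ 2 - 27 * coeff p 0 * coeff p 3 ^ 2 - 2 * coeff p 2 ^ 3"

lemma quartic_I_pencil:
  "quartic_I (smult b p - smult a q) = b^2 * quartic_I p - a * b * quartic_I_polar p q + a^2 * quartic_I q"
  by (simp add: quartic_I_def quartic_I_polar_def power2_eq_square algebra_simps)

text \<open>With the triple root moved to 0, the coefficients 0, 1 and 2 vanish, and each term of
  \<open>quartic_I\<close> contains one of them.\<close>

lemma quartic_I_triple_root:
  assumes "degree p \<le> 4" "poly p x = 0" "poly (hder 1 p) x = 0" "poly (hder 2 p) x = 0"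
  shows "quartic_I p = (0 :: 'a::{idom,ring_char_0})"
proof -
  have h: "coeff p 0 + coeff p 1 * x + coeff p 2 * x^2 + coeff p 3 * x^3 + coeff p 4 * x^4 = 0"
    "coeff p 1 + 2 * coeff p 2 * x + 3 * coeff p 3 * x^2 + 4 * coeff p 4 * x^3 = 0"
    "coeff p 2 + 3 * coeff p 3 * x + 6 * coeff p 4 * x^2 = 0"
    using assms(2-4) poly_hder[OF assms(1), of 0 x] poly_hder[OF assms(1), of 1 x]
      poly_hder[OF assms(1), of 2 x]
    by (simp_all add: eval_nat_numeral algebra_simps)
  show ?thesis
    unfolding quartic_I_def using h by algebra
qed

text \<open>Up to a factor \<open>quartic_J\<close> is the catalecticant, the determinant that
  detects sums of two fourth powers.\<close>

lemma quartic_J_two_fourth_powers: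
  "quartic_J (smult s ([:- x, 1:] ^ 4) + smult t ([:- y, 1:] ^ 4)) = (0 :: 'a::comm_ring_1)"
proof -
  have "[:- c, 1:] ^ 4 = [:c^4, - 4 * c^3, 6 * c^2, - 4 * c, 1:]" for c :: 'a
    by (simp add: eval_nat_numeral algebra_simps)
  then show ?thesis
    by (simp add: quartic_J_def coeff_pCons eval_nat_numeral) (simp add: algebra_simps)
qed

lemma binary_quadratic_three_zeros:
  fixes x y z :: "'a::idom"
  assumes "b1^2 * x - a1 * b1 * y + a1^2 * z = 0" "b2^2 * x - a2 * b2 * y + a2^2 * z = 0"
    "b3^2 * x - a3 * b3 * y + a3^2 * z = 0"
    "a1 * b2 \<noteq> a2 * b1" "a1 * b3 \<noteq> a3 * b1" "a2 * b3 \<noteq> a3 * b2"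
  shows "x = 0" "y = 0" "z = 0"
proof -
  have "(a1 * b2 - a2 * b1) * (a1 * b3 - a3 * b1) * (a2 * b3 - a3 * b2) * x = 0"
    "(a1 * b2 - a2 * b1) * (a1 * b3 - a3 * b1) * (a2 * b3 - a3 * b2) * y = 0"
    "(a1 * b2 - a2 * b1) * (a1 * b3 - a3 * b1) * (a2 * b3 - a3 * b2) * z = 0"
    using assms(1-3) by algebra+
  then show "x = 0" "y = 0" "z = 0"
    using assms(4-6) by auto
qed

context smooth_line
begin

definition \<alpha> :: "'k \<Rightarrow> 'k poly" where
  "\<alpha> P = smult (poly B P) A - smult (poly A P) B"

lemma degree_\<alpha>: "degree (\<alpha> P) \<le> 4"
  using degree_A degree_B by (simp add: \<alpha>_def degree_diff_le)

lemma hder_\<alpha>: "poly (hder j (\<alpha> P)) P = poly (T j 1) P"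
  unfolding T_1 by (simp add: \<alpha>_def hder_diff hder_smult algebra_simps)

lemma \<alpha>_nonzero: "\<alpha> P \<noteq> 0"
  using T_at_ramification(3)[of P] hder_\<alpha>[of _ P] by (metis hder_zero poly_0)

lemma order_\<alpha>: "order P (\<alpha> P) = order P W + 1"
proof -
  obtain q where q: "\<alpha> P = [:- P, 1:] ^ order P (\<alpha> P) * q" "poly q P \<noteq> 0"
    by (rule order_factor[OF \<alpha>_nonzero])
  have "\<not> order P (\<alpha> P) < order P W + 1"
  proof
    assume "order P (\<alpha> P) < order P W + 1"
    then have "poly (hder (order P (\<alpha> P)) (\<alpha> P)) P = 0"
      using T_at_ramification(2) hder_\<alpha> by simp
    then show False
      using poly_hder_eq[of "order P (\<alpha> P)" P q] q by metis
  qed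
  moreover have "\<not> order P W + 1 < order P (\<alpha> P)"
  proof
    assume "order P W + 1 < order P (\<alpha> P)"
    then have "poly (hder (order P W + 1) (\<alpha> P)) P = 0"
      using poly_hder_less[of "order P W + 1" "order P (\<alpha> P)" P q] q by metis
    then show False
      using T_at_ramification(3)[of P] hder_\<alpha> by simp
  qed
  ultimately show ?thesis
    by linarith
qed

text \<open>The ramification indices \<open>order P W + 1\<close> and \<open>order P' W + 1\<close> add up to more than the degree 4
  of the pencil, so the two points lie in different fibres.\<close>

lemma \<alpha>_independent:
  assumes "P \<noteq> P'" "order P W + order P' W > 2"
  shows "poly A P * poly B P' \<noteq> poly A P' * poly B P"
proof
  assume eq: "poly A P * poly B P' = poly A P' * poly B P"
  obtain c where c: "\<alpha> P' = smult c (\<alpha> P)"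
  proof (cases "poly B P = 0")
    case False
    show ?thesis
    proof (rule that[of "poly B P' / poly B P"])
      have "poly A P' = poly B P' / poly B P * poly A P"
        using False eq by (simp add: field_simps)
      then show "\<alpha> P' = smult (poly B P' / poly B P) (\<alpha> P)"
        using False by (simp add: \<alpha>_def smult_diff_right)
    qed
  next
    case True
    then have AP: "poly A P \<noteq> 0"
      using no_common_zero by auto
    show ?thesis
    proof (rule that[of "poly A P' / poly A P"])
      have "poly B P' = poly A P' / poly A P * poly B P"
        using AP eq by (simp add: field_simps)
      then show "\<alpha> P' = smult (poly A P' / poly A P) (\<alpha> P)"
        using AP by (simp add: \<alpha>_def smult_diff_right)
    qed
  qed
  have "c \<noteq> 0"
    using c \<alpha>_nonzero[of P'] by auto
  then have "order P' (\<alpha> P) = order P' W + 1"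
    using c order_\<alpha>[of P'] by (simp add: order_smult)
  moreover have "order P (\<alpha> P) + order P' (\<alpha> P) \<le> (\<Sum>x | poly (\<alpha> P) x = 0. order x (\<alpha> P))"
  proof -
    have "{P, P'} \<subseteq> {x. poly (\<alpha> P) x = 0}"
      using order_\<alpha>[of P] calculation order_root[of "\<alpha> P" P] order_root[of "\<alpha> P" P'] by auto
    then have "(\<Sum>x\<in>{P, P'}. order x (\<alpha> P)) \<le> (\<Sum>x | poly (\<alpha> P) x = 0. order x (\<alpha> P))"
      using poly_roots_finite[OF \<alpha>_nonzero] by (intro sum_mono2) auto
    then show ?thesis
      using assms(1) by simp
  qed
  ultimately show False
    using sum_order_le_degree[OF \<alpha>_nonzero, of P] degree_\<alpha>[of P] assms(2) order_\<alpha>[of P] by linarith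
qed

text \<open>Three double roots of \<open>W\<close> give three different members of the pencil with a
  triple root. On the pencil \<open>quartic_I\<close> is a binary quadratic form, so three zeros
  annihilate it, including its middle coefficient, the polarization.\<close>

lemma quartic_I_zero:
  assumes "\<And>P. poly W P = 0 \<Longrightarrow> order P W = 2"
  shows "quartic_I A = 0" "quartic_I_polar A B = 0"
proof -
  have "(\<Sum>P | poly W P = 0. order P W) = (\<Sum>P | poly W P = 0. 2)"
    by (rule sum.cong) (use assms in auto)
  then have "card {P. poly W P = 0} = 3"
    using sum_order_W by simp
  then obtain P1 P2 P3 where P: "{P. poly W P = 0} = {P1, P2, P3}" "P1 \<noteq> P2" "P1 \<noteq> P3" "P2 \<noteq> P3"
    by (metis card_3_iff)
  have w: "order P1 W = 2" "order P2 W = 2" "order P3 W = 2"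
    using assms P by auto
  have I: "quartic_I (\<alpha> P) = 0" if "order P W = 2" for P
  proof (rule quartic_I_triple_root[OF degree_\<alpha>])
    show "poly (\<alpha> P) P = 0"
      by (simp add: \<alpha>_def)
    show "poly (hder 1 (\<alpha> P)) P = 0" "poly (hder 2 (\<alpha> P)) P = 0"
      unfolding hder_\<alpha> using T_at_ramification(2)[of _ P] that by auto
  qed
  have E: "poly B P^2 * quartic_I A - poly A P * poly B P * quartic_I_polar A B + poly A P^2 * quartic_I B = 0"
    if "order P W = 2" for P
    using I[OF that] unfolding \<alpha>_def quartic_I_pencil by simp
  show "quartic_I A = 0" "quartic_I_polar A B = 0"
    using binary_quadratic_three_zeros[OF E[OF w(1)] E[OF w(2)] E[OF w(3)]]
      \<alpha>_independent[of P1 P2] \<alpha>_independent[of P1 P3] \<alpha>_independent[of P2 P3] P(2-4) w by auto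
qed

text \<open>At the two roots of \<open>W\<close> the pencil contains fourth powers of linear forms,
  and these two members span it.\<close>

lemma quartic_J_zero:
  assumes "\<And>P. poly W P = 0 \<Longrightarrow> order P W = 3"
  shows "quartic_J A = 0"
proof -
  have "(\<Sum>P | poly W P = 0. order P W) = (\<Sum>P | poly W P = 0. 3)"
    by (rule sum.cong) (use assms in auto)
  then have "card {P. poly W P = 0} = 2"
    using sum_order_W by simp
  then obtain P1 P2 where P: "{P. poly W P = 0} = {P1, P2}" "P1 \<noteq> P2"
    by (metis card_2_iff)
  have w: "order P1 W = 3" "order P2 W = 3"
    using assms P by auto
  have fourth: "\<exists>t. \<alpha> P = smult t ([:- P, 1:] ^ 4)" if "order P W = 3" for P
  proof -
    have "order P (\<alpha> P) = 4"
      using order_\<alpha>[of P] that by simp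
    then obtain q where q: "\<alpha> P = [:- P, 1:] ^ 4 * q" "poly q P \<noteq> 0"
      using order_factor[OF \<alpha>_nonzero, of P P] by metis
    have "degree (\<alpha> P) = degree ([:- P, 1:] ^ 4) + degree q"
      unfolding q(1) by (rule degree_mult_eq) (use q(2) in auto)
    then have "degree (\<alpha> P) = 4 + degree q"
      by (simp add: degree_linear_power)
    then have "degree q = 0"
      using degree_\<alpha>[of P] by simp
    then obtain t where "q = [:t:]"
      by (rule degree_eq_zeroE)
    then show ?thesis
      using q by (intro exI[of _ t]) (simp add: mult.commute)
  qed
  obtain t1 t2 where t: "\<alpha> P1 = smult t1 ([:- P1, 1:] ^ 4)" "\<alpha> P2 = smult t2 ([:- P2, 1:] ^ 4)"
    using fourth w by blast
  define d where "d = poly A P2 * poly B P1 - poly A P1 * poly B P2"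
  have d: "d \<noteq> 0"
    using \<alpha>_independent[of P1 P2] P(2) w by (simp add: d_def)
  have "smult d A = smult (poly A P2) (\<alpha> P1) - smult (poly A P1) (\<alpha> P2)"
    by (simp add: \<alpha>_def d_def smult_diff_right smult_diff_left mult.commute)
  then have "A = smult (inverse d) (smult (poly A P2) (\<alpha> P1) - smult (poly A P1) (\<alpha> P2))"
    using d by (metis smult_smult left_inverse smult_1_left)
  also have "\<dots> = smult (inverse d * poly A P2 * t1) ([:- P1, 1:] ^ 4) +
      smult (- (inverse d * poly A P1 * t2)) ([:- P2, 1:] ^ 4)"
    unfolding t by (simp add: smult_diff_right mult.assoc)
  finally show ?thesis
    using quartic_J_two_fourth_powers by metis
qed

end

section \<open>Linear and homogeneous forms as functions\<close>

definition lin :: "('k::field ^ 'n \<Rightarrow> 'k) \<Rightarrow> bool" where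
  "lin \<mu> \<longleftrightarrow> (\<forall>u v. \<mu> (u + v) = \<mu> u + \<mu> v) \<and> (\<forall>c v. \<mu> (c *s v) = c * \<mu> v)"

lemma lin_add: "lin \<mu> \<Longrightarrow> \<mu> (u + v) = \<mu> u + \<mu> v"
  and lin_scale: "lin \<mu> \<Longrightarrow> \<mu> (c *s v) = c * \<mu> v"
  by (auto simp: lin_def)

lemma lin_diff: "lin \<mu> \<Longrightarrow> \<mu> (u - v) = \<mu> u - \<mu> v"
  using lin_add[of \<mu> "u - v" v] by simp

lemma lin_component: "lin (\<lambda>v. v $ i)"
  by (simp add: lin_def)

text \<open>Generating the forms by rules turns restriction to a line, composition with a projection
  and division by a linear form into inductions free of coordinates. The zero function belongs to
  every degree.\<close>

inductive form :: "nat \<Rightarrow> ('k::field ^ 'n \<Rightarrow> 'k) \<Rightarrow> bool" where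
  form_const: "form 0 (\<lambda>v. c)"
| form_zero: "form d (\<lambda>v. 0)"
| form_lin_mult: "lin \<mu> \<Longrightarrow> form d g \<Longrightarrow> form (Suc d) (\<lambda>v. \<mu> v * g v)"
| form_add: "form d g \<Longrightarrow> form d h \<Longrightarrow> form d (\<lambda>v. g v + h v)"

lemma form_const_mult: "form d g \<Longrightarrow> form d (\<lambda>v. c * g v)"
proof (induction rule: form.induct)
  case (form_lin_mult \<mu> d g)
  then show ?case
    using form.form_lin_mult[of \<mu> d "\<lambda>v. c * g v"] by (simp add: mult.left_commute)
next
  case (form_add d g h)
  then show ?case
    using form.form_add[of d "\<lambda>v. c * g v" "\<lambda>v. c * h v"] by (simp add: distrib_left)
qed (auto intro: form.intros)

lemma form_mult: "form d g \<Longrightarrow> form e h \<Longrightarrow> form (d + e) (\<lambda>v. g v * h v)"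
proof (induction rule: form.induct)
  case (form_const c)
  then show ?case
    using form_const_mult by simp
next
  case (form_lin_mult \<mu> d g)
  then show ?case
    using form.form_lin_mult[of \<mu> "d + e" "\<lambda>v. g v * h v"] by (simp add: mult.assoc)
next
  case (form_add d g1 g2)
  then show ?case
    using form.form_add[of "d + e" "\<lambda>v. g1 v * h v" "\<lambda>v. g2 v * h v"] by (simp add: distrib_right)
qed (auto intro: form.intros)

lemma form_sum:
  assumes "finite I" "\<And>i. i \<in> I \<Longrightarrow> form d (g i)"
  shows "form d (\<lambda>v. \<Sum>i\<in>I. g i v)"
  using assms by (induction I) (auto intro: form.intros)

lemma form_prod_power:
  assumes "finite I"
  shows "form (\<Sum>i\<in>I. m i) (\<lambda>v. \<Prod>i\<in>I. (v $ i) ^ m i)"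
  using assms
proof (induction I)
  case empty
  then show ?case
    by (simp add: form_const)
next
  case (insert i I)
  have "form k (\<lambda>v. (v $ i) ^ k)" for k
    by (induction k) (use form_const[of 1] form_lin_mult[OF lin_component] in auto)
  from form_mult[OF this[of "m i"] insert.IH] show ?case
    using insert.hyps by simp
qed

lemma form_mpoly_eval:
  assumes "homogeneous_form d F"
  shows "form d (mpoly_eval F)"
proof -
  have "form d (\<lambda>v. \<Sum>m\<in>Poly_Mapping.keys F. Poly_Mapping.lookup F m *
      (\<Prod>i\<in>UNIV. (v $ i) ^ Poly_Mapping.lookup m i))"
  proof (rule form_sum)
    fix m
    assume "m \<in> Poly_Mapping.keys F"
    then have "(\<Sum>i\<in>UNIV. Poly_Mapping.lookup m i) = d"
      using assms by (simp add: homogeneous_form_def)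
    then show "form d (\<lambda>v. Poly_Mapping.lookup F m * (\<Prod>i\<in>UNIV. (v $ i) ^ Poly_Mapping.lookup m i))"
      using form_const_mult[OF form_prod_power[of UNIV "Poly_Mapping.lookup m"]] by simp
  qed simp
  then show ?thesis
    by (simp add: mpoly_eval_def[abs_def])
qed

lemma form_scale: "form d g \<Longrightarrow> g (c *s v) = c ^ d * g v"
  by (induction rule: form.induct) (auto simp: lin_scale algebra_simps)

lemma form_compose:
  assumes "form d g" and \<pi>: "\<And>\<mu>. lin \<mu> \<Longrightarrow> lin (\<lambda>v. \<mu> (\<pi> v))"
  shows "form d (\<lambda>v. g (\<pi> v))"
  using assms(1)
proof (induction rule: form.induct)
  case (form_lin_mult \<mu> d g)
  show ?case
    using form.form_lin_mult[OF \<pi>[OF form_lin_mult(1)] form_lin_mult(3)] .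
qed (auto intro: form.intros)

lemma form_line:
  assumes "form d g"
  shows "\<exists>p. \<forall>s. g (v + s *s e) = poly p s"
  using assms
proof (induction rule: form.induct)
  case (form_const c)
  then show ?case
    by (intro exI[of _ "[:c:]"]) simp
next
  case (form_zero d)
  then show ?case
    by (intro exI[of _ 0]) simp
next
  case (form_lin_mult \<mu> d g)
  then obtain p where "\<forall>s. g (v + s *s e) = poly p s"
    by blast
  with form_lin_mult(1) show ?case
    by (intro exI[of _ "[:\<mu> v, \<mu> e:] * p"]) (simp add: lin_add lin_scale del: mult_pCons_left)
next
  case (form_add d g h)
  then obtain p q where "\<forall>s. g (v + s *s e) = poly p s" "\<forall>s. h (v + s *s e) = poly q s"
    by blast
  then show ?case
    by (intro exI[of _ "p + q"]) simp
qed

lemma lin_projection: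
  assumes \<mu>: "lin \<mu>" and \<nu>: "lin \<nu>"
  shows "lin (\<lambda>v. \<nu> (v - \<mu> v *s e))"
proof -
  have "(\<lambda>v. \<nu> (v - \<mu> v *s e)) = (\<lambda>v. \<nu> v - \<mu> v * \<nu> e)"
    by (simp add: lin_diff[OF \<nu>] lin_scale[OF \<nu>])
  then show ?thesis
    by (simp only:) (simp add: lin_def lin_add[OF \<mu>] lin_add[OF \<nu>] lin_scale[OF \<mu>] lin_scale[OF \<nu>] algebra_simps)
qed

text \<open>The remainder is \<open>g\<close> after the shift by \<open>\<mu> v *s e\<close>; if
  \<open>\<mu> e = 1\<close>, this shift is the projection onto the kernel of \<open>\<mu>\<close>.
  The quotient of a form of degree 0 has to be zero, hence the case distinction.\<close>

lemma form_divide_aux: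
  assumes "form d g" and \<mu>: "lin \<mu>"
  shows "\<exists>h. (case d of 0 \<Rightarrow> h = (\<lambda>_. 0) | Suc d' \<Rightarrow> form d' h) \<and>
    (\<forall>v. g v = \<mu> v * h v + g (v - \<mu> v *s e))"
  using assms(1)
proof (induction rule: form.induct)
  case (form_const c)
  then show ?case
    by (intro exI[of _ "\<lambda>_. 0"]) simp
next
  case (form_zero d)
  then show ?case
    by (intro exI[of _ "\<lambda>_. 0"]) (auto intro: form.intros split: nat.split)
next
  case (form_lin_mult \<nu> d g)
  then obtain h where h: "case d of 0 \<Rightarrow> h = (\<lambda>_. 0) | Suc d' \<Rightarrow> form d' h"
    "\<And>v. g v = \<mu> v * h v + g (v - \<mu> v *s e)"
    by blast
  let ?h = "\<lambda>v. \<nu> v * h v + \<nu> e * g (v - \<mu> v *s e)"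
  have "form d (\<lambda>v. g (v - \<mu> v *s e))"
    using form_lin_mult(2) lin_projection[OF \<mu>] by (rule form_compose)
  moreover have "form d (\<lambda>v. \<nu> v * h v)"
    using h(1) form.form_lin_mult[OF form_lin_mult(1)] by (cases d) (auto intro: form.intros)
  ultimately have 1: "form d ?h"
    by (intro form.form_add form_const_mult)
  have 2: "\<nu> v * g v = \<mu> v * ?h v + \<nu> (v - \<mu> v *s e) * g (v - \<mu> v *s e)" for v
  proof -
    define r where "r = g (v - \<mu> v *s e)"
    have "g v = \<mu> v * h v + r"
      unfolding r_def by (rule h(2))
    then show ?thesis
      unfolding r_def[symmetric]
      by (simp add: lin_diff[OF form_lin_mult(1)] lin_scale[OF form_lin_mult(1)] algebra_simps)
  qed
  show ?case
    by (rule exI[of _ ?h], rule conjI, unfold nat.case, rule 1, rule allI, rule 2)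
next
  case (form_add d g1 g2)
  then obtain h1 h2 where h:
    "case d of 0 \<Rightarrow> h1 = (\<lambda>_. 0) | Suc d' \<Rightarrow> form d' h1" "\<And>v. g1 v = \<mu> v * h1 v + g1 (v - \<mu> v *s e)"
    "case d of 0 \<Rightarrow> h2 = (\<lambda>_. 0) | Suc d' \<Rightarrow> form d' h2" "\<And>v. g2 v = \<mu> v * h2 v + g2 (v - \<mu> v *s e)"
    by blast
  have 1: "g1 v + g2 v = \<mu> v * (h1 v + h2 v) + (g1 (v - \<mu> v *s e) + g2 (v - \<mu> v *s e))" for v
  proof -
    have "g1 v + g2 v = (\<mu> v * h1 v + g1 (v - \<mu> v *s e)) + (\<mu> v * h2 v + g2 (v - \<mu> v *s e))"
      by (rule arg_cong2[of _ _ _ _ "(+)", OF h(2) h(4)])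
    also have "\<dots> = \<mu> v * (h1 v + h2 v) + (g1 (v - \<mu> v *s e) + g2 (v - \<mu> v *s e))"
      by (simp add: algebra_simps)
    finally show ?thesis .
  qed
  have 2: "case d of 0 \<Rightarrow> (\<lambda>v. h1 v + h2 v) = (\<lambda>_. 0) | Suc d' \<Rightarrow> form d' (\<lambda>v. h1 v + h2 v)"
    using h(1,3) form.form_add by (cases d) auto
  show ?case
    by (rule exI[of _ "\<lambda>v. h1 v + h2 v"], rule conjI, rule 2, rule allI, rule 1)
qed

lemma form_divide:
  assumes "form (Suc d) g" "lin \<mu>"
  obtains h where "form d h" "\<And>v. g v = \<mu> v * h v + g (v - \<mu> v *s e)"
  using form_divide_aux[OF assms, of e] by auto

text \<open>The value at \<open>(x, y)\<close> of the binary form of degree \<open>e\<close> with dehomogenization \<open>p\<close>.\<close>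

definition hom :: "nat \<Rightarrow> 'k::field poly \<Rightarrow> 'k \<Rightarrow> 'k \<Rightarrow> 'k" where
  "hom e p x y = (\<Sum>i\<le>e. coeff p i * x ^ i * y ^ (e - i))"

lemma hom_add: "hom e (p + q) x y = hom e p x y + hom e q x y"
  by (simp add: hom_def sum.distrib algebra_simps)

lemma hom_0 [simp]: "hom e 0 x y = 0"
  by (simp add: hom_def)

lemma hom_smult: "hom e (smult c p) x y = c * hom e p x y"
  by (simp add: hom_def sum_distrib_left mult.assoc)

lemma hom_linear_mult:
  assumes "degree p \<le> e"
  shows "hom (Suc e) ([:b, a:] * p) x y = (a * x + b * y) * hom e p x y"
proof -
  have "hom (Suc e) (smult b p) x y = b * y * hom e p x y"
    using assms by (simp add: hom_def coeff_eq_0 sum_distrib_left Suc_diff_le mult_ac)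
  moreover have "hom (Suc e) (pCons 0 (smult a p)) x y = a * x * hom e p x y"
    unfolding hom_def sum.atMost_Suc_shift by (simp add: sum_distrib_left mult_ac)
  ultimately show ?thesis
    by (simp add: hom_add algebra_simps)
qed

lemma poly_hom: "degree p \<le> e \<Longrightarrow> poly p x = hom e p x 1"
  using poly_hder[of p e 0 x] by (simp add: hom_def)

section \<open>Expansion of a form along a line\<close>

definition chart :: "nat \<Rightarrow> ('k::field ^ 'n \<Rightarrow> 'k) \<Rightarrow> 'k ^ 'n \<Rightarrow> 'k ^ 'n \<Rightarrow> 'k ^ 'n \<Rightarrow> 'k ^ 'n \<Rightarrow>
    (nat \<Rightarrow> nat \<Rightarrow> 'k poly) \<Rightarrow> bool" where
  "chart d g u1 u2 u3 u4 \<phi> \<longleftrightarrow> (\<forall>k l. degree (\<phi> k l) \<le> d - k - l) \<and> (\<forall>k l. d < k + l \<longrightarrow> \<phi> k l = 0) \<and>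
     (\<forall>x y z w. g (x *s u1 + y *s u2 + z *s u3 + w *s u4) =
        (\<Sum>k\<le>d. \<Sum>l\<le>d. hom (d - k - l) (\<phi> k l) x y * z ^ k * w ^ l))"

lemma chart_exists:
  assumes "form d g"
  shows "\<exists>\<phi>. chart d g u1 u2 u3 u4 \<phi>"
  using assms
proof (induction rule: form.induct)
  case (form_const c)
  show ?case
    by (rule exI[of _ "\<lambda>k l. if k + l = 0 then [:c:] else 0"]) (simp add: chart_def hom_def)
next
  case (form_zero d)
  show ?case
    by (rule exI[of _ "\<lambda>k l. 0"]) (simp add: chart_def)
next
  case (form_add d g h)
  then obtain \<phi> \<psi> where "chart d g u1 u2 u3 u4 \<phi>" "chart d h u1 u2 u3 u4 \<psi>"
    by blast
  then have "chart d (\<lambda>v. g v + h v) u1 u2 u3 u4 (\<lambda>k l. \<phi> k l + \<psi> k l)"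
    by (auto simp: chart_def hom_add sum.distrib algebra_simps intro!: degree_add_le)
  then show ?case
    by blast
next
  case (form_lin_mult \<mu> d g)
  then obtain \<phi> where \<phi>: "\<And>k l. degree (\<phi> k l) \<le> d - k - l" "\<And>k l. d < k + l \<Longrightarrow> \<phi> k l = 0"
    "\<And>x y z w. g (x *s u1 + y *s u2 + z *s u3 + w *s u4) =
        (\<Sum>k\<le>d. \<Sum>l\<le>d. hom (d - k - l) (\<phi> k l) x y * z ^ k * w ^ l)"
    unfolding chart_def by blast
  define lin2 where "lin2 = [:\<mu> u2, \<mu> u1:]"
  \<comment> \<open>The contributions to the coefficient of \<open>z^k w^l\<close> that come from
    the parts of \<open>\<mu>\<close> in \<open>x\<close> and \<open>y\<close>, in \<open>z\<close>,
    and in \<open>w\<close>.\<close>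
  define a where "a = (\<lambda>k l. lin2 * \<phi> k l)"
  define b where "b = (\<lambda>k l. case k of 0 \<Rightarrow> 0 | Suc k' \<Rightarrow> smult (\<mu> u3) (\<phi> k' l))"
  define c where "c = (\<lambda>k l. case l of 0 \<Rightarrow> 0 | Suc l' \<Rightarrow> smult (\<mu> u4) (\<phi> k l'))"
  let ?\<psi> = "\<lambda>k l. a k l + b k l + c k l"
  have za: "a k l = 0" if "Suc d < k + l" for k l
    using \<phi>(2) that by (simp add: a_def)
  have da: "degree (a k l) \<le> Suc d - k - l" for k l
  proof (cases "d < k + l")
    case False
    have "degree (a k l) \<le> degree lin2 + degree (\<phi> k l)"
      unfolding a_def by (rule degree_mult_le)
    moreover have "degree lin2 \<le> 1"
      by (simp add: lin2_def)
    ultimately show ?thesis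
      using \<phi>(1)[of k l] False by simp
  qed (simp add: a_def \<phi>(2))
  have db: "degree (b k l) \<le> Suc d - k - l" for k l
    using \<phi>(1)[of "k - 1" l] by (cases k) (auto simp: b_def intro: order_trans[OF degree_smult_le])
  have dc: "degree (c k l) \<le> Suc d - k - l" for k l
    using \<phi>(1)[of k "l - 1"] by (cases l) (auto simp: c_def intro: order_trans[OF degree_smult_le])
  have zb: "b k l = 0" if "Suc d < k + l" for k l
    using \<phi>(2) that by (cases k) (simp_all add: b_def)
  have zc: "c k l = 0" if "Suc d < k + l" for k l
    using \<phi>(2) that by (cases l) (simp_all add: c_def)
  have ext: "(\<Sum>k\<le>Suc d. \<Sum>l\<le>Suc d. X k l) = (\<Sum>k\<le>d. \<Sum>l\<le>d. X k l)"
    if "\<And>k l. d < k \<or> d < l \<Longrightarrow> X k l = 0" for X :: "nat \<Rightarrow> nat \<Rightarrow> 'a"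
    using that by simp
  have "\<mu> (x *s u1 + y *s u2 + z *s u3 + w *s u4) * g (x *s u1 + y *s u2 + z *s u3 + w *s u4) =
      (\<Sum>k\<le>Suc d. \<Sum>l\<le>Suc d. hom (Suc d - k - l) (?\<psi> k l) x y * z ^ k * w ^ l)" for x y z w
  proof -
    let ?G = "\<Sum>k\<le>d. \<Sum>l\<le>d. hom (d - k - l) (\<phi> k l) x y * z ^ k * w ^ l"
    have "(\<Sum>k\<le>Suc d. \<Sum>l\<le>Suc d. hom (Suc d - k - l) (a k l) x y * z ^ k * w ^ l) =
        (\<Sum>k\<le>d. \<Sum>l\<le>d. hom (Suc d - k - l) (a k l) x y * z ^ k * w ^ l)"
      by (rule ext) (use \<phi>(2) in \<open>auto simp: a_def\<close>)
    also have "\<dots> = (\<Sum>k\<le>d. \<Sum>l\<le>d. (\<mu> u1 * x + \<mu> u2 * y) * (hom (d - k - l) (\<phi> k l) x y * z ^ k * w ^ l))"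
    proof (intro sum.cong refl)
      fix k l
      show "hom (Suc d - k - l) (a k l) x y * z ^ k * w ^ l =
          (\<mu> u1 * x + \<mu> u2 * y) * (hom (d - k - l) (\<phi> k l) x y * z ^ k * w ^ l)"
      proof (cases "d < k + l")
        case False
        then have "Suc d - k - l = Suc (d - k - l)"
          by simp
        then show ?thesis
          using hom_linear_mult[OF \<phi>(1)[of k l]] by (simp add: a_def lin2_def del: mult_pCons_left)
      qed (simp add: a_def \<phi>(2))
    qed
    finally have 1: "(\<Sum>k\<le>Suc d. \<Sum>l\<le>Suc d. hom (Suc d - k - l) (a k l) x y * z ^ k * w ^ l) =
        (\<mu> u1 * x + \<mu> u2 * y) * ?G"
      by (simp add: sum_distrib_left)
    have "(\<Sum>k\<le>Suc d. \<Sum>l\<le>Suc d. hom (Suc d - k - l) (b k l) x y * z ^ k * w ^ l) =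
        (\<Sum>k\<le>d. \<Sum>l\<le>Suc d. hom (d - k - l) (smult (\<mu> u3) (\<phi> k l)) x y * z ^ Suc k * w ^ l)"
      unfolding sum.atMost_Suc_shift[of _ d] by (simp add: b_def)
    also have "\<dots> = (\<Sum>k\<le>d. \<Sum>l\<le>d. hom (d - k - l) (smult (\<mu> u3) (\<phi> k l)) x y * z ^ Suc k * w ^ l)"
      using \<phi>(2) by simp
    finally have 2: "(\<Sum>k\<le>Suc d. \<Sum>l\<le>Suc d. hom (Suc d - k - l) (b k l) x y * z ^ k * w ^ l) =
        (\<mu> u3 * z) * ?G"
      by (simp add: sum_distrib_left hom_smult mult_ac)
    have "(\<Sum>k\<le>Suc d. \<Sum>l\<le>Suc d. hom (Suc d - k - l) (c k l) x y * z ^ k * w ^ l) =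
        (\<Sum>k\<le>Suc d. \<Sum>l\<le>d. hom (d - k - l) (smult (\<mu> u4) (\<phi> k l)) x y * z ^ k * w ^ Suc l)"
    proof (rule sum.cong[OF refl])
      fix k
      show "(\<Sum>l\<le>Suc d. hom (Suc d - k - l) (c k l) x y * z ^ k * w ^ l) =
          (\<Sum>l\<le>d. hom (d - k - l) (smult (\<mu> u4) (\<phi> k l)) x y * z ^ k * w ^ Suc l)"
        unfolding sum.atMost_Suc_shift[of _ d] by (simp add: c_def)
    qed
    also have "\<dots> = (\<Sum>k\<le>d. \<Sum>l\<le>d. hom (d - k - l) (smult (\<mu> u4) (\<phi> k l)) x y * z ^ k * w ^ Suc l)"
      using \<phi>(2) by simp
    finally have 3: "(\<Sum>k\<le>Suc d. \<Sum>l\<le>Suc d. hom (Suc d - k - l) (c k l) x y * z ^ k * w ^ l) =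
        (\<mu> u4 * w) * ?G"
      by (simp add: sum_distrib_left hom_smult mult_ac)
    have "(\<Sum>k\<le>Suc d. \<Sum>l\<le>Suc d. hom (Suc d - k - l) (?\<psi> k l) x y * z ^ k * w ^ l) =
        (\<mu> u1 * x + \<mu> u2 * y + \<mu> u3 * z + \<mu> u4 * w) * ?G"
      unfolding hom_add distrib_right sum.distrib 1 2 3 ..
    then show ?thesis
      unfolding \<phi>(3) by (simp add: lin_add[OF form_lin_mult(1)] lin_scale[OF form_lin_mult(1)] mult.commute)
  qed
  moreover have "degree (?\<psi> k l) \<le> Suc d - k - l" "Suc d < k + l \<Longrightarrow> ?\<psi> k l = 0" for k l
    using da[of k l] db[of k l] dc[of k l] za[of k l] zb[of k l] zc[of k l] by (auto intro!: degree_add_le)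
  ultimately have "chart (Suc d) (\<lambda>v. \<mu> v * g v) u1 u2 u3 u4 ?\<psi>"
    unfolding chart_def by blast
  then show ?case
    by blast
qed

section \<open>Derivatives along polynomial curves\<close>

lemma mpoly_eval_superset:
  assumes "finite S" "Poly_Mapping.keys F \<subseteq> S"
  shows "mpoly_eval F v = (\<Sum>m\<in>S. Poly_Mapping.lookup F m * (\<Prod>i\<in>UNIV. (v $ i) ^ Poly_Mapping.lookup m i))"
  unfolding mpoly_eval_def
  by (rule sum.mono_neutral_left) (use assms in \<open>auto simp: in_keys_iff\<close>)

lemma mpoly_eval_add: "mpoly_eval (F + G) v = mpoly_eval F v + mpoly_eval G v"
proof -
  let ?S = "Poly_Mapping.keys F \<union> Poly_Mapping.keys G"
  have "mpoly_eval (F + G) v = (\<Sum>m\<in>?S. Poly_Mapping.lookup (F + G) m * (\<Prod>i\<in>UNIV. (v $ i) ^ Poly_Mapping.lookup m i))"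
    by (rule mpoly_eval_superset[OF _ Poly_Mapping.keys_add]) simp
  also have "\<dots> = mpoly_eval F v + mpoly_eval G v"
    using mpoly_eval_superset[of ?S F v] mpoly_eval_superset[of ?S G v]
    by (simp add: lookup_add distrib_right sum.distrib)
  finally show ?thesis .
qed

lemma mpoly_eval_zero [simp]: "mpoly_eval 0 v = 0"
  by (simp add: mpoly_eval_def)

lemma mpoly_eval_single:
  "mpoly_eval (Poly_Mapping.single m c) v = c * (\<Prod>i\<in>UNIV. (v $ i) ^ Poly_Mapping.lookup m i)"
  using mpoly_eval_superset[of "{m}" "Poly_Mapping.single m c" v] by simp

lemma mpoly_eval_sum: "finite S \<Longrightarrow> mpoly_eval (\<Sum>m\<in>S. G m) v = (\<Sum>m\<in>S. mpoly_eval (G m) v)"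
  by (induction S rule: finite_induct) (simp_all add: mpoly_eval_add)

lemma mpoly_eval_pderiv:
  "mpoly_eval (mpoly_pderiv i F) v = (\<Sum>m\<in>Poly_Mapping.keys F. of_nat (Poly_Mapping.lookup m i) *
     Poly_Mapping.lookup F m * ((v $ i) ^ (Poly_Mapping.lookup m i - 1) *
     (\<Prod>j\<in>UNIV - {i}. (v $ j) ^ Poly_Mapping.lookup m j)))"
proof -
  have "(\<Prod>j\<in>UNIV. (v $ j) ^ Poly_Mapping.lookup (m - Poly_Mapping.single i 1) j) =
      (v $ i) ^ (Poly_Mapping.lookup m i - 1) * (\<Prod>j\<in>UNIV - {i}. (v $ j) ^ Poly_Mapping.lookup m j)" for m
  proof -
    have "(\<Prod>j\<in>UNIV. (v $ j) ^ Poly_Mapping.lookup (m - Poly_Mapping.single i 1) j) =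
        (v $ i) ^ Poly_Mapping.lookup (m - Poly_Mapping.single i 1) i *
        (\<Prod>j\<in>UNIV - {i}. (v $ j) ^ Poly_Mapping.lookup (m - Poly_Mapping.single i 1) j)"
      by (rule prod.remove) auto
    also have "(\<Prod>j\<in>UNIV - {i}. (v $ j) ^ Poly_Mapping.lookup (m - Poly_Mapping.single i 1) j) =
        (\<Prod>j\<in>UNIV - {i}. (v $ j) ^ Poly_Mapping.lookup m j)"
      by (rule prod.cong) (auto simp: lookup_minus lookup_single)
    finally show ?thesis
      by (simp add: lookup_minus)
  qed
  then show ?thesis
    by (simp add: mpoly_pderiv_def mpoly_eval_sum mpoly_eval_single)
qed

definition dir_deriv :: "('n::finite, 'k::field) mpolynomial \<Rightarrow> 'k ^ 'n \<Rightarrow> 'k ^ 'n \<Rightarrow> 'k" where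
  "dir_deriv F v e = (\<Sum>i\<in>UNIV. e $ i * mpoly_eval (mpoly_pderiv i F) v)"

definition along :: "('n::finite, 'k::field) mpolynomial \<Rightarrow> ('n \<Rightarrow> 'k poly) \<Rightarrow> 'k poly" where
  "along F \<gamma> = (\<Sum>m\<in>Poly_Mapping.keys F. smult (Poly_Mapping.lookup F m) (\<Prod>i\<in>UNIV. \<gamma> i ^ Poly_Mapping.lookup m i))"

lemma poly_along: "poly (along F \<gamma>) x = mpoly_eval F (\<chi> i. poly (\<gamma> i) x)"
  by (simp add: along_def mpoly_eval_def poly_sum poly_prod)

lemma poly_pderiv_along:
  "poly (pderiv (along F \<gamma>)) x = dir_deriv F (\<chi> i. poly (\<gamma> i) x) (\<chi> i. poly (pderiv (\<gamma> i)) x)"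
proof -
  have "poly (pderiv (\<Prod>i\<in>UNIV. \<gamma> i ^ m i)) x = (\<Sum>i\<in>UNIV. poly (pderiv (\<gamma> i)) x * (of_nat (m i) *
      (poly (\<gamma> i) x ^ (m i - 1) * (\<Prod>j\<in>UNIV - {i}. poly (\<gamma> j) x ^ m j))))" for m
    by (simp add: pderiv_prod pderiv_power poly_sum poly_prod mult_ac)
  then have "poly (pderiv (along F \<gamma>)) x = (\<Sum>m\<in>Poly_Mapping.keys F. \<Sum>i\<in>UNIV. poly (pderiv (\<gamma> i)) x *
      (of_nat (Poly_Mapping.lookup m i) * Poly_Mapping.lookup F m *
      (poly (\<gamma> i) x ^ (Poly_Mapping.lookup m i - 1) * (\<Prod>j\<in>UNIV - {i}. poly (\<gamma> j) x ^ Poly_Mapping.lookup m j))))"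
    by (simp add: along_def higher_pderiv_sum[of 1, simplified] pderiv_smult poly_sum sum_distrib_left mult_ac)
  also have "\<dots> = dir_deriv F (\<chi> i. poly (\<gamma> i) x) (\<chi> i. poly (pderiv (\<gamma> i)) x)"
    by (subst sum.swap) (simp add: dir_deriv_def mpoly_eval_pderiv sum_distrib_left)
  finally show ?thesis .
qed

lemma lin_dir_deriv: "lin (dir_deriv F v)"
  by (simp add: lin_def dir_deriv_def sum.distrib sum_distrib_left algebra_simps)

text \<open>The coordinate vectors of a curve \<open>x \<mapsto> \<Sum> p\<^sub>j(x) u\<^sub>j\<close>.\<close>

definition curve :: "('k::field poly \<times> ('k ^ 'n)) list \<Rightarrow> 'n \<Rightarrow> 'k poly" where
  "curve ps i = (\<Sum>(p, u)\<leftarrow>ps. smult (u $ i) p)"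

lemma curve_eval: "(\<chi> i. poly (curve ps i) x) = (\<Sum>(p, u)\<leftarrow>ps. poly p x *s u)"
  by (induction ps) (auto simp: curve_def vec_eq_iff mult.commute)

lemma curve_pderiv: "(\<chi> i. poly (pderiv (curve ps i)) x) = (\<Sum>(p, u)\<leftarrow>ps. poly (pderiv p) x *s u)"
  by (induction ps) (auto simp: curve_def vec_eq_iff mult.commute pderiv_add pderiv_smult)

text \<open>The chain rule, for expansions known only as functions: over an infinite field, the
  values along the curve determine the pulled-back polynomial.\<close>

lemma dir_deriv_curve:
  assumes "\<And>x. mpoly_eval F (\<Sum>(p, u)\<leftarrow>ps. poly p x *s u) = poly q (x :: 'k::field_char_0)"
  shows "dir_deriv F (\<Sum>(p, u)\<leftarrow>ps. poly p x *s u) (\<Sum>(p, u)\<leftarrow>ps. poly (pderiv p) x *s u) = poly (pderiv q) x"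
proof -
  have "along F (curve ps) = q"
    using assms by (intro poly_eq_poly_eq_iff[THEN iffD1] ext) (simp add: poly_along curve_eval)
  then show ?thesis
    using poly_pderiv_along[of F "curve ps" x] by (simp add: curve_eval curve_pderiv)
qed

lemma dir_deriv_line:
  assumes "\<And>s. mpoly_eval F (v + s *s e) = poly q (s :: 'k::field_char_0)"
  shows "dir_deriv F (v + s *s e) e = poly (pderiv q) s"
  using dir_deriv_curve[of F "[([:1:], v), ([:0, 1:], e)]" q s] assms by (simp add: pderiv_pCons)

lemma poly_dir_deriv_line: "\<exists>q. \<forall>s. dir_deriv F (v + s *s e) e' = poly q (s :: 'k::field)"
proof -
  let ?\<gamma> = "curve [([:1:], v), ([:0, 1:], e)]"
  have "dir_deriv F (v + s *s e) e' = poly (\<Sum>i\<in>UNIV. smult (e' $ i) (along (mpoly_pderiv i F) ?\<gamma>)) s" for s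
    by (simp add: dir_deriv_def poly_sum poly_along curve_eval)
  then show ?thesis
    by blast
qed

definition frame :: "'k::field ^ 'n \<Rightarrow> 'k ^ 'n \<Rightarrow> 'k ^ 'n \<Rightarrow> 'k ^ 'n \<Rightarrow> bool" where
  "frame u1 u2 u3 u4 \<longleftrightarrow> (\<forall>v. \<exists>x y z w. v = x *s u1 + y *s u2 + z *s u3 + w *s u4) \<and>
     (\<forall>x y z w. x *s u1 + y *s u2 + z *s u3 + w *s u4 = 0 \<longrightarrow> x = 0 \<and> y = 0 \<and> z = 0 \<and> w = 0)"

lemma poly_taylor:
  fixes p :: "'a::comm_ring_1 poly"
  assumes "degree p \<le> n"
  shows "poly p (x + h) = (\<Sum>j\<le>n. poly (hder j p) x * h ^ j)"
proof -
  have "(\<Sum>j\<le>n. poly (hder j p) x * h ^ j) = (\<Sum>j\<le>n. \<Sum>i\<le>n. coeff p i * (of_nat (i choose j) * h ^ j * x ^ (i - j)))"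
    by (simp add: poly_hder[OF assms] sum_distrib_left mult_ac)
  also have "\<dots> = (\<Sum>i\<le>n. \<Sum>j\<le>n. coeff p i * (of_nat (i choose j) * h ^ j * x ^ (i - j)))"
    by (rule sum.swap)
  also have "\<dots> = (\<Sum>i\<le>n. coeff p i * (x + h) ^ i)"
  proof (rule sum.cong)
    fix i
    assume "i \<in> {..n}"
    then have "(\<Sum>j\<le>n. of_nat (i choose j) * h ^ j * x ^ (i - j)) = (\<Sum>j\<le>i. of_nat (i choose j) * h ^ j * x ^ (i - j))"
      by (intro sum.mono_neutral_right) (auto simp: binomial_eq_0)
    also have "\<dots> = (x + h) ^ i"
      by (simp add: binomial_ring[of h x] add.commute)
    finally show "(\<Sum>j\<le>n. coeff p i * (of_nat (i choose j) * h ^ j * x ^ (i - j))) = coeff p i * (x + h) ^ i"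
      by (simp flip: sum_distrib_left)
  qed simp
  also have "\<dots> = poly p (x + h)"
    using poly_hder[OF assms, of 0 "x + h"] by simp
  finally show ?thesis ..
qed

text \<open>Taylor expansion in \<open>x\<close>, grouped by the degree \<open>K\<close> in
  \<open>z\<close> and \<open>w\<close> and then by the total order n = j + K. As
  \<open>\<phi> 0 0\<close> vanishes, K starts at 1, which is why \<open>jet n\<close> sums over j <
  n.\<close>

lemma (in quintic_chart) jet_expansion:
  assumes z: "\<And>k l. 5 < k + l \<Longrightarrow> \<phi> k l = 0" and z0: "\<phi> 0 0 = 0"
  shows "(\<Sum>k\<le>5. \<Sum>l\<le>5. poly (\<phi> k l) (p + s * a) * (s * poly B p) ^ k * (- (s * poly A p)) ^ l) =
    (\<Sum>n\<le>5. jet n p a * s ^ n)"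
proof -
  define X where "X k l = poly (\<phi> k l) (p + s * a) * (s * poly B p) ^ k * (- (s * poly A p)) ^ l" for k l
  define Y where "Y j K = poly (T j K) p" for j K
  have X0: "X k l = 0" if "5 < k + l" for k l
    using z[OF that] by (simp add: X_def)
  have "(\<Sum>k\<le>5. \<Sum>l\<le>5. X k l) = (\<Sum>K\<le>5. \<Sum>k\<le>K. X k (K - k))"
    by (simp add: numeral_sums X0)
  also have "\<dots> = (\<Sum>K\<in>{1..5}. \<Sum>k\<le>K. X k (K - k))"
    by (rule sum.mono_neutral_right) (auto simp: X_def z0 not_le)
  also have "\<dots> = (\<Sum>K\<in>{1..5}. s ^ K * (\<Sum>j\<le>5 - K. Y j K * (s * a) ^ j))"
  proof (rule sum.cong)
    fix K :: nat
    assume K: "K \<in> {1..5}"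
    have "(\<Sum>k\<le>K. X k (K - k)) = (\<Sum>k\<le>K. \<Sum>j\<le>5 - K. s ^ K * (poly (hder j (\<phi> k (K - k))) p * poly B p ^ k *
        (- poly A p) ^ (K - k) * (s * a) ^ j))"
    proof (rule sum.cong)
      fix k
      assume k: "k \<in> {..K}"
      then have "degree (\<phi> k (K - k)) \<le> 5 - K"
        using K degree_\<phi>[of k "K - k"] by auto
      moreover have "s ^ K = s ^ k * s ^ (K - k)"
        using k by (simp flip: power_add)
      ultimately show "X k (K - k) = (\<Sum>j\<le>5 - K. s ^ K * (poly (hder j (\<phi> k (K - k))) p * poly B p ^ k *
        (- poly A p) ^ (K - k) * (s * a) ^ j))"
        unfolding X_def mult_minus_right[symmetric] power_mult_distrib
        by (simp add: poly_taylor power_mult_distrib sum_distrib_left sum_distrib_right mult_ac)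
    qed simp
    also have "\<dots> = (\<Sum>j\<le>5 - K. \<Sum>k\<le>K. s ^ K * (poly (hder j (\<phi> k (K - k))) p * poly B p ^ k *
        (- poly A p) ^ (K - k) * (s * a) ^ j))"
      by (rule sum.swap)
    also have "\<dots> = s ^ K * (\<Sum>j\<le>5 - K. Y j K * (s * a) ^ j)"
      by (simp add: Y_def T_def poly_sum sum_distrib_left sum_distrib_right)
    finally show "(\<Sum>k\<le>K. X k (K - k)) = s ^ K * (\<Sum>j\<le>5 - K. Y j K * (s * a) ^ j)" .
  qed simp
  also have "\<dots> = (\<Sum>n\<le>5. (\<Sum>j<n. Y j (n - j) * a ^ j) * s ^ n)"
    by (simp add: atLeastAtMostSuc_conv numeral_sums) (simp add: algebra_simps)
  finally show ?thesis
    by (simp add: X_def Y_def jet_def)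
qed


text \<open>Serves to reach the point at infinity of a parametrized line from its finite
  points.\<close>

lemma poly_cancel_power:
  fixes p :: "'a::field_char_0 poly"
  assumes "\<And>x. x \<noteq> 0 \<Longrightarrow> poly p x = c * x ^ Suc n"
  shows "poly p 0 = 0"
proof -
  have "p = monom c (Suc n)"
    by (rule poly_eq_if_eq_off_zeros[of "[:0, 1:]"]) (use assms in \<open>auto simp: poly_monom\<close>)
  then show ?thesis
    by (simp add: poly_monom)
qed

section \<open>Smooth quintic surfaces and their lines\<close>

locale quintic_surface =
  fixes F :: "(4, 'k::{alg_closed_field,field_char_0}) mpolynomial"
  assumes homogeneous: "homogeneous_form 5 F"
    and smooth: "v \<noteq> 0 \<Longrightarrow> mpoly_eval F v = 0 \<Longrightarrow> \<exists>e. dir_deriv F v e \<noteq> 0"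
begin

abbreviation f where "f \<equiv> mpoly_eval F"
abbreviation D where "D \<equiv> dir_deriv F"

lemma form_f: "form 5 f"
  by (rule form_mpoly_eval[OF homogeneous])

lemmas f_scale = form_scale[OF form_f]
lemmas D_add = lin_add[OF lin_dir_deriv]
lemmas D_mult = lin_scale[OF lin_dir_deriv]

lemma D_zero_along:
  assumes "\<And>s. f (v + s *s e) = 0"
  shows "D (v + s *s e) e = 0"
  using dir_deriv_line[of F v e 0 s] assms by simp

lemma D_euler:
  assumes "f v = 0"
  shows "D v v = 0"
proof -
  have "v + s *s v = (1 + s) *s v" for s
    by (simp add: vec.scale_left_distrib)
  then have "f (v + s *s v) = 0" for s
    using f_scale[of "1 + s" v] assms by simp
  from D_zero_along[OF this, of 0] show ?thesis
    by simp
qed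

lemma D_scale:
  assumes "c \<noteq> 0"
  shows "D (c *s v) e = c ^ 4 * D v e"
proof -
  obtain p where p: "\<And>s. f (v + s *s e) = poly p s"
    using form_line[OF form_f, of v e] by blast
  have eq: "c *s v + s *s e = c *s (v + (s / c) *s e)" for s
    using assms by (simp add: vec.scale_right_distrib)
  have "f (c *s v + s *s e) = poly (smult (c ^ 5) (pcompose p [:0, 1 / c:])) s" for s
    unfolding eq f_scale p by (simp add: poly_pcompose)
  from dir_deriv_line[OF this, of 0] dir_deriv_line[OF p, of 0] show ?thesis
    using assms by (simp add: pderiv_smult pderiv_pcompose poly_pcompose pderiv_pCons eval_nat_numeral)
qed

lemma D_frame_nonzero:
  assumes "frame u1 u2 u3 u4" "v \<noteq> 0" "f v = 0"
  shows "D v u1 \<noteq> 0 \<or> D v u2 \<noteq> 0 \<or> D v u3 \<noteq> 0 \<or> D v u4 \<noteq> 0"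
proof (rule ccontr)
  assume *: "\<not> ?thesis"
  obtain e where e: "D v e \<noteq> 0"
    using smooth assms by blast
  obtain x y z w where "e = x *s u1 + y *s u2 + z *s u3 + w *s u4"
    using assms(1) unfolding frame_def by blast
  then show False
    using e * by (simp add: D_add D_mult)
qed

end

locale surface_line = quintic_surface F
  for F :: "(4, 'k::{alg_closed_field,field_char_0}) mpolynomial" +
  fixes u1 u2 u3 u4 :: "'k ^ 4" and \<phi> :: "nat \<Rightarrow> nat \<Rightarrow> 'k poly"
  assumes frame: "frame u1 u2 u3 u4"
    and line: "f (x *s u1 + y *s u2) = 0"
    and chart: "chart 5 f u1 u2 u3 u4 \<phi>"
begin

lemma coords_zero:
  "x *s u1 + y *s u2 + z *s u3 + w *s u4 = 0 \<Longrightarrow> x = 0 \<and> y = 0 \<and> z = 0 \<and> w = 0"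
  using frame unfolding frame_def by blast

lemma degree_le: "degree (\<phi> k l) \<le> 5 - k - l" and zero_gt: "5 < k + l \<Longrightarrow> \<phi> k l = 0"
  using chart unfolding chart_def by auto

lemma f_eq: "f (x *s u1 + y *s u2 + z *s u3 + w *s u4) =
    (\<Sum>k\<le>5. \<Sum>l\<le>5. hom (5 - k - l) (\<phi> k l) x y * z ^ k * w ^ l)"
  using chart unfolding chart_def by blast

lemma f_eq_1: "f (x *s u1 + u2 + z *s u3 + w *s u4) =
    (\<Sum>k\<le>5. \<Sum>l\<le>5. poly (\<phi> k l) x * z ^ k * w ^ l)"
  using f_eq[of x 1 z w] poly_hom[OF degree_le] by simp

lemma f_eq_z: "f (x *s u1 + y *s u2 + z *s u3) = (\<Sum>k\<le>5. hom (5 - k) (\<phi> k 0) x y * z ^ k)"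
proof -
  have "(\<Sum>l\<le>5. c l * 0 ^ l) = (c 0 :: 'k)" for c
    by (simp add: numeral_sums)
  then show ?thesis
    using f_eq[of x y z 0] by simp
qed

lemma f_eq_w: "f (x *s u1 + y *s u2 + w *s u4) = (\<Sum>l\<le>5. hom (5 - l) (\<phi> 0 l) x y * w ^ l)"
  using f_eq[of x y 0 w] by (simp add: numeral_sums)

lemma \<phi>_0_0: "\<phi> 0 0 = 0"
proof -
  have "poly (\<phi> 0 0) x = 0" for x
    using f_eq_1[of x 0 0] line[of x 1] by (simp add: numeral_sums)
  then show ?thesis
    using poly_all_0_iff_0 by blast
qed

sublocale quintic_chart \<phi>
  by unfold_locales (rule degree_le)

lemma D_u3: "D (x *s u1 + y *s u2) u3 = hom 4 A x y"
proof -
  have "f (x *s u1 + y *s u2 + s *s u3) = poly (\<Sum>k\<le>5. monom (hom (5 - k) (\<phi> k 0) x y) k) s" for s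
    unfolding f_eq_z by (simp add: poly_sum poly_monom)
  from dir_deriv_line[OF this, of 0] show ?thesis
    by (simp add: numeral_sums pderiv_add pderiv_monom poly_monom)
qed

lemma D_u4: "D (x *s u1 + y *s u2) u4 = hom 4 B x y"
proof -
  have "f (x *s u1 + y *s u2 + s *s u4) = poly (\<Sum>k\<le>5. monom (hom (5 - k) (\<phi> 0 k) x y) k) s" for s
    unfolding f_eq_w by (simp add: poly_sum poly_monom)
  from dir_deriv_line[OF this, of 0] show ?thesis
    by (simp add: numeral_sums pderiv_add pderiv_monom poly_monom)
qed

lemma D_u1: "D (x *s u1 + y *s u2) u1 = 0" and D_u2: "D (x *s u1 + y *s u2) u2 = 0"
proof -
  have eq: "x *s u1 + y *s u2 + s *s u1 = (x + s) *s u1 + y *s u2"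
    "x *s u1 + y *s u2 + s *s u2 = x *s u1 + (y + s) *s u2" for s
    by (simp_all add: vec.scale_left_distrib algebra_simps)
  have "f (x *s u1 + y *s u2 + s *s u1) = 0" "f (x *s u1 + y *s u2 + s *s u2) = 0" for s
    unfolding eq by (rule line)+
  from D_zero_along[OF this(1), of 0] D_zero_along[OF this(2), of 0]
  show "D (x *s u1 + y *s u2) u1 = 0" "D (x *s u1 + y *s u2) u2 = 0"
    by simp_all
qed

lemma no_common_zero_hom:
  assumes "x \<noteq> 0 \<or> y \<noteq> 0"
  shows "hom 4 A x y \<noteq> 0 \<or> hom 4 B x y \<noteq> 0"
proof -
  have "x *s u1 + y *s u2 \<noteq> 0"
    using coords_zero[of x y 0 0] assms by auto
  then show ?thesis
    using D_frame_nonzero[OF frame _ line, of x y] by (simp add: D_u1 D_u2 D_u3 D_u4)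
qed

lemma no_common_zero: "poly A x \<noteq> 0 \<or> poly B x \<noteq> 0"
  using no_common_zero_hom[of x 1] poly_hom[of A 4] poly_hom[of B 4] degree_A degree_B by simp

definition dir :: "'k \<Rightarrow> 'k \<Rightarrow> 'k ^ 4" where
  "dir p a = a *s u1 + poly B p *s u3 - poly A p *s u4"

lemma f_jets: "f (p *s u1 + u2 + s *s dir p a) = (\<Sum>n\<le>5. jet n p a * s ^ n)"
proof -
  have eq: "p *s u1 + u2 + s *s dir p a = (p + s * a) *s u1 + u2 + (s * poly B p) *s u3 + (- (s * poly A p)) *s u4"
    by (simp add: dir_def vec_eq_iff algebra_simps)
  show ?thesis
    unfolding eq f_eq_1 by (rule jet_expansion[OF zero_gt \<phi>_0_0])
qed

lemma jet_0: "jet 0 p a = 0"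
  by (simp add: jet_def)

lemma in_lines_iff: "(p, a) \<in> lines \<longleftrightarrow> (\<forall>s. f (p *s u1 + u2 + s *s dir p a) = 0)"
proof
  assume *: "(p, a) \<in> lines"
  have "jet n p a = 0" if "n \<le> 5" for n
  proof -
    have "n = 0 \<or> n = 1 \<or> n \<in> {2..5}"
      using that by auto
    then show ?thesis
      using * jet_0[of p a] jet_1[of p a] by (auto simp: lines_def)
  qed
  then show "\<forall>s. f (p *s u1 + u2 + s *s dir p a) = 0"
    unfolding f_jets by simp
next
  assume *: "\<forall>s. f (p *s u1 + u2 + s *s dir p a) = 0"
  have "poly (\<Sum>n\<le>5. monom (jet n p a) n) s = 0" for s
    using * unfolding f_jets by (simp add: poly_sum poly_monom)
  then have "(\<Sum>n\<le>5. monom (jet n p a) n) = 0"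
    using poly_all_0_iff_0 by blast
  then have c: "coeff (\<Sum>n\<le>5. monom (jet n p a) n) m = 0" for m
    by simp
  have "jet m p a = 0" if "m \<le> 5" for m
    using c[of m] that by (simp add: coeff_sum)
  then show "(p, a) \<in> lines"
    by (simp add: lines_def)
qed

text \<open>If the inflectional tangents along the line filled out the surface, then at a ramification point
  the plane section would be double along such a tangent, and the surface singular somewhere on it.\<close>

lemma not_ruled:
  assumes W: "poly W P = 0"
  shows "\<exists>p. \<exists>n\<in>{2..5}. jet n p (poly a p) \<noteq> 0"
proof (rule ccontr)
  assume "\<not> ?thesis"
  then have "(p, poly a p) \<in> lines" for p
    by (auto simp: lines_def)
  then have ruled: "f (p *s u1 + u2 + s *s dir p (poly a p)) = 0" for p s
    using in_lines_iff by blast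
  define e v where "e = P *s u1 + u2" and "v = dir P (poly a P)"
  let ?A = "poly A P" and ?B = "poly B P"
  have van: "f (e + s *s v) = 0" for s
    using ruled by (simp add: e_def v_def)
  have Dv: "D (e + s *s v) v = 0" for s
    using D_zero_along van by blast
  have De: "D (e + s *s v) e = 0" for s
    using D_euler[OF van, of s] Dv[of s] by (simp add: D_add D_mult)
  obtain k1 k2 k3 k4 where k: "\<And>s. D (e + s *s v) u1 = poly k1 s" "\<And>s. D (e + s *s v) u2 = poly k2 s"
    "\<And>s. D (e + s *s v) u3 = poly k3 s" "\<And>s. D (e + s *s v) u4 = poly k4 s"
    using poly_dir_deriv_line[of F e v u1] poly_dir_deriv_line[of F e v u2]
      poly_dir_deriv_line[of F e v u3] poly_dir_deriv_line[of F e v u4] by metis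
  have "?A * poly (pderiv B) P = ?B * poly (pderiv A) P"
    using W by (simp add: T_def hder_1 mult.commute)
  \<comment> \<open>The tangent plane is stationary at a ramification point: the derivative of
    \<open>(A, B)\<close> is a multiple of its value.\<close>
  then obtain c where c: "poly (pderiv A) P = c * ?A" "poly (pderiv B) P = c * ?B"
  proof (cases "?A = 0")
    case True
    then have "?B \<noteq> 0"
      using no_common_zero by auto
    with that[of "poly (pderiv B) P / ?B"] show ?thesis
      using \<open>?A * poly (pderiv B) P = ?B * poly (pderiv A) P\<close> True by simp
  next
    case False
    with that[of "poly (pderiv A) P / ?A"] show ?thesis
      using \<open>?A * poly (pderiv B) P = ?B * poly (pderiv A) P\<close> by (simp add: field_simps)
  qed
  \<comment> \<open>The point with parameter \<open>s\<close> on the tangent at \<open>x\<close> is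
    differentiated in \<open>x\<close>. Because of \<open>c\<close>, its velocity at
    \<open>P\<close> is a multiple of \<open>u1\<close> plus a multiple of \<open>v\<close>, and the
    latter direction is already known to be tangent.\<close>
  have k1s: "poly k1 s * (1 + s * (poly (pderiv a) P - c * poly a P)) = 0" for s
  proof -
    let ?ps = "[([:0, 1:] + smult s a, u1), ([:1:], u2), (smult s B, u3), (- smult s A, u4)]"
    have sum: "(\<Sum>(p, u)\<leftarrow>?ps. poly p x *s u) = x *s u1 + u2 + s *s dir x (poly a x)" for x
      by (simp add: dir_def vec_eq_iff algebra_simps)
    have "D (\<Sum>(p, u)\<leftarrow>?ps. poly p P *s u) (\<Sum>(p, u)\<leftarrow>?ps. poly (pderiv p) P *s u) = poly (pderiv 0) P"
      by (rule dir_deriv_curve) (unfold sum ruled, simp)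
    moreover have "(\<Sum>(p, u)\<leftarrow>?ps. poly (pderiv p) P *s u) =
        (1 + s * (poly (pderiv a) P - c * poly a P)) *s u1 + (s * c) *s v"
      by (simp add: pderiv_add pderiv_pCons pderiv_smult pderiv_minus c[unfolded One_nat_def] v_def dir_def vec_eq_iff algebra_simps)
    ultimately have "D (e + s *s v) ((1 + s * (poly (pderiv a) P - c * poly a P)) *s u1 + (s * c) *s v) = 0"
      unfolding sum by (simp add: e_def v_def)
    then show ?thesis
      unfolding D_add D_mult Dv k(1) by (simp add: mult.commute)
  qed
  have "poly (k1 * [:1, poly (pderiv a) P - c * poly a P:]) s =
      poly k1 s * (1 + s * (poly (pderiv a) P - c * poly a P))" for s
    by (simp add: algebra_simps)
  then have "poly (k1 * [:1, poly (pderiv a) P - c * poly a P:]) s = 0" for s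
    unfolding k1s .
  then have "k1 * [:1, poly (pderiv a) P - c * poly a P:] = 0"
    using poly_all_0_iff_0 by blast
  then have k1: "k1 = 0"
    unfolding mult_eq_0_iff by simp
  have k2: "poly k2 s = 0" for s
    using De[of s] unfolding e_def[symmetric] using k(1,2)[of s] k1 by (simp add: e_def D_add D_mult)
  have k34: "?B * poly k3 s = ?A * poly k4 s" for s
  proof -
    have "D (e + s *s v) (v + (?A *s u4)) = D (e + s *s v) (poly a P *s u1 + ?B *s u3)"
      by (simp add: v_def dir_def)
    then show ?thesis
      unfolding D_add D_mult Dv k using k1 by simp
  qed
  have "D (e + 0 *s v) u3 = ?A" "D (e + 0 *s v) u4 = ?B"
    using D_u3[of P 1] D_u4[of P 1] poly_hom[of A 4] poly_hom[of B 4] degree_A degree_B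
    by (simp_all add: e_def)
  then have k0: "poly k3 0 = ?A" "poly k4 0 = ?B"
    unfolding k by simp_all
  \<comment> \<open>Along the whole tangent the gradient is \<open>h\<close> times its value at
    \<open>e\<close>. A zero of \<open>h\<close> is a singular point; if \<open>h\<close> is
    constant, the point \<open>v\<close> at infinity is singular.\<close>
  obtain h where h: "\<And>s. poly k3 s = ?A * poly h s" "\<And>s. poly k4 s = ?B * poly h s" "poly h 0 = 1"
  proof (cases "?A = 0")
    case True
    then have B: "?B \<noteq> 0"
      using no_common_zero by auto
    show ?thesis
    proof (rule that[of "smult (1 / ?B) k4"])
      fix s
      show "poly k3 s = ?A * poly (smult (1 / ?B) k4) s"
        using k34[of s] True B by simp
    qed (use B k0 in simp_all)
  next
    case A: False
    show ?thesis
    proof (rule that[of "smult (1 / ?A) k3"])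
      fix s
      show "poly k4 s = ?B * poly (smult (1 / ?A) k3) s"
        using k34[of s] A by (simp add: field_simps)
    qed (use A k0 in simp_all)
  qed
  show False
  proof (cases "degree h = 0")
    case False
    then obtain s where "poly h s = 0"
      using alg_closed_imp_poly_has_root[of h] by auto
    then have "D (e + s *s v) u1 = 0" "D (e + s *s v) u2 = 0" "D (e + s *s v) u3 = 0" "D (e + s *s v) u4 = 0"
      using k k1 k2 h by auto
    moreover have "e + s *s v \<noteq> 0"
    proof
      assume "e + s *s v = 0"
      then have "(P + s * poly a P) *s u1 + 1 *s u2 + (s * ?B) *s u3 + (- (s * ?A)) *s u4 = 0"
        by (simp add: e_def v_def dir_def vec_eq_iff algebra_simps)
      then show False
        using coords_zero by fastforce
    qed
    ultimately show False
      using D_frame_nonzero[OF frame _ van] by blast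
  next
    case True
    then obtain d where "h = [:d:]"
      by (rule degree_eq_zeroE)
    then have h1: "poly h s = 1" for s
      using h(3) by simp
    have swap: "v + x *s e = x *s (e + (1 / x) *s v)" if "x \<noteq> 0" for x
      using that by (simp add: vec.scale_right_distrib add.commute)
    \<comment> \<open>First partial derivatives have degree 4, so one that is constant along
      \<open>e + s *s v\<close> is a constant times \<open>x^4\<close> along
      \<open>v + x *s e\<close>.\<close>
    have at: "D v u = 0" if "\<And>s. D (e + s *s v) u = d" for u d
    proof -
      obtain q where q: "\<And>x. D (v + x *s e) u = poly q x"
        using poly_dir_deriv_line[of F v e u] by blast
      have "poly q x = d * x ^ Suc 3" if "x \<noteq> 0" for x
        using q[of x] D_scale[OF that, of "e + (1 / x) *s v" u] \<open>\<And>s. D (e + s *s v) u = d\<close>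
        unfolding swap[OF that] by (simp add: eval_nat_numeral)
      then have "poly q 0 = 0"
        by (rule poly_cancel_power)
      then show ?thesis
        using q[of 0] by simp
    qed
    have "D v u1 = 0" "D v u2 = 0" "D v u3 = 0" "D v u4 = 0"
      using at[of u1 0] at[of u2 0] at[of u3 ?A] at[of u4 ?B] k k1 k2 h h1 by simp_all
    moreover have "v \<noteq> 0"
    proof
      assume "v = 0"
      then have "poly a P *s u1 + 0 *s u2 + ?B *s u3 + (- ?A) *s u4 = 0"
        by (simp add: v_def dir_def vec_eq_iff algebra_simps)
      then show False
        using coords_zero no_common_zero by fastforce
    qed
    moreover have "f v = 0"
    proof -
      obtain q where q: "\<And>x. f (v + x *s e) = poly q x"
        using form_line[OF form_f, of v e] by blast
      have "poly q x = 0 * x ^ Suc 0" if "x \<noteq> 0" for x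
        using q[of x] f_scale[of x "e + (1 / x) *s v"] van unfolding swap[OF that] by simp
      then have "poly q 0 = 0"
        by (rule poly_cancel_power)
      then show ?thesis
        using q[of 0] by simp
    qed
    ultimately show False
      using D_frame_nonzero[OF frame] by blast
  qed
qed

end

section \<open>Wronskians under a change of chart\<close>

lemma poly_degree_4:
  assumes "degree p \<le> 4"
  shows "p = [:coeff p 0, coeff p 1, coeff p 2, coeff p 3, coeff p 4:]"
proof (rule poly_eqI)
  fix n
  show "coeff p n = coeff [:coeff p 0, coeff p 1, coeff p 2, coeff p 3, coeff p 4:] n"
  proof (cases "n \<le> 4")
    case True
    then have "n = 0 \<or> n = 1 \<or> n = 2 \<or> n = 3 \<or> n = 4"
      by auto
    then show ?thesis
      by (auto simp: eval_nat_numeral)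
  next
    case False
    then have "coeff p n = 0"
      using assms by (intro coeff_eq_0) auto
    moreover obtain m where "n = 5 + m"
      using le_Suc_ex[of 5 n] False by auto
    moreover have "5 + m = Suc (Suc (Suc (Suc (Suc m))))"
      by simp
    ultimately show ?thesis
      by simp
  qed
qed

lemma wronskian_quartics:
  fixes p q :: "'a::{idom,ring_char_0} poly"
  assumes "degree p \<le> 4" "degree q \<le> 4"
  shows "degree (pderiv p * q - pderiv q * p) \<le> 6"
    and "coeff (pderiv p * q - pderiv q * p) 6 = coeff p 4 * coeff q 3 - coeff p 3 * coeff q 4"
proof -
  obtain a0 a1 a2 a3 a4 b0 b1 b2 b3 b4 where p: "p = [:a0, a1, a2, a3, a4:]" and q: "q = [:b0, b1, b2, b3, b4:]"
    using poly_degree_4[OF assms(1)] poly_degree_4[OF assms(2)] by blast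
  show "coeff (pderiv p * q - pderiv q * p) 6 = coeff p 4 * coeff q 3 - coeff p 3 * coeff q 4"
    unfolding p q by (simp add: pderiv_pCons eval_nat_numeral algebra_simps)
  show "degree (pderiv p * q - pderiv q * p) \<le> 6"
  proof (rule degree_le, intro allI impI)
    fix n :: nat
    assume "6 < n"
    then obtain m where n: "n = Suc (Suc (Suc (Suc (Suc (Suc (Suc m))))))"
      by (metis less_imp_Suc_add add_Suc eval_nat_numeral(2) eval_nat_numeral(3) numeral_One One_nat_def add_0 numeral_Bit0 BitM.simps)
    show "coeff (pderiv p * q - pderiv q * p) n = 0"
      unfolding p q n by (cases m) (simp_all add: pderiv_pCons algebra_simps)
  qed
qed

text \<open>Both polynomials describe one binary quartic, \<open>p\<close> in a chart whose point at
  infinity is \<open>c\<close>. The leading coefficient of the Wronskian in the new chart is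
  therefore minus the value at \<open>c\<close> of the old one.\<close>

lemma hom_inverse_chart:
  fixes p q :: "'a::{field_char_0} poly"
  assumes "degree p \<le> 4" "degree q \<le> 4" "\<And>x. hom 4 p x 1 = hom 4 q (x * c + 1) x"
  shows "coeff p 4 = poly q c" "coeff p 3 = poly (pderiv q) c"
proof -
  obtain b0 b1 b2 b3 b4 where q: "q = [:b0, b1, b2, b3, b4:]"
    using poly_degree_4[OF assms(2)] by blast
  let ?r = "[:b4, 4 * b4 * c + b3, 6 * b4 * c^2 + 3 * b3 * c + b2, 4 * b4 * c^3 + 3 * b3 * c^2 + 2 * b2 * c + b1,
    b4 * c^4 + b3 * c^3 + b2 * c^2 + b1 * c + b0:]"
  have "poly p x = poly ?r x" for x
    using assms(3)[of x] poly_hom[OF assms(1), of x]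
    by (simp add: q hom_def numeral_sums) (simp add: algebra_simps)
  then have "p = ?r"
    by (intro poly_eq_poly_eq_iff[THEN iffD1] ext)
  then show "coeff p 4 = poly q c" "coeff p 3 = poly (pderiv q) c"
    by (simp_all add: q eval_nat_numeral pderiv_pCons algebra_simps)
qed

context surface_line
begin

lemma W_eq': "W = pderiv A * B - pderiv B * A"
  by (simp add: T_def hder_1)

text \<open>If \<open>W\<close> vanished, comparing orders at a root of \<open>A\<close> would make
  \<open>B\<close> vanish there. So \<open>A\<close> would be constant, then \<open>B\<close> too,
  and both quartic forms would vanish at \<open>y = 0\<close>.\<close>

lemma W_nonzero': "W \<noteq> 0"
proof
  assume "W = 0"
  then have eq: "pderiv A * B = pderiv B * A"
    unfolding W_eq' by simp
  have root: "degree B = 0" if "degree A = 0"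
  proof (rule ccontr)
    assume B: "degree B \<noteq> 0"
    then obtain r where "poly B r = 0"
      using alg_closed_imp_poly_has_root[of B] by auto
    then have "A \<noteq> 0"
      using no_common_zero[of r] by auto
    moreover have "pderiv A = 0"
      using that by (simp add: pderiv_eq_0_iff)
    ultimately have "pderiv B = 0"
      using eq by auto
    then show False
      using B by (simp add: pderiv_eq_0_iff)
  qed
  have "degree A = 0"
  proof (rule ccontr)
    assume A: "degree A \<noteq> 0"
    then obtain r where r: "poly A r = 0"
      using alg_closed_imp_poly_has_root[of A] by auto
    have A0: "A \<noteq> 0"
      using A by auto
    obtain A1 where A1: "A = [:- r, 1:] ^ order r A * A1" "poly A1 r \<noteq> 0"
      by (rule order_factor[OF A0])
    define L where "L = [:- r, 1:]"
    have L: "L \<noteq> 0" "poly L r = 0"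
      by (auto simp: L_def)
    obtain m where m: "order r A = Suc m"
      using r A0 order_root[of A r] by (metis not0_implies_Suc)
    have dA: "pderiv A = L ^ m * (smult (of_nat (Suc m)) A1 + L * pderiv A1)"
      using pderiv_linear_power_mult[of r m A1] A1(1) unfolding m L_def by simp
    have A: "A = L ^ Suc m * A1"
      using A1(1) unfolding m L_def .
    have "L ^ m * ((smult (of_nat (Suc m)) A1 + L * pderiv A1) * B) = pderiv A * B"
      unfolding dA by (rule mult.assoc[symmetric])
    also have "\<dots> = pderiv B * (L ^ Suc m * A1)"
      unfolding eq by (rule arg_cong[OF A])
    also have "\<dots> = L ^ m * (pderiv B * L * A1)"
      by (simp add: mult_ac)
    finally have "(smult (of_nat (Suc m)) A1 + L * pderiv A1) * B = pderiv B * L * A1"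
      using L by (metis mult_left_cancel power_not_zero)
    from arg_cong[OF this, of "\<lambda>p. poly p r"] have "of_nat (Suc m) * poly A1 r * poly B r = 0"
      using L by (simp del: of_nat_Suc)
    moreover have "of_nat (Suc m) \<noteq> (0::'k)"
      by (rule of_nat_neq_0)
    ultimately have "poly B r = 0"
      using A1(2) by simp
    then show False
      using no_common_zero[of r] r by simp
  qed
  with root have "coeff A 4 = 0" "coeff B 4 = 0"
    by (simp_all add: coeff_eq_0)
  then show False
    using no_common_zero_hom[of 1 0] by (simp add: hom_def numeral_sums)
qed

text \<open>A line on the surface lies in the tangent plane at its point \<open>e\<close>, so the
  \<open>u3\<close> and \<open>u4\<close> components of a direction are proportional to
  \<open>B\<close> and \<open>- A\<close>. They are not both zero, because \<open>L\<close> would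
  otherwise contain \<open>u1\<close>.\<close>

lemma line_in_chart:
  assumes L: "vec.subspace L" "vec.dim L = 2" "\<And>v. v \<in> L \<Longrightarrow> f v = 0"
    and e: "x *s u1 + y *s u2 \<in> L" "y \<noteq> 0" and u1: "u1 \<notin> L"
  shows "\<exists>(p, a)\<in>lines. L = vec.span {p *s u1 + u2, dir p a}"
proof -
  define p where "p = x / y"
  define e where "e = p *s u1 + u2"
  have "e = (1 / y) *s (x *s u1 + y *s u2)"
    using \<open>y \<noteq> 0\<close> by (simp add: e_def p_def vec.scale_right_distrib)
  then have eL: "e \<in> L"
    using L(1) assms(4) vec.subspace_scale by blast
  have e0: "e \<noteq> 0"
  proof
    assume "e = 0"
    then have "p *s u1 + 1 *s u2 + 0 *s u3 + 0 *s u4 = 0"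
      by (simp add: e_def)
    then show False
      using coords_zero by fastforce
  qed
  have "\<not> L \<subseteq> vec.span {e}"
  proof
    assume "L \<subseteq> vec.span {e}"
    then have "vec.dim L \<le> card {e}"
      by (rule vec.dim_le_card) simp
    then show False
      using L(2) by simp
  qed
  then obtain v where v: "v \<in> L" "v \<notin> vec.span {e}"
    by blast
  obtain v1 v2 v3 v4 where vc: "v = v1 *s u1 + v2 *s u2 + v3 *s u3 + v4 *s u4"
    using frame unfolding frame_def by blast
  define v' where "v' = v - v2 *s e"
  have v'L: "v' \<in> L"
    unfolding v'_def using L(1) v(1) eL by (intro vec.subspace_diff vec.subspace_scale)
  have v'c: "v' = (v1 - v2 * p) *s u1 + v3 *s u3 + v4 *s u4"
    by (simp add: v'_def vc e_def vec_eq_iff algebra_simps)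
  have v'0: "v' \<noteq> 0"
  proof
    assume "v' = 0"
    then have "v = v2 *s e"
      by (simp add: v'_def)
    then show False
      using v(2) by (simp add: vec.span_base vec.span_scale)
  qed
  have "v3 \<noteq> 0 \<or> v4 \<noteq> 0"
  proof (rule ccontr)
    assume *: "\<not> ?thesis"
    define k where "k = v1 - v2 * p"
    have eq: "v' = k *s u1"
      using v'c * by (simp add: k_def)
    then have "k \<noteq> 0"
      using v'0 by auto
    then have "u1 = (1 / k) *s v'"
      using eq by simp
    then show False
      using u1 v'L L(1) vec.subspace_scale by metis
  qed
  have "f (e + s *s v') = 0" for s
    using L eL v'L vec.subspace_add vec.subspace_scale by blast
  from D_zero_along[OF this, of 0] have "D e v' = 0"
    by simp
  then have AB: "poly A p * v3 + poly B p * v4 = 0"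
    using D_u1[of p 1] D_u3[of p 1] D_u4[of p 1] poly_hom[of A 4] poly_hom[of B 4] degree_A degree_B
    unfolding v'c D_add D_mult by (simp add: e_def mult.commute)
  obtain c where c: "v3 = c * poly B p" "v4 = - (c * poly A p)"
  proof (cases "poly B p = 0")
    case True
    then have A: "poly A p \<noteq> 0"
      using no_common_zero by auto
    with that[of "- v4 / poly A p"] AB True show ?thesis
      by simp
  next
    case False
    have "v4 = - (v3 / poly B p * poly A p)"
      using AB False by (simp add: field_simps add_eq_0_iff)
    with that[of "v3 / poly B p"] False show ?thesis
      by simp
  qed
  then have c0: "c \<noteq> 0"
    using \<open>v3 \<noteq> 0 \<or> v4 \<noteq> 0\<close> by auto
  define a where "a = (v1 - v2 * p) / c"
  have "v1 - v2 * p = c * a"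
    using c0 by (simp add: a_def)
  then have v'd: "v' = c *s dir p a"
    unfolding v'c c by (simp only:) (simp add: dir_def vec_eq_iff algebra_simps)
  then have "dir p a = (1 / c) *s v'"
    using c0 by simp
  then have dL: "dir p a \<in> L"
    using v'L L(1) vec.subspace_scale by metis
  have "f (p *s u1 + u2 + s *s dir p a) = 0" for s
    using L eL dL vec.subspace_add vec.subspace_scale unfolding e_def by blast
  then have "(p, a) \<in> lines"
    using in_lines_iff by blast
  moreover have "L = vec.span {e, dir p a}"
  proof -
    have sub: "vec.span {e, dir p a} \<subseteq> L"
      using L(1) eL dL by (intro vec.span_minimal) auto
    have "v \<in> vec.span {e, dir p a}"
    proof -
      have "v = c *s dir p a + v2 *s e"
        using v'd by (simp add: v'_def algebra_simps)
      then show ?thesis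
        by (simp add: vec.span_add vec.span_base vec.span_scale)
    qed
    have "vec.independent {v, e}"
      using v(2) e0 by (simp add: vec.independent_insert)
    moreover have "v \<noteq> e"
      using v(2) vec.span_base by fastforce
    ultimately have "card {v, e} \<le> vec.dim (vec.span {e, dir p a})"
      using \<open>v \<in> vec.span {e, dir p a}\<close> vec.span_base[of e "{e, dir p a}"]
      by (intro vec.independent_card_le_dim) auto
    then have "vec.dim L \<le> vec.dim (vec.span {e, dir p a})"
      using \<open>v \<noteq> e\<close> L(2) by simp
    then show ?thesis
      using vec.subspace_dim_equal[OF vec.subspace_span L(1) sub] by simp
  qed
  ultimately show ?thesis
    unfolding e_def by blast
qed

end

section \<open>Charts adapted to a line of the surface\<close>

context quintic_surface
begin

definition surface_lines :: "(('k ^ 4) set) set" where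
  "surface_lines = {L. vec.subspace L \<and> vec.dim L = 2 \<and> (\<forall>v\<in>L. f v = 0)}"

definition lines_meeting :: "('k ^ 4) set \<Rightarrow> (('k ^ 4) set) set" where
  "lines_meeting U = {L \<in> surface_lines. L \<noteq> U \<and> (\<exists>e\<in>L \<inter> U. e \<noteq> 0)}"

text \<open>The new \<open>u1\<close> is the point that the chart misses. It is chosen off the
  ramification points, which gives \<open>W\<close> its full degree 6, and off the finitely many
  points of \<open>Z\<close>.\<close>

lemma good_chart:
  assumes fr: "frame v1 v2 u3 u4" and van: "\<And>x y. f (x *s v1 + y *s v2) = 0" and Z: "finite Z"
  obtains u1 u2 \<phi> where "surface_line F u1 u2 u3 u4 \<phi>" "smooth_line \<phi>"
    "\<And>v. (\<exists>x y. v = x *s u1 + y *s u2) \<longleftrightarrow> (\<exists>x y. v = x *s v1 + y *s v2)"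
    "\<And>z c. z \<in> Z \<Longrightarrow> u1 \<noteq> c *s z"
proof -
  obtain \<psi> where "chart 5 f v1 v2 u3 u4 \<psi>"
    using chart_exists[OF form_f] by blast
  then interpret V: surface_line F v1 v2 u3 u4 \<psi>
    by unfold_locales (use fr van in auto)
  define bad where "bad z = {p. \<exists>c. p *s v1 + v2 = c *s z}" for z
  have "finite (bad z)" for z
  proof -
    have uniq: "p = p'" if "p *s v1 + v2 = c *s z" "p' *s v1 + v2 = c' *s z" for p p' c c'
    proof -
      have "(c' * p - c * p') *s v1 + (c' - c) *s v2 = c' *s (p *s v1 + v2) - c *s (p' *s v1 + v2)"
        by (simp add: vec_eq_iff algebra_simps)
      also have "\<dots> = 0"
        unfolding that by (simp add: mult.commute)
      finally have "(c' * p - c * p') *s v1 + (c' - c) *s v2 + 0 *s u3 + 0 *s u4 = 0"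
        by (simp only: vec.scale_zero_left add_0_right)
      from V.coords_zero[OF this] have *: "c' * p - c * p' = 0" "c' - c = 0"
        by blast+
      then have "c' = c"
        by simp
      with *(1) have "c * (p - p') = 0"
        by (simp only: right_diff_distrib)
      moreover have "c \<noteq> 0"
      proof
        assume "c = 0"
        then have "p *s v1 + 1 *s v2 + 0 *s u3 + 0 *s u4 = 0"
          using that by simp
        then show False
          using V.coords_zero by fastforce
      qed
      ultimately show ?thesis
        by simp
    qed
    show ?thesis
    proof (cases "bad z = {}")
      case False
      then obtain p where "p \<in> bad z"
        by blast
      then have "bad z \<subseteq> {p}"
        using uniq by (auto simp: bad_def)
      then show ?thesis
        by (rule finite_subset) simp
    qed simp
  qed
  then have "finite ({p. poly V.W p = 0} \<union> (\<Union>z\<in>Z. bad z))"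
    using Z V.W_nonzero' poly_roots_finite by auto
  then obtain p where p: "poly V.W p \<noteq> 0" "\<And>z. z \<in> Z \<Longrightarrow> p \<notin> bad z"
    using ex_new_if_finite[OF infinite_UNIV_char_0] by blast
  define u1 where "u1 = p *s v1 + v2"
  have span_eq: "x *s u1 + y *s v1 = (x * p + y) *s v1 + x *s v2" for x y
    by (simp add: u1_def vec_eq_iff algebra_simps)
  have fr': "frame u1 v1 u3 u4"
    unfolding frame_def
  proof (intro conjI allI impI)
    fix v
    obtain x y z w where "v = x *s v1 + y *s v2 + z *s u3 + w *s u4"
      using fr unfolding frame_def by blast
    then have "v = y *s u1 + (x - y * p) *s v1 + z *s u3 + w *s u4"
      unfolding span_eq by simp
    then show "\<exists>x y z w. v = x *s u1 + y *s v1 + z *s u3 + w *s u4"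
      by blast
  next
    fix x y z w
    assume "x *s u1 + y *s v1 + z *s u3 + w *s u4 = 0"
    then have "x * p + y = 0 \<and> x = 0 \<and> z = 0 \<and> w = 0"
      unfolding span_eq by (intro V.coords_zero)
    then show "x = 0" "y = 0" "z = 0" "w = 0"
      by auto
  qed
  obtain \<phi> where "chart 5 f u1 v1 u3 u4 \<phi>"
    using chart_exists[OF form_f] by blast
  moreover have "f (x *s u1 + y *s v1) = 0" for x y
    unfolding span_eq by (rule van)
  ultimately interpret S: surface_line F u1 v1 u3 u4 \<phi>
    by unfold_locales (use fr' in blast)+
  have "hom 4 S.A x 1 = hom 4 V.A (x * p + 1) x" "hom 4 S.B x 1 = hom 4 V.B (x * p + 1) x" for x
    unfolding S.D_u3[symmetric] V.D_u3[symmetric] S.D_u4[symmetric] V.D_u4[symmetric] span_eq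
    by (rule refl)+
  note AB = hom_inverse_chart[OF S.degree_A V.degree_A this(1)] hom_inverse_chart[OF S.degree_B V.degree_B this(2)]
  have "coeff S.W 6 = - poly V.W p"
    unfolding S.W_eq' V.W_eq' wronskian_quartics(2)[OF S.degree_A S.degree_B] AB
    by (simp add: mult.commute)
  then have "coeff S.W 6 \<noteq> 0"
    using p(1) by simp
  then have "degree S.W = 6"
    using wronskian_quartics(1)[OF S.degree_A S.degree_B] le_degree[of S.W 6] unfolding S.W_eq' by simp
  then have "smooth_line \<phi>"
    by unfold_locales (use S.no_common_zero S.not_ruled in auto)
  moreover have "(\<exists>x y. v = x *s u1 + y *s v1) \<longleftrightarrow> (\<exists>x y. v = x *s v1 + y *s v2)" for v
  proof
    assume "\<exists>x y. v = x *s u1 + y *s v1"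
    then show "\<exists>x y. v = x *s v1 + y *s v2"
      unfolding span_eq by blast
  next
    assume "\<exists>x y. v = x *s v1 + y *s v2"
    then obtain x y where "v = x *s v1 + y *s v2"
      by blast
    then have "v = y *s u1 + (x - y * p) *s v1"
      unfolding span_eq by simp
    then show "\<exists>x y. v = x *s u1 + y *s v1"
      by blast
  qed
  moreover have "u1 \<noteq> c *s z" if "z \<in> Z" for z c
    using p(2)[OF that] by (auto simp: bad_def u1_def)
  ultimately show ?thesis
    using that S.surface_line_axioms by blast
qed

lemma inter_unique:
  assumes "vec.subspace L" "vec.dim L = 2" "vec.subspace U" "vec.dim U = 2" "L \<noteq> U"
    "e \<in> L" "e \<in> U" "e \<noteq> 0" "v \<in> L" "v \<in> U"
  shows "\<exists>c. v = c *s e"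
proof (rule ccontr)
  assume *: "\<not> ?thesis"
  have "v \<notin> vec.span {e}"
    using * by (auto simp: vec.span_breakdown_eq)
  then have ind: "vec.independent {v, e}" and ne: "v \<noteq> e"
    using \<open>e \<noteq> 0\<close> vec.span_base[of e "{e}"] by (auto simp: vec.independent_insert)
  have "vec.span {v, e} = X" if "vec.subspace X" "vec.dim X = 2" "e \<in> X" "v \<in> X" for X
  proof (rule vec.subspace_dim_equal)
    show "vec.span {v, e} \<subseteq> X"
      using that by (intro vec.span_minimal) auto
    show "vec.dim X \<le> vec.dim (vec.span {v, e})"
      using that ind ne by (simp add: vec.dim_eq_card_independent)
  qed (use that in auto)
  then show False
    using assms by metis
qed

lemma line_chart:
  assumes fr: "frame v1 v2 u3 u4" and U: "U \<in> surface_lines" "v1 \<in> U" "v2 \<in> U"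
    and Z: "finite Z"
  obtains u1 u2 \<phi> where "surface_line F u1 u2 u3 u4 \<phi>" "smooth_line \<phi>"
    "U = {v. \<exists>x y. v = x *s u1 + y *s u2}" "finite (lines_meeting U)"
    "card (lines_meeting U) \<le> card (quintic_chart.lines \<phi>)" "\<And>z c. z \<in> Z \<Longrightarrow> u1 \<noteq> c *s z"
proof -
  have sU: "vec.subspace U" "vec.dim U = 2" "\<And>v. v \<in> U \<Longrightarrow> f v = 0"
    using U(1) by (auto simp: surface_lines_def)
  have inU: "x *s v1 + y *s v2 \<in> U" for x y
    using sU(1) U(2,3) by (intro vec.subspace_add vec.subspace_scale)
  have van: "f (x *s v1 + y *s v2) = 0" for x y
    using inU sU(3) by blast
  have U_eq: "U = {v. \<exists>x y. v = x *s v1 + y *s v2}"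
  proof -
    have eq: "vec.span {v1, v2} = {v. \<exists>x y. v = x *s v1 + y *s v2}"
      by (auto simp: vec.span_breakdown_eq algebra_simps) (metis add.commute diff_add_cancel eq_diff_eq')
    have c0: "x = 0 \<and> y = 0" if "x *s v1 + y *s v2 = 0" for x y
    proof -
      have "x *s v1 + y *s v2 + 0 *s u3 + 0 *s u4 = 0"
        using that by simp
      then show ?thesis
        using fr unfolding frame_def by blast
    qed
    have "v1 \<notin> vec.span {v2}"
    proof
      assume "v1 \<in> vec.span {v2}"
      then obtain k where "v1 = k *s v2"
        by (auto simp: vec.span_breakdown_eq)
      then have "1 *s v1 + (- k) *s v2 = 0"
        by simp
      then show False
        using c0 by fastforce
    qed
    moreover have "v2 \<noteq> 0"
      using c0[of 0 1] by auto
    ultimately have "vec.independent {v1, v2}" "v1 \<noteq> v2"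
      using vec.span_base[of v2 "{v2}"] by (auto simp: vec.independent_insert)
    then have "vec.dim (vec.span {v1, v2}) = 2"
      by (simp add: vec.dim_eq_card_independent)
    moreover have "vec.span {v1, v2} \<subseteq> U"
      using sU(1) U(2,3) by (intro vec.span_minimal) auto
    ultimately have "vec.span {v1, v2} = U"
      using vec.subspace_dim_equal[OF vec.subspace_span sU(1)] sU(2) by simp
    then show ?thesis
      unfolding eq ..
  qed
  \<comment> \<open>A chart counts only lines that meet \<open>U\<close> off \<open>u1\<close>, and
    only finitely many points can be avoided. Finite sets \<open>Y\<close> of lines therefore come
    first; the uniform bound 29 on them makes \<open>lines_meeting U\<close> finite, and then
    \<open>Y\<close> can be all of it.\<close>
  have chart_for: "\<exists>u1 u2 \<phi>. surface_line F u1 u2 u3 u4 \<phi> \<and> smooth_line \<phi> \<and>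
      U = {v. \<exists>x y. v = x *s u1 + y *s u2} \<and> card Y \<le> card (quintic_chart.lines \<phi>) \<and>
      (\<forall>z\<in>Z. \<forall>c. u1 \<noteq> c *s z)"
    if Y: "finite Y" "Y \<subseteq> lines_meeting U" for Y
  proof -
    have "\<forall>L\<in>Y. \<exists>e\<in>L \<inter> U. e \<noteq> 0"
      using Y(2) by (auto simp: lines_meeting_def)
    then obtain e where e: "\<And>L. L \<in> Y \<Longrightarrow> e L \<in> L" "\<And>L. L \<in> Y \<Longrightarrow> e L \<in> U" "\<And>L. L \<in> Y \<Longrightarrow> e L \<noteq> 0"
      by (metis IntD1 IntD2)
    obtain u1 u2 \<phi> where ch: "surface_line F u1 u2 u3 u4 \<phi>" "smooth_line \<phi>"
      "\<And>v. (\<exists>x y. v = x *s u1 + y *s u2) \<longleftrightarrow> (\<exists>x y. v = x *s v1 + y *s v2)"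
      "\<And>z c. z \<in> Z \<union> e ` Y \<Longrightarrow> u1 \<noteq> c *s z"
      using good_chart[OF fr van, of "Z \<union> e ` Y"] Z Y(1) by blast
    interpret S: surface_line F u1 u2 u3 u4 \<phi>
      by (rule ch(1))
    interpret sm: smooth_line \<phi>
      by (rule ch(2))
    have U2: "U = {v. \<exists>x y. v = x *s u1 + y *s u2}"
      unfolding U_eq ch(3) ..
    have u1U: "u1 \<in> U"
      unfolding U2 using exI[of "\<lambda>x. \<exists>y. u1 = x *s u1 + y *s u2" 1] exI[of "\<lambda>y. u1 = 1 *s u1 + y *s u2" 0] by simp
    have "Y \<subseteq> (\<lambda>(p, a). vec.span {p *s u1 + u2, S.dir p a}) ` S.lines"
    proof
      fix L
      assume L: "L \<in> Y"
      then have sL: "vec.subspace L" "vec.dim L = 2" "\<And>v. v \<in> L \<Longrightarrow> f v = 0" "L \<noteq> U"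
        using Y(2) by (auto simp: lines_meeting_def surface_lines_def)
      obtain x y where xy: "e L = x *s u1 + y *s u2"
        using e(2)[OF L] U2 by blast
      have "u1 \<notin> L"
        using inter_unique[OF sL(1,2) sU(1,2) sL(4) e(1-3)[OF L], of u1] u1U ch(4)[of "e L"] L by blast
      moreover have "y \<noteq> 0"
      proof
        assume "y = 0"
        then have "x \<noteq> 0" "u1 = (1 / x) *s e L"
          using xy e(3)[OF L] by auto
        then show False
          using ch(4)[of "e L" "1 / x"] L by blast
      qed
      ultimately obtain p a where "(p, a) \<in> S.lines" "L = vec.span {p *s u1 + u2, S.dir p a}"
        using S.line_in_chart[OF sL(1-3), of x y] e(1)[OF L] xy by auto
      then show "L \<in> (\<lambda>(p, a). vec.span {p *s u1 + u2, S.dir p a}) ` S.lines"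
        by force
    qed
    then have "card Y \<le> card S.lines"
      using sm.finite_lines by (meson card_image_le card_mono finite_imageI le_trans)
    then show ?thesis
      using ch U2 by blast
  qed
  have fin: "finite (lines_meeting U)"
  proof -
    have "card Y \<le> 29" if "finite Y" "Y \<subseteq> lines_meeting U" for Y
      using chart_for[OF that] smooth_line.card_lines_le_29 le_trans by blast
    then show ?thesis
      using finite_if_finite_subsets_card_bdd[of "lines_meeting U" 29] by blast
  qed
  show ?thesis
    using chart_for[OF fin subset_refl] fin that by blast
qed

end

section \<open>Quartics in adapted coordinates and factorization of forms\<close>

lemma quartic_coeffs:
  fixes p0 p1 q0 q1 b c d :: "'a::comm_ring_1"
  shows "smult b ([:p0, p1:] ^ 3 * [:q0, q1:]) + smult c ([:p0, p1:] ^ 2 * [:q0, q1:] ^ 2) + smult d ([:p0, p1:] * [:q0, q1:] ^ 3) =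
   [:b * p0^3 * q0 + c * p0^2 * q0^2 + d * p0 * q0^3,
     b * (p0^3 * q1 + 3 * p0^2 * p1 * q0) + c * (2 * p0^2 * q0 * q1 + 2 * p0 * p1 * q0^2) + d * (3 * p0 * q0^2 * q1 + p1 * q0^3),
     b * (3 * p0^2 * p1 * q1 + 3 * p0 * p1^2 * q0) + c * (p0^2 * q1^2 + 4 * p0 * p1 * q0 * q1 + p1^2 * q0^2) + d * (3 * p0 * q0 * q1^2 + 3 * p1 * q0^2 * q1),
     b * (3 * p0 * p1^2 * q1 + p1^3 * q0) + c * (2 * p0 * p1 * q1^2 + 2 * p1^2 * q0 * q1) + d * (p0 * q1^3 + 3 * p1 * q0 * q1^2),
     b * p1^3 * q1 + c * p1^2 * q1^2 + d * p1 * q1^3:]"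
  by (simp add: eval_nat_numeral algebra_simps)

text \<open>Two roots of the quartic are the zeros of the linear forms, so only the three middle
  coefficients survive in these coordinates. The factor is the determinant of the coordinate change
  to the weight 4; for \<open>quartic_J\<close> the weight is 6.\<close>

lemma quartic_I_covariant:
  fixes p0 p1 q0 q1 b c d :: "'a::comm_ring_1"
  shows "quartic_I (smult b ([:p0, p1:] ^ 3 * [:q0, q1:]) + smult c ([:p0, p1:] ^ 2 * [:q0, q1:] ^ 2) + smult d ([:p0, p1:] * [:q0, q1:] ^ 3))
   = (p1 * q0 - p0 * q1) ^ 4 * (c^2 - 3 * b * d)"
  unfolding quartic_coeffs quartic_I_def
  by (simp add: eval_nat_numeral) (simp add: algebra_simps)

lemma quartic_J_covariant:
  fixes p0 p1 q0 q1 b c d :: "'a::idom"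
  shows "quartic_J (smult b ([:p0, p1:] ^ 3 * [:q0, q1:]) + smult c ([:p0, p1:] ^ 2 * [:q0, q1:] ^ 2) + smult d ([:p0, p1:] * [:q0, q1:] ^ 3))
   = (p1 * q0 - p0 * q1) ^ 6 * (c * (9 * b * d - 2 * c^2))"
  unfolding quartic_coeffs quartic_J_def
  by (simp add: coeff_pCons eval_nat_numeral(3) numeral_2_eq_2 numeral_3_eq_3) algebra

text \<open>Against a quartic with a triple root and a simple root, the polarization sees a single
  coefficient of the other quartic.\<close>

lemma quartic_I_polar_covariant:
  fixes p0 p1 q0 q1 k :: "'a::idom"
  shows "quartic_I_polar (smult k ([:p0, p1:] ^ 3 * [:q0, q1:]))
     (smult b0 ([:p0, p1:] ^ 4) + (smult b1 ([:p0, p1:] ^ 3 * [:q0, q1:]) + smult b2 ([:p0, p1:] ^ 2 * [:q0, q1:] ^ 2)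
       + smult b3 ([:p0, p1:] * [:q0, q1:] ^ 3)) + smult b4 ([:q0, q1:] ^ 4))
   = - 3 * k * b3 * (p1 * q0 - p0 * q1) ^ 4"
proof -
  have 1: "[:x, y:] ^ 4 = [:x^4, 4 * x^3 * y, 6 * x^2 * y^2, 4 * x * y^3, y^4:]" for x y :: 'a
    by (simp add: eval_nat_numeral algebra_simps)
  have 2: "[:p0, p1:] ^ 3 * [:q0, q1:] = [:p0^3 * q0, p0^3 * q1 + 3 * p0^2 * p1 * q0,
      3 * p0^2 * p1 * q1 + 3 * p0 * p1^2 * q0, 3 * p0 * p1^2 * q1 + p1^3 * q0, p1^3 * q1:]"
    by (simp add: eval_nat_numeral algebra_simps)
  show ?thesis
    unfolding quartic_coeffs 1 2 quartic_I_polar_def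
    by (simp add: coeff_pCons eval_nat_numeral(3) numeral_2_eq_2 numeral_3_eq_3) algebra
qed

lemma form_0_const:
  assumes "form 0 g"
  shows "g v = g w"
proof -
  have "d = 0 \<longrightarrow> g v = g w" if "form d g" for d
    using that by (induction rule: form.induct) auto
  then show ?thesis
    using assms by blast
qed

text \<open>After division by \<open>\<mu>\<close> the quotient still vanishes where another
  \<open>\<nu>\<close> does: along a direction in the kernel of \<open>\<nu>\<close> but not of
  \<open>\<mu>\<close>, the quotient is a polynomial whose product with a nonzero linear polynomial
  is zero.\<close>

lemma form_factor:
  assumes "finite S" "\<And>\<mu>. \<mu> \<in> S \<Longrightarrow> lin \<mu>" "\<And>\<mu>. \<mu> \<in> S \<Longrightarrow> \<exists>e. \<mu> e \<noteq> 0"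
    "\<And>\<mu> \<nu>. \<mu> \<in> S \<Longrightarrow> \<nu> \<in> S \<Longrightarrow> \<mu> \<noteq> \<nu> \<Longrightarrow> \<exists>e. \<nu> e = 0 \<and> \<mu> e \<noteq> 0"
    "form (d + card S) g" "\<And>\<mu> v. \<mu> \<in> S \<Longrightarrow> \<mu> v = 0 \<Longrightarrow> g v = (0 :: 'k::field_char_0)"
  shows "\<exists>h. form d h \<and> (\<forall>v. g v = (\<Prod>\<mu>\<in>S. \<mu> v) * h v)"
  using assms
proof (induction S arbitrary: g)
  case empty
  then show ?case
    by auto
next
  case (insert \<mu> S)
  have \<mu>: "lin \<mu>"
    using insert.prems(1) by simp
  obtain e0 where "\<mu> e0 \<noteq> 0"
    using insert.prems(2) by blast
  define e where "e = (1 / \<mu> e0) *s e0"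
  have e: "\<mu> e = 1"
    using \<open>\<mu> e0 \<noteq> 0\<close> by (simp add: e_def lin_scale[OF \<mu>])
  have "form (Suc (d + card S)) g"
    using insert.prems(4) insert.hyps by simp
  then obtain h where h: "form (d + card S) h" "\<And>v. g v = \<mu> v * h v + g (v - \<mu> v *s e)"
    using form_divide[OF _ \<mu>, of "d + card S" g e] by blast
  have "\<mu> (v - \<mu> v *s e) = 0" for v
    by (simp add: lin_diff[OF \<mu>] lin_scale[OF \<mu>] e)
  then have "g (v - \<mu> v *s e) = 0" for v
    using insert.prems(5)[of \<mu>] by simp
  then have g: "g v = \<mu> v * h v" for v
    using h(2)[of v] by simp
  have "h v = 0" if \<nu>: "\<nu> \<in> S" "\<nu> v = 0" for \<nu> v
  proof -
    have "\<mu> \<noteq> \<nu>"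
      using \<nu> insert.hyps by auto
    then obtain e' where e': "\<nu> e' = 0" "\<mu> e' \<noteq> 0"
      using insert.prems(3)[of \<mu> \<nu>] \<nu> by auto
    have l\<nu>: "lin \<nu>"
      using insert.prems(1) \<nu> by simp
    obtain p where p: "\<And>s. h (v + s *s e') = poly p s"
      using form_line[OF h(1), of v e'] by blast
    have "poly ([:\<mu> v, \<mu> e':] * p) s = 0" for s
    proof -
      have "\<nu> (v + s *s e') = 0"
        using \<nu> e' by (simp add: lin_add[OF l\<nu>] lin_scale[OF l\<nu>])
      then have "g (v + s *s e') = 0"
        using insert.prems(5)[of \<nu>] \<nu> by simp
      then have "\<mu> (v + s *s e') * poly p s = 0"
        unfolding g p .
      then show ?thesis
        by (simp add: lin_add[OF \<mu>] lin_scale[OF \<mu>] del: mult_pCons_left)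
    qed
    then have "[:\<mu> v, \<mu> e':] * p = 0"
      using poly_all_0_iff_0 by blast
    then have "p = 0"
      using e' unfolding mult_eq_0_iff by simp
    then show ?thesis
      using p[of 0] by simp
  qed
  then have "\<exists>k. form d k \<and> (\<forall>v. h v = (\<Prod>\<mu>\<in>S. \<mu> v) * k v)"
    using insert.prems(1-3) h(1) by (intro insert.IH) auto
  then obtain k where "form d k" "\<And>v. h v = (\<Prod>\<mu>\<in>S. \<mu> v) * k v"
    by blast
  then show ?case
    using insert.hyps g by (intro exI[of _ k]) (simp add: mult.assoc)
qed

lemma frame_coordinate:
  fixes u1 u2 u3 u4 :: "'k::field ^ 'n"
  assumes fr: "frame u1 u2 u3 u4"
  obtains \<mu> \<eta> where "lin \<mu>" "lin \<eta>" "\<And>x y z w. \<mu> (x *s u1 + y *s u2 + z *s u3 + w *s u4) = z"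
    "\<And>x y z w. \<eta> (x *s u1 + y *s u2 + z *s u3 + w *s u4) = w"
proof -
  define \<mu> where "\<mu> v = (THE z. \<exists>x y w. v = x *s u1 + y *s u2 + z *s u3 + w *s u4)" for v
  define \<eta> where "\<eta> v = (THE w. \<exists>x y z. v = x *s u1 + y *s u2 + z *s u3 + w *s u4)" for v
  have uniq: "x = x' \<and> y = y' \<and> z = z' \<and> w = w'"
    if "x *s u1 + y *s u2 + z *s u3 + w *s u4 = x' *s u1 + y' *s u2 + z' *s u3 + w' *s u4" for x y z w x' y' z' w'
  proof -
    have "(x - x') *s u1 + (y - y') *s u2 + (z - z') *s u3 + (w - w') *s u4 =
        (x *s u1 + y *s u2 + z *s u3 + w *s u4) - (x' *s u1 + y' *s u2 + z' *s u3 + w' *s u4)"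
      by (simp add: vec_eq_iff algebra_simps)
    then have "(x - x') *s u1 + (y - y') *s u2 + (z - z') *s u3 + (w - w') *s u4 = 0"
      unfolding that by simp
    then have "x - x' = 0 \<and> y - y' = 0 \<and> z - z' = 0 \<and> w - w' = 0"
      using fr unfolding frame_def by blast
    then show ?thesis
      by simp
  qed
  have \<mu>: "\<mu> (x *s u1 + y *s u2 + z *s u3 + w *s u4) = z"
    and \<eta>: "\<eta> (x *s u1 + y *s u2 + z *s u3 + w *s u4) = w" for x y z w
    unfolding \<mu>_def \<eta>_def by (rule the_equality; use uniq in blast)+
  have "lin \<mu> \<and> lin \<eta>"
    unfolding lin_def
  proof (intro conjI allI)
    fix u v :: "'k ^ 'n" and c :: 'k
    obtain x y z w where u: "u = x *s u1 + y *s u2 + z *s u3 + w *s u4"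
      using fr unfolding frame_def by blast
    obtain x' y' z' w' where v: "v = x' *s u1 + y' *s u2 + z' *s u3 + w' *s u4"
      using fr unfolding frame_def by blast
    have "u + v = (x + x') *s u1 + (y + y') *s u2 + (z + z') *s u3 + (w + w') *s u4"
      "c *s v = (c * x') *s u1 + (c * y') *s u2 + (c * z') *s u3 + (c * w') *s u4"
      unfolding u v by (simp_all add: vec_eq_iff algebra_simps)
    then show "\<mu> (u + v) = \<mu> u + \<mu> v" "\<eta> (u + v) = \<eta> u + \<eta> v" "\<mu> (c *s v) = c * \<mu> v" "\<eta> (c *s v) = c * \<eta> v"
      by (simp_all only: \<mu> \<eta> u v)
  qed
  with \<mu> \<eta> show ?thesis
    using that by blast
qed

lemma frame_exists:
  fixes U H :: "('k::field ^ 4) set"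
  assumes U: "vec.subspace U" "vec.dim U = 2" "U \<subseteq> H" and H: "vec.subspace H"
    and u3: "u3 \<in> H" "u3 \<notin> U" and u4: "u4 \<notin> H"
  obtains v1 v2 where "v1 \<in> U" "v2 \<in> U" "frame v1 v2 u3 u4"
proof -
  obtain b where b: "b \<subseteq> U" "vec.independent b" "U \<subseteq> vec.span b" "card b = 2"
    using vec.basis_exists[of U] U(2) by metis
  then obtain v1 v2 where v: "b = {v1, v2}" "v1 \<noteq> v2"
    by (metis card_2_iff)
  have vU: "v1 \<in> U" "v2 \<in> U"
    using b v by auto
  have span: "vec.span {v1, v2} = U"
    using b(1,3) U(1) unfolding v by (metis vec.span_minimal subset_antisym)
  have i3: "vec.independent {u3, v1, v2}"
    using b(2) u3(2) span unfolding v by (metis vec.independent_insertI)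
  have "vec.span {u3, v1, v2} \<subseteq> H"
    using H u3(1) vU U(3) by (intro vec.span_minimal) auto
  then have n4: "u4 \<notin> vec.span {u3, v1, v2}"
    using u4 by auto
  then have i4: "vec.independent {u4, u3, v1, v2}"
    using i3 by (rule vec.independent_insertI)
  have d: "u3 \<notin> {v1, v2}" "u4 \<notin> {u3, v1, v2}"
    using u3 u4 vU U(3) by auto
  have card: "card {u4, u3, v1, v2} = 4"
    using d v(2) by auto
  have "vec.dim (vec.span {u4, u3, v1, v2}) = 4"
    using i4 card by (simp add: vec.dim_eq_card_independent)
  moreover have "vec.dim (UNIV :: ('k ^ 4) set) = 4"
    unfolding vec_dim_card by simp
  ultimately have "vec.dim (UNIV :: ('k ^ 4) set) \<le> vec.dim (vec.span {u4, u3, v1, v2})"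
    by (simp only: order_refl)
  then have full: "vec.span {u4, u3, v1, v2} = UNIV"
    by (rule vec.subspace_dim_equal[OF vec.subspace_span vec.subspace_UNIV subset_UNIV])
  have "frame v1 v2 u3 u4"
    unfolding frame_def
  proof (intro conjI allI impI)
    fix v :: "'k ^ 4"
    have "v \<in> vec.span {u4, u3, v1, v2}"
      unfolding full by simp
    then obtain w z x y where "v - w *s u4 - z *s u3 - x *s v1 = y *s v2"
      unfolding vec.span_breakdown_eq by (auto simp: algebra_simps)
    then have "v = x *s v1 + y *s v2 + z *s u3 + w *s u4"
      by (simp add: vec_eq_iff algebra_simps)
    then show "\<exists>x y z w. v = x *s v1 + y *s v2 + z *s u3 + w *s u4"
      by blast
  next
    fix x y z w
    assume eq: "x *s v1 + y *s v2 + z *s u3 + w *s u4 = 0"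
    have "(\<Sum>u\<in>{u4, u3, v1, v2}. (if u = u4 then w else if u = u3 then z else if u = v1 then x else y) *s u) = 0"
    proof -
      have "u3 \<noteq> v1" "u3 \<noteq> v2" "v1 \<noteq> u3" "v2 \<noteq> u3" "u4 \<noteq> u3" "u3 \<noteq> u4" "v1 \<noteq> u4" "v2 \<noteq> u4"
        "u4 \<noteq> v1" "u4 \<noteq> v2" "v1 \<noteq> v2" "v2 \<noteq> v1"
        using d v(2) by auto
      then show ?thesis
        using eq by (simp add: algebra_simps)
    qed
    from vec.independentD[OF i4 _ subset_refl this]
    have 0: "(if u = u4 then w else if u = u3 then z else if u = v1 then x else y) = 0"
      if "u \<in> {u4, u3, v1, v2}" for u
      using that by blast
    show "x = 0" "y = 0" "z = 0" "w = 0"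
      using 0[of v1] 0[of v2] 0[of u3] 0[of u4] d v(2) by auto
  qed
  then show ?thesis
    using that vU by blast
qed

lemma order_prod_eq:
  assumes "finite S" "\<And>i. i \<in> S \<Longrightarrow> p i \<noteq> (0 :: 'a::idom poly)"
  shows "order x (prod p S) = (\<Sum>i\<in>S. order x (p i))"
  using assms
proof (induction S)
  case (insert i S)
  then have "p i * prod p S \<noteq> 0"
    by auto
  then show ?case
    using insert by (simp add: order_mult)
qed simp

lemma prod_const_polys: "(\<Prod>i\<in>S. [:a i:]) = [:\<Prod>i\<in>S. a i:]"
  by (induction S rule: infinite_finite_induct) (auto simp: one_pCons mult.commute)

lemma order_linear:
  assumes "a \<noteq> 0 \<or> b \<noteq> (0 :: 'a::field)"
  shows "order x [:a, b:] = (if a + x * b = 0 then 1 else 0)"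
proof (cases "a + x * b = 0")
  case True
  then have a: "a = - (x * b)"
    by (simp add: add_eq_0_iff)
  with assms have "b \<noteq> 0"
    by auto
  have eq: "[:a, b:] = smult b [:- x, 1:]"
    by (simp add: a mult.commute)
  have "order x [:a, b:] = order x [:- x, 1:]"
    unfolding eq using \<open>b \<noteq> 0\<close> by (rule order_smult)
  then show ?thesis
    using True order_power_n_n[of x 1] by simp
next
  case False
  then show ?thesis
    by (simp add: order_0I)
qed

lemma double_root_pderiv:
  fixes p :: "'a::{idom,ring_char_0} poly"
  assumes "[:- x, 1:] ^ 2 dvd p"
  shows "poly (pderiv p) x = 0"
proof -
  obtain q where "p = [:- x, 1:] ^ Suc 1 * q"
    using assms by (metis dvdE numeral_2_eq_2 One_nat_def)
  then show ?thesis
    using pderiv_linear_power_mult[of x 1 q] by simp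
qed

context surface_line
begin

text \<open>At a root of \<open>A\<close> the other generator \<open>B\<close> is nonzero, so the
  derivative of \<open>A\<close> determines the order of the Wronskian.\<close>

lemma order_W_from_A:
  assumes A0: "A \<noteq> 0" and n: "order P A = Suc n"
  shows "order P W = n"
proof -
  define L where "L = [:- P, 1:]"
  obtain A1 where "A = L ^ order P A * A1" and A1: "poly A1 P \<noteq> 0"
    unfolding L_def by (rule order_factor[OF A0])
  then have A: "A = L ^ Suc n * A1"
    unfolding n by simp
  then have dA: "pderiv A = L ^ n * (smult (of_nat (Suc n)) A1 + L * pderiv A1)"
    using pderiv_linear_power_mult[of P n A1] by (simp add: L_def)
  have "poly A P = 0"
    unfolding A by (simp add: L_def)
  then have B: "poly B P \<noteq> 0"
    using no_common_zero by auto
  define X where "X = (smult (of_nat (Suc n)) A1 + L * pderiv A1) * B - L * pderiv B * A1"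
  have BA: "pderiv B * A = pderiv B * (L ^ Suc n * A1)"
    by (rule arg_cong[OF A])
  have "W = L ^ n * X"
    unfolding W_eq' dA X_def BA by (simp add: algebra_simps)
  moreover have "poly X P \<noteq> 0"
    using A1 B of_nat_neq_0[of n, where 'a = 'k] by (simp add: X_def L_def del: of_nat_Suc)
  ultimately show ?thesis
    using order_factor_unique[of X P n] by (simp add: L_def)
qed

lemma D_u4_general: "D (x *s u1 + y *s u2 + z *s u3) u4 = (\<Sum>k\<le>4. hom (4 - k) (\<phi> k 1) x y * z ^ k)"
proof -
  have "f (x *s u1 + y *s u2 + z *s u3 + w *s u4) =
      poly (\<Sum>l\<le>5. monom (\<Sum>k\<le>5. hom (5 - k - l) (\<phi> k l) x y * z ^ k) l) w" for w
    unfolding f_eq by (subst sum.swap) (simp add: poly_sum poly_monom sum_distrib_right)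
  from dir_deriv_line[OF this, of 0] show ?thesis
    using zero_gt[of 5 1] by (simp add: numeral_sums pderiv_add pderiv_monom poly_monom)
qed

end

section \<open>Plane sections that consist of five lines\<close>

locale plane_section = quintic_surface F
  for F :: "(4, 'k::{alg_closed_field,field_char_0}) mpolynomial" +
  fixes H :: "('k ^ 4) set" and u4 :: "'k ^ 4" and \<U> :: "('k ^ 4) set set"
    and lf :: "('k ^ 4) set \<Rightarrow> 'k ^ 4 \<Rightarrow> 'k" and c :: 'k
  assumes H: "vec.subspace H" "vec.dim H = 3" and u4: "u4 \<notin> H"
    and \<U>: "U \<in> \<U> \<Longrightarrow> U \<in> surface_lines" "U \<in> \<U> \<Longrightarrow> U \<subseteq> H" "card \<U> = 5"
    and lin: "U \<in> \<U> \<Longrightarrow> lin (lf U)" and ker: "U \<in> \<U> \<Longrightarrow> v \<in> H \<Longrightarrow> lf U v = 0 \<longleftrightarrow> v \<in> U"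
    and f_prod: "v \<in> H \<Longrightarrow> f v = c * (\<Prod>U\<in>\<U>. lf U v)"
begin

lemma finite_\<U>: "finite \<U>"
  using \<U>(3) card.infinite by fastforce

lemma line_subspace: "U \<in> \<U> \<Longrightarrow> vec.subspace U" "U \<in> \<U> \<Longrightarrow> vec.dim U = 2"
  using \<U>(1) by (auto simp: surface_lines_def)

abbreviation M :: "('k ^ 4) set \<Rightarrow> nat" where
  "M U \<equiv> card (lines_meeting U)"

definition through :: "'k ^ 4 \<Rightarrow> ('k ^ 4) set set" where
  "through v = {U \<in> \<U>. v \<in> U}"

lemma H_minus_line:
  assumes "U \<in> \<U>"
  obtains u3 where "u3 \<in> H" "u3 \<notin> U"
proof -
  have "H \<noteq> U"
    using H(2) line_subspace(2)[OF assms] by auto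
  then show ?thesis
    using that \<U>(2)[OF assms] by blast
qed

lemma meet:
  assumes "U \<in> \<U>" "V \<in> \<U>"
  obtains e where "e \<in> U" "e \<in> V" "e \<noteq> 0"
proof -
  note s = line_subspace[OF assms(1)] line_subspace[OF assms(2)]
  define S where "S = {x + y |x y. x \<in> U \<and> y \<in> V}"
  have "S \<subseteq> H"
    unfolding S_def using \<U>(2) assms vec.subspace_add[OF H(1)] by blast
  then have "vec.dim S \<le> 3"
    using vec.dim_subset[of S H] unfolding H(2) by blast
  moreover have "vec.dim S + vec.dim (U \<inter> V) = 2 + 2"
    using vec.dim_sums_Int[OF s(1) s(3)] unfolding S_def s(2) s(4) .
  ultimately have "vec.dim (U \<inter> V) \<noteq> 0"
    by linarith
  then have "\<not> U \<inter> V \<subseteq> {0}"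
    unfolding vec.dim_eq_0 .
  then show ?thesis
    using that by blast
qed

lemma chart:
  assumes U: "U \<in> \<U>" and u3: "u3 \<in> H" "u3 \<notin> U" and Z: "finite Z"
  obtains u1 u2 \<phi> where "surface_line F u1 u2 u3 u4 \<phi>" "smooth_line \<phi>"
    "U = {v. \<exists>x y. v = x *s u1 + y *s u2}" "finite (lines_meeting U)"
    "M U \<le> card (quintic_chart.lines \<phi>)" "\<And>z k. z \<in> Z \<Longrightarrow> u1 \<noteq> k *s z"
proof -
  obtain v1 v2 where v: "v1 \<in> U" "v2 \<in> U" "frame v1 v2 u3 u4"
    by (rule frame_exists[OF line_subspace[OF U] \<U>(2)[OF U] H(1) u3 u4])
  show ?thesis
    by (rule line_chart[OF v(3) \<U>(1)[OF U] v(1,2) Z]) (rule that)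
qed

end

locale plane_chart = plane_section F H u4 \<U> lf c + surface_line F u1 u2 u3 u4 \<phi> + smooth_line \<phi>
  for F :: "(4, 'k::{alg_closed_field,field_char_0}) mpolynomial" and H u4 \<U> lf c u1 u2 u3 \<phi> +
  fixes U :: "('k ^ 4) set"
  assumes U: "U \<in> \<U>" and U_eq: "U = {v. \<exists>x y. v = x *s u1 + y *s u2}" and u3: "u3 \<in> H"
    and M: "M U \<le> card lines"
begin

lemma in_U: "x *s u1 + y *s u2 \<in> U"
  unfolding U_eq by blast

lemma in_U': "x *s u1 + u2 \<in> U"
  using in_U[of x 1] by simp

definition others :: "('k ^ 4) set set" where
  "others = \<U> - {U}"

lemma lf_combine: "V \<in> \<U> \<Longrightarrow> lf V (x *s u + v) = x * lf V u + lf V v"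
  by (simp add: lin_add[OF lin] lin_scale[OF lin])

lemma zero_iff:
  assumes "V \<in> \<U>"
  shows "poly [:lf V u2, lf V u1:] P = 0 \<longleftrightarrow> P *s u1 + u2 \<in> V"
proof -
  have "P *s u1 + u2 \<in> H"
    using in_U' \<U>(2)[OF U] by blast
  moreover have "poly [:lf V u2, lf V u1:] P = lf V (P *s u1 + u2)"
    unfolding lf_combine[OF assms] by simp
  ultimately show ?thesis
    using ker[OF assms] by (simp only:)
qed

text \<open>The product formula is restricted to the vectors \<open>x *s u1 + u2 + z *s u3\<close>
  and compared in powers of \<open>z\<close>. The factor of \<open>U\<close> contributes
  \<open>z * lf U u3\<close>, which shifts the exponent by one.\<close>

lemma \<phi>_k_0:
  assumes "k \<le> 4"
  shows "poly (\<phi> (Suc k) 0) x = c * lf U u3 * coeff (\<Prod>V\<in>others. [:lf V (x *s u1 + u2), lf V u3:]) k"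
proof -
  let ?P = "\<Prod>V\<in>others. [:lf V (x *s u1 + u2), lf V u3:]"
  let ?S = "\<Sum>k\<le>5. monom (poly (\<phi> k 0) x) k"
  have "poly ?S z = poly (smult (c * lf U u3) (pCons 0 ?P)) z" for z
  proof -
    have "x *s u1 + u2 + z *s u3 \<in> H"
      using in_U'[of x] \<U>(2)[OF U] u3 H(1) by (meson subsetD vec.subspace_add vec.subspace_scale)
    then have "f (x *s u1 + u2 + z *s u3) = c * (\<Prod>V\<in>\<U>. lf V (x *s u1 + u2 + z *s u3))"
      by (rule f_prod)
    also have "(\<Prod>V\<in>\<U>. lf V (x *s u1 + u2 + z *s u3)) =
        lf U (x *s u1 + u2 + z *s u3) * (\<Prod>V\<in>others. lf V (x *s u1 + u2 + z *s u3))"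
      unfolding others_def by (rule prod.remove[OF finite_\<U> U])
    also have "lf U (x *s u1 + u2 + z *s u3) = z * lf U u3"
      using ker[OF U, of "x *s u1 + u2"] in_U'[of x] \<U>(2)[OF U]
      by (auto simp: lin_add[OF lin[OF U]] lin_scale[OF lin[OF U]])
    also have "(\<Prod>V\<in>others. lf V (x *s u1 + u2 + z *s u3)) = poly ?P z"
      unfolding poly_prod by (rule prod.cong) (auto simp: others_def lin_add[OF lin] lin_scale[OF lin])
    finally have "f (x *s u1 + u2 + z *s u3) = c * (z * lf U u3 * poly ?P z)" .
    moreover have "f (x *s u1 + u2 + z *s u3) = poly ?S z"
      using f_eq_z[of x 1 z] poly_hom[OF degree_le[of _ 0]] by (simp add: poly_sum poly_monom)
    ultimately show ?thesis
      by simp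
  qed
  then have "?S = smult (c * lf U u3) (pCons 0 ?P)"
    by (intro poly_eq_poly_eq_iff[THEN iffD1] ext)
  from arg_cong[OF this, of "\<lambda>p. coeff p (Suc k)"] show ?thesis
    using assms by (simp add: coeff_sum)
qed

lemma A_prod: "A = smult (c * lf U u3) (\<Prod>V\<in>others. [:lf V u2, lf V u1:])"
proof (rule poly_eq_poly_eq_iff[THEN iffD1], rule ext)
  fix x
  have "coeff (\<Prod>V\<in>others. [:lf V (x *s u1 + u2), lf V u3:]) 0 = (\<Prod>V\<in>others. lf V (x *s u1 + u2))"
    by (simp add: poly_0_coeff_0[symmetric] poly_prod)
  also have "\<dots> = (\<Prod>V\<in>others. poly [:lf V u2, lf V u1:] x)"
    by (rule prod.cong) (auto simp: others_def lf_combine)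
  finally show "poly A x = poly (smult (c * lf U u3) (\<Prod>V\<in>others. [:lf V u2, lf V u1:])) x"
    using \<phi>_k_0[of 0 x] by (simp add: poly_prod)
qed

lemma A_nonzero: "A \<noteq> 0"
  using W_nonzero unfolding W_eq' by auto

lemma scalar_nonzero: "c * lf U u3 \<noteq> 0"
  using A_nonzero A_prod by auto

lemma node:
  assumes "v \<in> U" "v \<noteq> 0" "\<And>k. u1 \<noteq> k *s v"
  obtains P y where "y \<noteq> 0" "v = y *s (P *s u1 + u2)"
proof -
  obtain x y where xy: "v = x *s u1 + y *s u2"
    using assms(1) U_eq by blast
  have "y \<noteq> 0"
  proof
    assume "y = 0"
    then have "x \<noteq> 0" "u1 = (1 / x) *s v"
      using xy assms(2) by auto
    then show False
      using assms(3) by blast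
  qed
  then show ?thesis
    using that[of y "x / y"] xy by (simp add: vec.scale_right_distrib)
qed

lemma mem_scale: "V \<in> \<U> \<Longrightarrow> y \<noteq> 0 \<Longrightarrow> y *s v \<in> V \<longleftrightarrow> v \<in> V"
  using line_subspace(1) by (metis vec.subspace_scale vec.scale_scale left_inverse vec.scale_one)

text \<open>The roots of \<open>A\<close> are the points in which the other four lines meet
  \<open>U\<close>. Besides \<open>U\<close>, n + 1 lines pass through \<open>v\<close>, which is
  the order of \<open>A\<close> there; the order of \<open>W\<close> is one less.\<close>

lemma order_W_node:
  assumes y: "y \<noteq> 0" and v: "v = y *s (P *s u1 + u2)" and card: "card (through v) = n + 2"
  shows "order P W = n"
proof (rule order_W_from_A[OF A_nonzero])
  have lin0: "lf V u2 \<noteq> 0 \<or> lf V u1 \<noteq> 0" if "V \<in> others" for V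
  proof -
    have "[:lf V u2, lf V u1:] \<noteq> 0"
      using that A_nonzero A_prod finite_\<U> by (auto simp: others_def prod_zero_iff)
    then show ?thesis
      by auto
  qed
  have "order P A = order P (\<Prod>V\<in>others. [:lf V u2, lf V u1:])"
    by (subst A_prod, rule order_smult) (rule scalar_nonzero)
  also have "\<dots> = (\<Sum>V\<in>others. order P [:lf V u2, lf V u1:])"
    by (rule order_prod_eq) (use finite_\<U> lin0 in \<open>auto simp: others_def\<close>)
  also have "\<dots> = (\<Sum>V\<in>others. if v \<in> V then 1 else 0)"
  proof (rule sum.cong)
    fix V
    assume V: "V \<in> others"
    then have V': "V \<in> \<U>"
      by (simp add: others_def)
    have "v \<in> V \<longleftrightarrow> poly [:lf V u2, lf V u1:] P = 0"
      unfolding v mem_scale[OF V' y] zero_iff[OF V'] ..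
    then show "order P [:lf V u2, lf V u1:] = (if v \<in> V then 1 else 0)"
      using order_linear[OF lin0[OF V], of P] by simp
  qed simp
  also have "\<dots> = card (through v - {U})"
    using finite_\<U> by (simp add: sum.If_cases others_def through_def) (rule arg_cong[of _ _ card], auto)
  also have "U \<in> through v"
    using U in_U'[of P] unfolding through_def v mem_Collect_eq mem_scale[OF U y] by (rule conjI)
  then have "card (through v - {U}) = Suc n"
    using card finite_\<U> by (simp add: through_def)
  finally show "order P A = Suc n" .
qed

text \<open>Up to a constant, \<open>\<phi> 2 0\<close> is a sum of products of three of the four
  linear factors of \<open>A\<close>, and each product contains two that vanish at \<open>P\<close>.
  Hence its derivative vanishes at \<open>P\<close>; the other terms of \<open>T 1 2\<close> contain
  \<open>A\<close>.\<close>

lemma T_1_2_node: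
  assumes P: "poly A P = 0" and three: "a \<in> others" "b \<in> others" "d \<in> others" "a \<noteq> b" "a \<noteq> d" "b \<noteq> d"
    and z: "P *s u1 + u2 \<in> a" "P *s u1 + u2 \<in> b" "P *s u1 + u2 \<in> d"
  shows "poly (T 1 2) P = 0"
proof -
  let ?l = "\<lambda>V. [:lf V u2, lf V u1:]"
  have fin: "finite others"
    using finite_\<U> by (simp add: others_def)
  have eq: "\<phi> 2 0 = smult (c * lf U u3) (\<Sum>V\<in>others. smult (lf V u3) (prod ?l (others - {V})))"
  proof (rule poly_eq_poly_eq_iff[THEN iffD1], rule ext)
    fix x
    let ?P = "\<Prod>V\<in>others. [:lf V (x *s u1 + u2), lf V u3:]"
    have "coeff ?P 1 = poly (pderiv ?P) 0"
      by (simp add: poly_0_coeff_0 coeff_pderiv)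
    also have "\<dots> = (\<Sum>V\<in>others. lf V u3 * (\<Prod>V\<in>others - {V}. lf V (x *s u1 + u2)))"
      by (simp add: pderiv_prod poly_sum poly_prod pderiv_pCons mult.commute)
    also have "\<dots> = (\<Sum>V\<in>others. lf V u3 * (\<Prod>V\<in>others - {V}. poly (?l V) x))"
      by (intro sum.cong refl arg_cong2[of _ _ _ _ "(*)"] prod.cong) (auto simp: others_def lf_combine)
    finally show "poly (\<phi> 2 0) x = poly (smult (c * lf U u3) (\<Sum>V\<in>others. smult (lf V u3) (prod ?l (others - {V})))) x"
      using \<phi>_k_0[of 1 x] by (simp add: poly_prod poly_sum numeral_2_eq_2)
  qed
  have root: "[:- P, 1:] dvd ?l V" if "V \<in> others" "P *s u1 + u2 \<in> V" for V
  proof -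
    have "V \<in> \<U>"
      using that(1) by (simp add: others_def)
    then show ?thesis
      using that(2) zero_iff[of V P] by (simp only: poly_eq_0_iff_dvd)
  qed
  have two: "[:- P, 1:] ^ 2 dvd prod ?l (others - {V})" if "V \<in> others" for V
  proof -
    obtain s t where st: "s \<noteq> t" "s \<in> others - {V}" "t \<in> others - {V}" "P *s u1 + u2 \<in> s" "P *s u1 + u2 \<in> t"
      using three z by (metis Diff_iff singletonD)
    have "prod ?l (others - {V}) = ?l s * (?l t * prod ?l (others - {V} - {s} - {t}))"
      using st fin by (subst prod.remove[of _ s], simp, simp) (subst prod.remove[of _ t], auto)
    then show ?thesis
      unfolding power2_eq_square using root[of s] root[of t] st
      by (simp only:) (intro mult_dvd_mono; auto simp del: mult_pCons_left)
  qed
  have "[:- P, 1:] ^ 2 dvd \<phi> 2 0"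
    unfolding eq by (intro dvd_smult dvd_sum two)
  then have "poly (pderiv (\<phi> 2 0)) P = 0"
    by (rule double_root_pderiv)
  then show ?thesis
    unfolding T_1_2_eq using P by simp
qed

lemma A_zero_at:
  assumes V: "V \<in> others" and "P *s u1 + u2 \<in> V"
  shows "poly A P = 0"
proof -
  have V': "V \<in> \<U>"
    using V by (simp add: others_def)
  have "poly [:lf V u2, lf V u1:] P = 0"
    unfolding zero_iff[OF V'] by (rule assms(2))
  then have "\<exists>V\<in>others. poly [:lf V u2, lf V u1:] P = 0"
    using V by blast
  moreover have "finite others"
    using finite_\<U> by (simp add: others_def)
  ultimately have "(\<Prod>V\<in>others. poly [:lf V u2, lf V u1:] P) = 0"
    by (simp only: prod_zero_iff)
  then show ?thesis
    by (subst A_prod) (simp only: poly_smult poly_prod mult_zero_right)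
qed

lemma coordinates:
  assumes p: "p \<in> U" and q: "q \<in> U" "\<And>k. q \<noteq> k *s p" "p \<noteq> 0"
  obtains p0 p1 q0 q1 where "\<And>x. x *s u1 + u2 = (p0 + x * p1) *s p + (q0 + x * q1) *s q"
    "u1 = p1 *s p + q1 *s q" "u2 = p0 *s p + q0 *s q" "p1 * q0 - p0 * q1 \<noteq> 0"
proof -
  obtain a b where ab: "p = a *s u1 + b *s u2"
    using p U_eq by blast
  obtain a' b' where ab': "q = a' *s u1 + b' *s u2"
    using q U_eq by blast
  define d where "d = a * b' - a' * b"
  have "d \<noteq> 0"
  proof
    assume "d = 0"
    then have ad: "a * b' = a' * b"
      by (simp add: d_def)
    have "a \<noteq> 0 \<or> b \<noteq> 0"
      using ab q(3) by auto
    then obtain k where "a' = k * a" "b' = k * b"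
    proof (cases "a = 0")
      case True
      with \<open>a \<noteq> 0 \<or> b \<noteq> 0\<close> that[of "b' / b"] ad show ?thesis
        by simp
    next
      case False
      with that[of "a' / a"] ad show ?thesis
        by (simp add: field_simps)
    qed
    then have "q = k *s p"
      unfolding ab ab' by (simp add: vec.scale_right_distrib)
    then show False
      using q(2) by blast
  qed
  have u1: "u1 = (b' / d) *s p + (- b / d) *s q"
  proof -
    have "(b' / d) *s p + (- b / d) *s q = ((a * b' - a' * b) / d) *s u1"
      unfolding ab ab' by (simp add: vec_eq_iff field_simps diff_divide_distrib)
    then show ?thesis
      using \<open>d \<noteq> 0\<close> by (simp add: d_def)
  qed
  have u2: "u2 = (- a' / d) *s p + (a / d) *s q"
  proof -
    have "(- a' / d) *s p + (a / d) *s q = ((a * b' - a' * b) / d) *s u2"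
      unfolding ab ab' by (simp add: vec_eq_iff field_simps diff_divide_distrib)
    then show ?thesis
      using \<open>d \<noteq> 0\<close> by (simp add: d_def)
  qed
  have "x *s u1 + u2 = (- a' / d + x * (b' / d)) *s p + (a / d + x * (- b / d)) *s q" for x
    by (subst u1, subst u2) (simp add: vec_eq_iff algebra_simps)
  moreover have "(b' / d) * (a / d) - (- a' / d) * (- b / d) = 1 / d"
  proof -
    have "(b' / d) * (a / d) - (- a' / d) * (- b / d) = (a * b' - a' * b) / (d * d)"
      by (simp add: diff_divide_distrib mult.commute)
    then show ?thesis
      using \<open>d \<noteq> 0\<close> unfolding d_def[symmetric] by simp
  qed
  ultimately show ?thesis
    using that[of "- a' / d" "b' / d" "a / d" "- b / d"] u1 u2 \<open>d \<noteq> 0\<close> by simp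
qed

end

section \<open>Concurrent lines and special cross-ratios\<close>

context plane_chart
begin

lemma card_through:
  assumes "v \<in> U" "v \<noteq> 0" "\<And>k. u1 \<noteq> k *s v" "card (through v) = n + 2"
  obtains P y where "y \<noteq> 0" "v = y *s (P *s u1 + u2)" "order P W = n" "0 < n \<longrightarrow> poly W P = 0"
proof -
  obtain P y where Py: "y \<noteq> 0" "v = y *s (P *s u1 + u2)"
    by (rule node[OF assms(1-3)])
  have "order P W = n"
    by (rule order_W_node[OF Py assms(4)])
  then show ?thesis
    using that[OF Py] order_W_pos[of P] by simp
qed

lemma M_three:
  assumes "v \<in> U" "v \<noteq> 0" "\<And>k. u1 \<noteq> k *s v" "card (through v) = 3"
  shows "M U \<le> 27"
proof -
  obtain P y where "order P W = 1"
    using card_through[OF assms(1-3), of 1] assms(4) by auto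
  then have "card lines \<le> 27"
    by (rule simple_ramification)
  then show ?thesis
    using M by simp
qed

lemma M_five:
  assumes "v \<in> U" "v \<noteq> 0" "\<And>k. u1 \<noteq> k *s v" "card (through v) = 5"
  shows "M U \<le> 28"
proof (rule ccontr)
  assume "\<not> M U \<le> 28"
  then have m: "29 \<le> card lines"
    using M by simp
  obtain P y where "order P W = 3" "poly W P = 0"
    using card_through[OF assms(1-3), of 3] assms(4) by auto
  then show False
    using most_lines(1)[OF m, of P] by simp
qed

lemma M_four:
  assumes "v \<in> U" "v \<noteq> 0" "\<And>k. u1 \<noteq> k *s v" "card (through v) = 4"
  shows "M U \<le> 28"
proof (rule ccontr)
  assume "\<not> M U \<le> 28"
  then have m: "29 \<le> card lines"
    using M by simp
  have "card (through v) = 2 + 2"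
    using assms(4) by simp
  then obtain P y where Py: "y \<noteq> 0" "v = y *s (P *s u1 + u2)" "0 < (2::nat) \<longrightarrow> poly W P = 0"
    by (rule card_through[OF assms(1-3)])
  have WP: "poly W P = 0"
    by (rule Py(3)[THEN mp]) simp
  have "U \<in> through v"
    using U assms(1) by (simp add: through_def)
  then have "card (through v - {U}) = 3"
    using assms(4) finite_\<U> by (simp add: through_def)
  then obtain a b d where abd: "through v - {U} = {a, b, d}" "a \<noteq> b" "a \<noteq> d" "b \<noteq> d"
    by (metis card_3_iff)
  have o: "V \<in> others" "P *s u1 + u2 \<in> V" if "V \<in> {a, b, d}" for V
  proof -
    have "V \<in> \<U>" "v \<in> V" "V \<noteq> U"
      using that unfolding abd(1)[symmetric] by (auto simp: through_def)
    then show "V \<in> others" "P *s u1 + u2 \<in> V"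
      using mem_scale[OF _ Py(1)] Py(2) by (auto simp only: others_def Diff_iff singleton_iff)
  qed
  have "poly A P = 0"
    using A_zero_at o[of a] by blast
  then have "poly (T 1 2) P = 0"
    using T_1_2_node[of P a b d] o abd(2-4) by blast
  then show False
    using most_lines(2)[OF m WP] by simp
qed

lemma invariants:
  assumes "28 \<le> M U"
  shows "quartic_I A = 0 \<or> quartic_J A = 0" "29 \<le> M U \<Longrightarrow> quartic_I A = 0"
proof -
  have "28 \<le> card lines"
    using M assms by simp
  then show "quartic_I A = 0 \<or> quartic_J A = 0"
    using many_lines quartic_I_zero(1) quartic_J_zero by blast
  show "quartic_I A = 0" if "29 \<le> M U"
  proof (rule quartic_I_zero(1))
    fix P
    assume "poly W P = 0"
    then show "order P W = 2"
      using most_lines(1)[of P] M that by simp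
  qed
qed

lemma linear_form_coords:
  assumes V: "V \<in> \<U>" and u: "u1 = p1 *s p + q1 *s q" "u2 = p0 *s p + q0 *s q"
  shows "[:lf V u2, lf V u1:] = smult (lf V p) [:p0, p1:] + smult (lf V q) [:q0, q1:]"
  by (simp add: u lin_add[OF lin[OF V]] lin_scale[OF lin[OF V]] mult.commute)

text \<open>The quotient of \<open>x\<close> and \<open>y\<close> is the cross-ratio of the points
  in which the four other lines meet \<open>U\<close>. The quadratic factor belongs to the
  equianharmonic values, the three linear ones to the harmonic values -1, 1/2 and 2. The homogeneous
  version needs no division.\<close>

lemma cross_ratio:
  assumes others: "others = {a, b, r, s}" "distinct [a, b, r, s]"
    and p: "p \<in> U" "p \<noteq> 0" "p \<in> a" and q: "q \<in> U" "q \<in> b" "\<And>k. q \<noteq> k *s p"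
    and M28: "28 \<le> M U"
  defines "x \<equiv> lf r p * lf s q" and "y \<equiv> lf r q * lf s p"
  shows "x^2 - x * y + y^2 = 0 \<or> (x + y) * (2 * x - y) * (x - 2 * y) = 0"
    and "29 \<le> M U \<Longrightarrow> x^2 - x * y + y^2 = 0"
proof -
  obtain p0 p1 q0 q1 where u: "u1 = p1 *s p + q1 *s q" "u2 = p0 *s p + q0 *s q" "p1 * q0 - p0 * q1 \<noteq> 0"
    by (rule coordinates[OF p(1) q(1,3) p(2)], rule that)
  have mem: "a \<in> \<U>" "b \<in> \<U>" "r \<in> \<U>" "s \<in> \<U>"
    using others(1) by (auto simp: others_def)
  have pq: "p \<in> H" "q \<in> H"
    using p q \<U>(2)[OF U] by auto
  have z: "lf a p = 0" "lf b q = 0"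
    using ker mem pq p q by auto
  let ?p = "[:p0, p1:]" and ?q = "[:q0, q1:]"
  define k where "k = c * lf U u3 * lf a q * lf b p"
  have "A = smult (c * lf U u3) ([:lf a u2, lf a u1:] * ([:lf b u2, lf b u1:] *
      ([:lf r u2, lf r u1:] * [:lf s u2, lf s u1:])))"
    using A_prod others by simp
  also have "\<dots> = smult k (?q * ?p * (smult (lf r p) ?p + smult (lf r q) ?q) * (smult (lf s p) ?p + smult (lf s q) ?q))"
    unfolding linear_form_coords[OF mem(1) u(1,2)] linear_form_coords[OF mem(2) u(1,2)]
      linear_form_coords[OF mem(3) u(1,2)] linear_form_coords[OF mem(4) u(1,2)] z k_def
    by (simp add: mult_ac del: mult_pCons_left mult_pCons_right smult_pCons)
  also have "\<dots> = smult (k * (lf r p * lf s p)) (?p ^ 3 * ?q) + smult (k * (x + y)) (?p ^ 2 * ?q ^ 2)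
      + smult (k * (lf r q * lf s q)) (?p * ?q ^ 3)"
  proof -
    have "smult k (Y * X * (smult c1 X + smult c2 Y) * (smult d1 X + smult d2 Y)) =
        smult (k * (c1 * d1)) (X ^ 3 * Y) + smult (k * (c1 * d2 + c2 * d1)) (X ^ 2 * Y ^ 2) +
        smult (k * (c2 * d2)) (X * Y ^ 3)" for X Y :: "'k poly" and c1 c2 d1 d2
      by (simp add: algebra_simps smult_add_left smult_add_right power2_eq_square power3_eq_cube)
    then show ?thesis
      unfolding x_def y_def by blast
  qed
  finally have A: "A = smult (k * (lf r p * lf s p)) (?p ^ 3 * ?q) + smult (k * (x + y)) (?p ^ 2 * ?q ^ 2)
      + smult (k * (lf r q * lf s q)) (?p * ?q ^ 3)" .
  have k0: "k \<noteq> 0"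
    using A A_nonzero by auto
  have xy: "lf r p * lf s p * (lf r q * lf s q) = x * y"
    by (simp add: x_def y_def mult_ac)
  have "(k * (x + y))^2 - 3 * (k * (lf r p * lf s p)) * (k * (lf r q * lf s q)) = k^2 * (x^2 - x * y + y^2)"
    using xy by (simp add: power2_eq_square) algebra
  then have I: "quartic_I A = (p1 * q0 - p0 * q1) ^ 4 * (k^2 * (x^2 - x * y + y^2))"
    unfolding A quartic_I_covariant by simp
  have "k * (x + y) * (9 * (k * (lf r p * lf s p)) * (k * (lf r q * lf s q)) - 2 * (k * (x + y))^2) =
      - (k^3 * ((x + y) * (2 * x - y) * (x - 2 * y)))"
    using xy by algebra
  then have J: "quartic_J A = (p1 * q0 - p0 * q1) ^ 6 * (- (k^3 * ((x + y) * (2 * x - y) * (x - 2 * y))))"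
    unfolding A quartic_J_covariant by (simp only:)
  show "x^2 - x * y + y^2 = 0 \<or> (x + y) * (2 * x - y) * (x - 2 * y) = 0"
    using invariants(1)[OF M28] u(3) k0 unfolding I J by auto
  show "x^2 - x * y + y^2 = 0" if "29 \<le> M U"
    using invariants(2)[OF M28 that] u(3) k0 unfolding I by auto
qed

end

lemma harmonic_cross_ratio:
  fixes y :: "'a::field_char_0"
  assumes "(y + 1) * (2 * y - 1) * (y - 2) = 0"
  shows "y = - 1 \<or> y = 1 / 2 \<or> y = 2"
proof -
  have "y + 1 = 0 \<or> 2 * y = 1 \<or> y - 2 = 0"
    using assms by simp
  moreover have "y = 1 / 2" if "2 * y = 1"
    using arg_cong[OF that, of "\<lambda>t. t / 2"] by simp
  ultimately show ?thesis
    by (auto simp: eq_neg_iff_add_eq_0)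
qed

text \<open>Cubes decide: equianharmonic numbers have cube -1, harmonic ones have cube -1, 1/8 or 8.
  Since \<open>x\<close> has cube -1, every combination is excluded by the cubes except that of
  harmonic \<open>y\<close> and \<open>z\<close>, where the rational number \<open>y / z\<close>
  would be a root of \<open>t^2 - t + 1\<close>.\<close>

lemma no_common_cross_ratios:
  fixes x y z :: "'a::field_char_0"
  assumes x: "x^2 - x + 1 = 0" and z: "y = z * x" and nz: "x \<noteq> 0" "y \<noteq> 0"
    and y: "y^2 - y + 1 = 0 \<or> (y + 1) * (2 * y - 1) * (y - 2) = 0"
    and z': "z^2 - z + 1 = 0 \<or> (z + 1) * (2 * z - 1) * (z - 2) = 0"
  shows False
proof -
  have x3: "x^3 = - 1"
    using x by algebra
  show False
  proof (cases "z^2 - z + 1 = 0")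
    case True
    then have z3: "z^3 = - 1"
      by algebra
    have y3: "y^3 = 1"
      using z x3 z3 by (simp add: power_mult_distrib)
    show False
      using y
    proof
      assume "y^2 - y + 1 = 0"
      then have "y^3 = - 1"
        by algebra
      then show False
        using y3 by simp
    next
      assume "(y + 1) * (2 * y - 1) * (y - 2) = 0"
      then have "y = - 1 \<or> y = 1 / 2 \<or> y = 2"
        by (rule harmonic_cross_ratio)
      then show False
        using y3 by (elim disjE; hypsubst) (simp_all add: power3_eq_cube)
    qed
  next
    case False
    then have "(z + 1) * (2 * z - 1) * (z - 2) = 0"
      using z' by blast
    then have zc: "z = - 1 \<or> z = 1 / 2 \<or> z = 2"
      by (rule harmonic_cross_ratio)
    have y3: "y^3 = - (z^3)"
      using z x3 by (simp add: power_mult_distrib)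
    show False
      using y
    proof
      assume "y^2 - y + 1 = 0"
      then have "y^3 = - 1"
        by algebra
      then show False
        using zc y3 by (elim disjE; hypsubst) (simp_all add: power3_eq_cube)
    next
      assume "(y + 1) * (2 * y - 1) * (y - 2) = 0"
      then have yc: "y = - 1 \<or> y = 1 / 2 \<or> y = 2"
        by (rule harmonic_cross_ratio)
      have "y^2 - y * z + z^2 = 0"
        using x z by algebra
      then have "(2 * y) * (2 * y) - (2 * y) * (2 * z) + (2 * z) * (2 * z) = 0"
        by algebra
      moreover have "2 * y = - 2 \<or> 2 * y = 1 \<or> 2 * y = 4" "2 * z = - 2 \<or> 2 * z = 1 \<or> 2 * z = 4"
        using yc zc by (auto simp: mult.commute)
      moreover have False if "p * p - p * q + q * q = 0" "p = - 2 \<or> p = 1 \<or> p = 4" "q = - 2 \<or> q = 1 \<or> q = 4"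
        for p q :: 'a
        using that(2,3,1) by (elim disjE; hypsubst) simp_all
      ultimately show False
        by blast
    qed
  qed
qed

context plane_section
begin

lemma plane_chart:
  assumes U: "U \<in> \<U>" and u3: "u3 \<in> H" "u3 \<notin> U"
  obtains u1 u2 \<phi> where "plane_chart F H u4 \<U> lf c u1 u2 u3 \<phi> U" "finite (lines_meeting U)"
    "\<forall>k. u1 \<noteq> k *s v"
proof (rule chart[OF U u3, of "{v}"])
  fix u1 u2 \<phi>
  assume ch: "surface_line F u1 u2 u3 u4 \<phi>" "smooth_line \<phi>"
    "U = {v. \<exists>x y. v = x *s u1 + y *s u2}" "finite (lines_meeting U)"
    "M U \<le> card (quintic_chart.lines \<phi>)" "\<And>z k. z \<in> {v} \<Longrightarrow> u1 \<noteq> k *s z"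
  interpret S: surface_line F u1 u2 u3 u4 \<phi>
    by (rule ch(1))
  interpret sm: smooth_line \<phi>
    by (rule ch(2))
  have "plane_chart F H u4 \<U> lf c u1 u2 u3 \<phi> U"
    by unfold_locales (use U u3 ch(3,5) in auto)
  then show ?thesis
    by (rule that) (use ch(4,6) in simp_all)
qed simp

lemma finite_lines_meeting:
  assumes "U \<in> \<U>"
  shows "finite (lines_meeting U)"
proof -
  obtain u3 where u3: "u3 \<in> H" "u3 \<notin> U"
    by (rule H_minus_line[OF assms])
  obtain u1 u2 \<phi> where "plane_chart F H u4 \<U> lf c u1 u2 u3 \<phi> U" "finite (lines_meeting U)" "\<forall>k. u1 \<noteq> k *s 0"
    by (rule plane_chart[OF assms u3])
  then show ?thesis
    by simp
qed

lemma M_le_29: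
  assumes "U \<in> \<U>"
  shows "M U \<le> 29"
proof -
  obtain u3 where u3: "u3 \<in> H" "u3 \<notin> U"
    by (rule H_minus_line[OF assms])
  obtain u1 u2 \<phi> where pc: "plane_chart F H u4 \<U> lf c u1 u2 u3 \<phi> U"
    and fin: "finite (lines_meeting U)" and ne0: "\<forall>k. u1 \<noteq> k *s 0"
    by (rule plane_chart[OF assms u3])
  interpret plane_chart F H u4 \<U> lf c u1 u2 u3 \<phi> U
    by (rule pc)
  show ?thesis
    using M card_lines_le_29 by simp
qed

lemma M_concurrent:
  assumes U: "U \<in> through v" and v: "v \<noteq> 0"
  shows "card (through v) = 3 \<Longrightarrow> M U \<le> 27" "card (through v) = 4 \<Longrightarrow> M U \<le> 28"
    "card (through v) = 5 \<Longrightarrow> M U \<le> 28"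
proof -
  have U': "U \<in> \<U>" "v \<in> U"
    using U by (auto simp: through_def)
  obtain u3 where u3: "u3 \<in> H" "u3 \<notin> U"
    by (rule H_minus_line[OF U'(1)])
  obtain u1 u2 \<phi> where pc: "plane_chart F H u4 \<U> lf c u1 u2 u3 \<phi> U"
    and fin: "finite (lines_meeting U)" and k: "\<forall>k. u1 \<noteq> k *s v"
    by (rule plane_chart[OF U'(1) u3])
  interpret plane_chart F H u4 \<U> lf c u1 u2 u3 \<phi> U
    by (rule pc)
  show "card (through v) = 3 \<Longrightarrow> M U \<le> 27" "card (through v) = 4 \<Longrightarrow> M U \<le> 28"
    "card (through v) = 5 \<Longrightarrow> M U \<le> 28"
    using M_three M_four M_five U'(2) v k by blast+
qed

text \<open>If four of the lines meet in \<open>v\<close> and the fifth, \<open>U\<^sub>0\<close>, is met by 29 lines, the coefficient of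
  \<open>z\<^sup>3 w\<close> in the chart of \<open>U\<^sub>0\<close> with third basis vector \<open>v\<close> is nonzero at each node; a line \<open>U\<close> through
  \<open>v\<close> met by 28 lines would make it vanish through the polarized invariant of degree 2.\<close>

lemma M_four_outside:
  assumes v: "v \<in> H" "v \<noteq> 0" "card (through v) = 4"
    and U0: "U0 \<in> \<U>" "v \<notin> U0" "29 \<le> M U0" and U: "U \<in> through v"
  shows "M U \<le> 27"
proof (rule ccontr)
  assume "\<not> M U \<le> 27"
  then have M28: "28 \<le> M U"
    by simp
  have U': "U \<in> \<U>" "v \<in> U"
    using U by (auto simp: through_def)
  have ne: "U \<noteq> U0"
    using U' U0(2) by auto
  obtain e where e: "e \<in> U0" "e \<in> U" "e \<noteq> 0"
    by (rule meet[OF U0(1) U'(1)])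
  obtain u1 u2 \<phi> where pc: "plane_chart F H u4 \<U> lf c u1 u2 v \<phi> U0"
    and fin: "finite (lines_meeting U0)" and k: "\<forall>k. u1 \<noteq> k *s e"
    by (rule plane_chart[OF U0(1) v(1) U0(2)])
  interpret C: plane_chart F H u4 \<U> lf c u1 u2 v \<phi> U0
    by (rule pc)
  have others: "C.others = through v"
  proof (rule sym, rule card_subset_eq)
    show "finite C.others" "through v \<subseteq> C.others"
      using finite_\<U> U0(2) by (auto simp: C.others_def through_def)
    show "card (through v) = card C.others"
      using v(3) \<U>(3) U0(1) finite_\<U> by (simp add: C.others_def)
  qed
  \<comment> \<open>A further line through \<open>e\<close> would also pass through \<open>v\<close>
    and thus coincide with \<open>U\<close>. So \<open>e\<close> is a simple root of
    \<open>A\<close>, where \<open>W\<close> is nonzero.\<close>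
  have e_through: "card (through e) = 0 + 2"
  proof -
    have "through e = {U0, U}"
    proof
      show "{U0, U} \<subseteq> through e"
        using e U0(1) U'(1) by (simp add: through_def)
      show "through e \<subseteq> {U0, U}"
      proof (rule subsetI, rule ccontr)
        fix V
        assume V: "V \<in> through e" "V \<notin> {U0, U}"
        then have V': "V \<in> \<U>" "e \<in> V" "V \<noteq> U"
          by (auto simp: through_def)
        then have "V \<in> C.others"
          using V by (simp add: C.others_def)
        then have "v \<in> V"
          unfolding others by (simp add: through_def)
        then have "\<exists>k. v = k *s e"
          using inter_unique[OF line_subspace[OF V'(1)] line_subspace[OF U'(1)] V'(3,2) e(2,3)] U'(2) by blast
        then show False
          using U0(2) e(1) line_subspace(1)[OF U0(1)] vec.subspace_scale by blast
      qed
    qed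
    then show ?thesis
      using ne by auto
  qed
  obtain P y where Py: "y \<noteq> 0" "e = y *s (P *s u1 + u2)" "order P C.W = 0"
    using C.card_through[OF e(1,3) k[rule_format] e_through] by metis
  define e' where "e' = P *s u1 + u2"
  have e_eq: "e = y *s e'"
    unfolding e'_def by (rule Py(2))
  have e': "e' \<in> U" "e' \<noteq> 0"
    using C.mem_scale[OF U'(1) Py(1), of e'] e(2,3) e_eq by auto
  have "P *s u1 + u2 \<in> U"
    using e'(1) unfolding e'_def .
  moreover have "U \<in> C.others"
    using U'(1) ne by (simp add: C.others_def)
  ultimately have AP: "poly C.A P = 0"
    by (metis C.A_zero_at)
  have WP: "poly C.W P \<noteq> 0"
    using Py(3) C.order_W_pos[of P] by simp
  \<comment> \<open>All factors of the section except that of \<open>U0\<close> vanish at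
    \<open>v\<close>, so the product does not involve \<open>z\<close> beyond the factor of
    \<open>U0\<close>.\<close>
  have \<phi>0: "\<phi> (Suc (Suc n)) 0 = 0" if "n \<le> 2" for n
  proof -
    have "poly (\<phi> (Suc (Suc n)) 0) x = 0" for x
    proof -
      have "(\<Prod>V\<in>C.others. [:lf V (x *s u1 + u2), lf V v:]) = (\<Prod>V\<in>C.others. [:lf V (x *s u1 + u2):])"
      proof (rule prod.cong)
        fix V
        assume "V \<in> C.others"
        then have "lf V v = 0"
          unfolding others using ker v(1) by (simp add: through_def)
        then show "[:lf V (x *s u1 + u2), lf V v:] = [:lf V (x *s u1 + u2):]"
          by simp
      qed simp
      then show ?thesis
        using C.\<phi>_k_0[of "Suc n" x] that by (simp add: prod_const_polys)
    qed
    then show ?thesis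
      using poly_all_0_iff_0 by blast
  qed
  have "\<not> C.inflected"
    using C.most_lines(3) C.M U0(3) by simp
  then have \<phi>31: "poly (\<phi> 3 1) P \<noteq> 0"
    using AP WP \<phi>0[of 0] \<phi>0[of 1] \<phi>0[of 2] unfolding C.inflected_def
    by (auto simp: eval_nat_numeral)
  obtain u3 where u3: "u3 \<in> H" "u3 \<notin> U"
    by (rule H_minus_line[OF U'(1)])
  obtain w1 w2 \<psi> where pc': "plane_chart F H u4 \<U> lf c w1 w2 u3 \<psi> U"
    and fin: "finite (lines_meeting U)" and k': "\<forall>k. w1 \<noteq> k *s v"
    by (rule plane_chart[OF U'(1) u3])
  interpret K: plane_chart F H u4 \<U> lf c w1 w2 u3 \<psi> U
    by (rule pc')
  have "card (through v) = 2 + 2"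
    using v(3) by simp
  then obtain P' y' where P': "y' \<noteq> 0" "v = y' *s (P' *s w1 + w2)" "order P' K.W = 2"
    "0 < (2::nat) \<longrightarrow> poly K.W P' = 0"
    by (rule K.card_through[OF U'(2) v(2) k'[rule_format]])
  have P'0: "poly K.W P' = 0"
    by (rule P'(4)[THEN mp]) simp
  have "28 \<le> card K.lines"
    using K.M M28 by simp
  \<comment> \<open>The four lines through \<open>v\<close> make it a root of order 2, which rules
    out the alternative that all roots have order 3.\<close>
  from K.many_lines[OF this] have "order P K.W = 2" if "poly K.W P = 0" for P
    using P'(3) P'0 that by auto
  then have polar: "quartic_I_polar K.A K.B = 0"
    by (rule K.quartic_I_zero(2))
  have nv: "v \<noteq> k *s e'" for k
  proof
    assume "v = k *s e'"
    moreover have "e' \<in> U0"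
      unfolding e'_def by (rule C.in_U')
    ultimately show False
      using U0(2) line_subspace(1)[OF U0(1)] vec.subspace_scale by blast
  qed
  obtain p0 p1 q0 q1 where u: "\<And>x. x *s w1 + w2 = (p0 + x * p1) *s e' + (q0 + x * q1) *s v"
    "w1 = p1 *s e' + q1 *s v" "w2 = p0 *s e' + q0 *s v" "p1 * q0 - p0 * q1 \<noteq> 0"
    using K.coordinates[OF e'(1) U'(2) nv e'(2)] by metis
  let ?p = "[:p0, p1:]" and ?q = "[:q0, q1:]"
  have "card (through v - {U}) = 3"
    using v(3) U finite_\<U> by (simp add: through_def)
  then obtain a b d where abd: "through v - {U} = {a, b, d}" "a \<noteq> b" "a \<noteq> d" "b \<noteq> d"
    by (metis card_3_iff)
  have abd': "V \<in> \<U>" "lf V v = 0" "V \<noteq> U0" "V \<noteq> U" if "V \<in> {a, b, d}" for V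
    using that ker v(1) U0(2) unfolding abd(1)[symmetric] by (auto simp: through_def)
  have "\<U> = insert U0 (through v)"
    using others U0(1) by (auto simp: C.others_def)
  then have Ko: "K.others = {U0, a, b, d}"
    using abd(1) ne U by (auto simp: K.others_def)
  have lf0: "lf U0 e' = 0"
    using ker[OF U0(1), of e'] C.in_U'[of P] \<U>(2)[OF U0(1)] by (auto simp: e'_def)
  have l: "[:lf V w2, lf V w1:] = smult (lf V e') ?p" if "V \<in> {a, b, d}" for V
    using K.linear_form_coords[OF abd'(1)[OF that] u(2,3)] abd'(2)[OF that] by simp
  have l0: "[:lf U0 w2, lf U0 w1:] = smult (lf U0 v) ?q"
    using K.linear_form_coords[OF U0(1) u(2,3)] lf0 by simp
  define m where "m = c * lf U u3 * (lf U0 v * lf a e' * lf b e' * lf d e')"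
  have "U0 \<notin> {a, b, d}"
    using abd'(3) by blast
  then have "K.A = smult (c * lf U u3) ([:lf U0 w2, lf U0 w1:] * ([:lf a w2, lf a w1:] *
      ([:lf b w2, lf b w1:] * [:lf d w2, lf d w1:])))"
    unfolding K.A_prod Ko using abd(2-4)
    by (simp del: mult_pCons_left mult_pCons_right smult_pCons)
  also have "\<dots> = smult m (?p ^ 3 * ?q)"
    unfolding l0 l[OF insertI1] l[OF insertI2[OF insertI1]] l[OF insertI2[OF insertI2[OF singletonI]]] m_def
    by (simp add: power3_eq_cube mult_ac del: mult_pCons_left mult_pCons_right smult_pCons)
  finally have KA: "K.A = smult m (?p ^ 3 * ?q)" .
  then have m: "m \<noteq> 0"
    using K.A_nonzero by auto
  have hom_scale: "hom n r (x * t) x = x ^ n * poly r t" if "degree r \<le> n" for n r and x t :: 'k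
  proof -
    have "hom n r (x * t) x = (\<Sum>i\<le>n. x ^ n * (coeff r i * t ^ i))"
      unfolding hom_def
    proof (rule sum.cong)
      fix i
      assume "i \<in> {..n}"
      then have "x ^ n = x ^ i * x ^ (n - i)"
        by (simp flip: power_add)
      then show "coeff r i * (x * t) ^ i * x ^ (n - i) = x ^ n * (coeff r i * t ^ i)"
        by (simp add: power_mult_distrib mult_ac)
    qed simp
    then show ?thesis
      using poly_hom[OF that, of t] by (simp add: hom_def sum_distrib_left)
  qed
  let ?b = "\<lambda>k. poly (\<phi> k 1) P"
  \<comment> \<open>On \<open>U\<close>, \<open>K.B\<close> is the derivative in direction
    \<open>u4\<close>. As \<open>U\<close> joins \<open>e'\<close> to \<open>v\<close>, it can be
    computed in the chart of \<open>U0\<close>, with \<open>v\<close> as third basis vector; the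
    coefficient next to \<open>?p * ?q ^ 3\<close> is thus \<open>\<phi> 3 1\<close> at
    \<open>P\<close>.\<close>
  have "poly K.B x = (\<Sum>k\<le>4. ?b k * (p0 + x * p1) ^ (4 - k) * (q0 + x * q1) ^ k)" for x
  proof -
    have "poly K.B x = D (x *s w1 + w2) u4"
      using K.D_u4[of x 1] poly_hom[OF K.degree_B] by simp
    moreover have "x *s w1 + w2 = ((p0 + x * p1) * P) *s u1 + (p0 + x * p1) *s u2 + (q0 + x * q1) *s v"
      unfolding u(1) e'_def by (simp add: vec_eq_iff algebra_simps)
    moreover have "hom (4 - k) (\<phi> k 1) ((p0 + x * p1) * P) (p0 + x * p1) = (p0 + x * p1) ^ (4 - k) * ?b k" for k
      by (rule hom_scale) (use C.degree_le[of k 1] in simp)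
    ultimately show ?thesis
      by (simp only: C.D_u4_general mult_ac)
  qed
  moreover have "(\<Sum>k\<le>4. b k * X ^ (4 - k) * Y ^ k) =
      b 0 * X ^ 4 + (b 1 * (X ^ 3 * Y) + b 2 * (X ^ 2 * Y ^ 2) + b 3 * (X * Y ^ 3)) + b 4 * Y ^ 4"
    for b :: "nat \<Rightarrow> 'k" and X Y
    by (simp add: numeral_sums algebra_simps)
  ultimately have "poly K.B x = poly (smult (?b 0) (?p ^ 4) + (smult (?b 1) (?p ^ 3 * ?q) + smult (?b 2) (?p ^ 2 * ?q ^ 2)
       + smult (?b 3) (?p * ?q ^ 3)) + smult (?b 4) (?q ^ 4)) x" for x
    by (simp only: poly_add poly_smult poly_mult poly_power poly_pCons poly_0 mult_zero_right add_0_right)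
  then have "K.B = smult (?b 0) (?p ^ 4) + (smult (?b 1) (?p ^ 3 * ?q) + smult (?b 2) (?p ^ 2 * ?q ^ 2)
       + smult (?b 3) (?p * ?q ^ 3)) + smult (?b 4) (?q ^ 4)"
    by (intro poly_eq_poly_eq_iff[THEN iffD1] ext)
  then have "quartic_I_polar K.A K.B = - 3 * m * ?b 3 * (p1 * q0 - p0 * q1) ^ 4"
    unfolding KA by (simp only: quartic_I_polar_covariant)
  then show False
    using polar m \<phi>31 u(4) by simp
qed

text \<open>The ratio of \<open>lf s\<close> to \<open>lf r\<close> at the vertices of the triangle
  gives numbers \<open>t1\<close>, \<open>t2\<close>, \<open>t3\<close>, and the cross-ratio on each
  side is a quotient of two of them. The identity \<open>t3 / t1 = (t2 / t1) * (t3 / t2)\<close>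
  links the three sides.\<close>

lemma generic_three:
  assumes gen: "\<And>v. v \<in> H \<Longrightarrow> v \<noteq> 0 \<Longrightarrow> card (through v) \<le> 2"
    and U: "U1 \<in> \<U>" "U2 \<in> \<U>" "U3 \<in> \<U>" "U1 \<noteq> U2" "U1 \<noteq> U3" "U2 \<noteq> U3"
    and M: "29 \<le> M U1" "28 \<le> M U2" "28 \<le> M U3"
  shows False
proof -
  obtain v1 where v1: "v1 \<in> U2" "v1 \<in> U3" "v1 \<noteq> 0"
    by (rule meet[OF U(2,3)])
  obtain v2 where v2: "v2 \<in> U1" "v2 \<in> U3" "v2 \<noteq> 0"
    by (rule meet[OF U(1,3)])
  obtain v3 where v3: "v3 \<in> U1" "v3 \<in> U2" "v3 \<noteq> 0"
    by (rule meet[OF U(1,2)])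
  have inH: "v1 \<in> H" "v2 \<in> H" "v3 \<in> H"
    using v1 v2 v3 \<U>(2) U by blast+
  have third: "x \<notin> V" if "x \<in> H" "x \<noteq> 0" "X \<in> \<U>" "Y \<in> \<U>" "V \<in> \<U>" "x \<in> X" "x \<in> Y" "X \<noteq> Y" "V \<noteq> X" "V \<noteq> Y" for x X Y V
  proof
    assume "x \<in> V"
    then have "card {X, Y, V} \<le> card (through x)"
      using that finite_\<U> by (intro card_mono) (auto simp: through_def)
    then show False
      using gen[OF that(1,2)] that(8-10) by auto
  qed
  have n: "v1 \<notin> U1" "v2 \<notin> U2" "v3 \<notin> U3"
    using third[OF inH(1) v1(3) U(2,3,1) v1(1,2)] third[OF inH(2) v2(3) U(1,3,2) v2(1,2)]
      third[OF inH(3) v3(3) U(1,2,3) v3(1,2)] U(4-6) by auto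
  have "card (\<U> - {U1, U2, U3}) = 2"
    using \<U>(3) U finite_\<U> by (simp add: card_Diff_subset)
  then obtain r s where rs: "\<U> - {U1, U2, U3} = {r, s}" "r \<noteq> s"
    by (metis card_2_iff)
  have rs': "r \<in> \<U>" "s \<in> \<U>" "r \<notin> {U1, U2, U3}" "s \<notin> {U1, U2, U3}"
    using rs(1) by auto
  have "\<U> = {U1, U2, U3} \<union> (\<U> - {U1, U2, U3})"
    using U(1-3) by blast
  also have "\<dots> = {U1, U2, U3, r, s}"
    unfolding rs(1) by blast
  finally have \<U>_eq: "\<U> = {U1, U2, U3, r, s}" .
  have nz: "lf V v1 \<noteq> 0" "lf V v2 \<noteq> 0" "lf V v3 \<noteq> 0" if "V \<in> {r, s}" for V
  proof -
    have V: "V \<in> \<U>" "V \<noteq> U1" "V \<noteq> U2" "V \<noteq> U3"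
      using that rs' by auto
    show "lf V v1 \<noteq> 0"
      using ker[OF V(1) inH(1)] third[OF inH(1) v1(3) U(2,3) V(1) v1(1,2) U(6) V(3,4)] by simp
    show "lf V v2 \<noteq> 0"
      using ker[OF V(1) inH(2)] third[OF inH(2) v2(3) U(1,3) V(1) v2(1,2) U(5) V(2,4)] by simp
    show "lf V v3 \<noteq> 0"
      using ker[OF V(1) inH(3)] third[OF inH(3) v3(3) U(1,2) V(1) v3(1,2) U(4) V(2,3)] by simp
  qed
  have cr: "(lf r p * lf s q)^2 - (lf r p * lf s q) * (lf r q * lf s p) + (lf r q * lf s p)^2 = 0 \<or>
      ((lf r p * lf s q) + (lf r q * lf s p)) * (2 * (lf r p * lf s q) - (lf r q * lf s p)) * ((lf r p * lf s q) - 2 * (lf r q * lf s p)) = 0"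
    "29 \<le> M X \<Longrightarrow> (lf r p * lf s q)^2 - (lf r p * lf s q) * (lf r q * lf s p) + (lf r q * lf s p)^2 = 0"
    if X: "X \<in> \<U>" "\<U> - {X} = {a, b, r, s}" "distinct [a, b, r, s]" "28 \<le> M X"
      and p: "p \<in> X" "p \<noteq> 0" "p \<in> a" "p \<notin> b" and q: "q \<in> X" "q \<in> b" "q \<noteq> 0" "b \<in> \<U>" for X a b p q
  proof -
    obtain u3 where u3: "u3 \<in> H" "u3 \<notin> X"
      by (rule H_minus_line[OF X(1)])
    obtain u1 u2 \<phi> where pc: "plane_chart F H u4 \<U> lf c u1 u2 u3 \<phi> X"
      and fin: "finite (lines_meeting X)" and ne0: "\<forall>k. u1 \<noteq> k *s 0"
      by (rule plane_chart[OF X(1) u3])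
    interpret K: plane_chart F H u4 \<U> lf c u1 u2 u3 \<phi> X
      by (rule pc)
    have qp: "q \<noteq> k *s p" for k
    proof
      assume "q = k *s p"
      then have "k \<noteq> 0" "p = (1 / k) *s q"
        using q(3) by auto
      then show False
        using p(4) q(2) line_subspace(1)[OF q(4)] vec.subspace_scale by blast
    qed
    have ot: "K.others = {a, b, r, s}"
      using X(2) by (simp add: K.others_def)
    note K.cross_ratio[OF ot X(3) p(1-3) q(1,2) qp X(4)]
    then show "(lf r p * lf s q)^2 - (lf r p * lf s q) * (lf r q * lf s p) + (lf r q * lf s p)^2 = 0 \<or>
      ((lf r p * lf s q) + (lf r q * lf s p)) * (2 * (lf r p * lf s q) - (lf r q * lf s p)) * ((lf r p * lf s q) - 2 * (lf r q * lf s p)) = 0"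
      "29 \<le> M X \<Longrightarrow> (lf r p * lf s q)^2 - (lf r p * lf s q) * (lf r q * lf s p) + (lf r q * lf s p)^2 = 0"
      by blast+
  qed
  have d: "r \<noteq> s" "r \<noteq> U1" "r \<noteq> U2" "r \<noteq> U3" "s \<noteq> U1" "s \<noteq> U2" "s \<noteq> U3"
    using rs(2) rs' by auto
  define t1 t2 t3 where "t1 = lf s v1 / lf r v1" and "t2 = lf s v2 / lf r v2" and "t3 = lf s v3 / lf r v3"
  have t: "lf s v1 = t1 * lf r v1" "lf s v2 = t2 * lf r v2" "lf s v3 = t3 * lf r v3" "t1 \<noteq> 0" "t2 \<noteq> 0" "t3 \<noteq> 0"
    using nz by (auto simp: t1_def t2_def t3_def)
  have norm: "x^2 - x + 1 = 0" if "(g * (t * h))^2 - (g * (t * h)) * (h * (t' * g)) + (h * (t' * g))^2 = 0"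
    "g \<noteq> 0" "h \<noteq> 0" "t' \<noteq> 0" "x = t / t'" for g h t t' x :: 'k
  proof -
    have "t = x * t'"
      using that by simp
    then have "(g * h * t')^2 * (x^2 - x + 1) = 0"
      using that(1) by algebra
    then show ?thesis
      using that by simp
  qed
  have norm': "(x + 1) * (2 * x - 1) * (x - 2) = 0"
    if "(g * (t * h) + h * (t' * g)) * (2 * (g * (t * h)) - h * (t' * g)) * (g * (t * h) - 2 * (h * (t' * g))) = 0"
    "g \<noteq> 0" "h \<noteq> 0" "t' \<noteq> 0" "x = t / t'" for g h t t' x :: 'k
  proof -
    have "t = x * t'"
      using that by simp
    then have "(g * h * t')^3 * ((x + 1) * (2 * x - 1) * (x - 2)) = 0"
      using that(1) by algebra
    then show ?thesis
      using that by simp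
  qed
  have c1: "\<U> - {U1} = {U3, U2, r, s}" "distinct [U3, U2, r, s]"
    "\<U> - {U2} = {U3, U1, r, s}" "distinct [U3, U1, r, s]"
    "\<U> - {U3} = {U2, U1, r, s}" "distinct [U2, U1, r, s]"
    unfolding \<U>_eq using U(4-6) d by (simp_all add: insert_Diff_if insert_commute)
  have "28 \<le> M U1"
    using M(1) by simp
  note cr2 = cr(2)[OF U(1) c1(1,2) this v2(1,3,2) n(2) v3(1,2,3) U(2) M(1)]
  have nzr: "lf r v1 \<noteq> 0" "lf r v2 \<noteq> 0" "lf r v3 \<noteq> 0"
    using nz by simp_all
  have x: "(t3 / t2)^2 - t3 / t2 + 1 = 0"
    by (rule norm[OF cr2[unfolded t(2,3)] nzr(2,3) t(5) refl])
  have y: "(t3 / t1)^2 - t3 / t1 + 1 = 0 \<or> (t3 / t1 + 1) * (2 * (t3 / t1) - 1) * (t3 / t1 - 2) = 0"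
    using cr(1)[OF U(2) c1(3,4) M(2) v1(1,3,2) n(1) v3(2,1,3) U(1)] unfolding t(1,3)
    by (rule disj_forward) (erule norm[OF _ nzr(1,3) t(4) refl] norm'[OF _ nzr(1,3) t(4) refl])+
  have z: "(t2 / t1)^2 - t2 / t1 + 1 = 0 \<or> (t2 / t1 + 1) * (2 * (t2 / t1) - 1) * (t2 / t1 - 2) = 0"
    using cr(1)[OF U(3) c1(5,6) M(3) v1(2,3,1) n(1) v2(2,1,3) U(1)] unfolding t(1,2)
    by (rule disj_forward) (erule norm[OF _ nzr(1,2) t(4) refl] norm'[OF _ nzr(1,2) t(4) refl])+
  show False
    by (rule no_common_cross_ratios[OF x _ _ _ y z]) (use t in simp_all)
qed

text \<open>The target is 5 * 28. Three concurrent lines give at most 3 * 27 + 2 * 29 = 139, five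
  give 5 * 28; with four, either a fifth line met by 29 lines forces 4 * 27 + 29, or all are at most
  28. Without triple points, a line met by 29 lines leaves at most one other above 27, and 2 * 29 +
  3 * 27 = 139.\<close>

lemma sum_M: "(\<Sum>U\<in>\<U>. M U) \<le> 140"
proof -
  have bound: "(\<Sum>U\<in>\<U>. M U) \<le> k * card S + l * (5 - card S)"
    if "S \<subseteq> \<U>" "\<And>U. U \<in> S \<Longrightarrow> M U \<le> k" "\<And>U. U \<in> \<U> - S \<Longrightarrow> M U \<le> l" for S k l
  proof -
    have "(\<Sum>U\<in>\<U>. M U) = (\<Sum>U\<in>\<U> - S. M U) + (\<Sum>U\<in>S. M U)"
      by (rule sum.subset_diff[OF that(1) finite_\<U>])
    also have "(\<Sum>U\<in>\<U> - S. M U) \<le> card (\<U> - S) * l"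
      using sum_bounded_above[of "\<U> - S" M l] that(3) by simp
    also have "(\<Sum>U\<in>S. M U) \<le> card S * k"
      using sum_bounded_above[of S M k] that(2) by simp
    also have "card (\<U> - S) = 5 - card S"
      using card_Diff_subset[OF finite_subset[OF that(1) finite_\<U>] that(1)] \<U>(3) by simp
    finally show ?thesis
      by (simp add: mult.commute)
  qed
  have through_sub: "through v \<subseteq> \<U>" for v
    by (auto simp: through_def)
  show ?thesis
  proof (cases "\<exists>v\<in>H. v \<noteq> 0 \<and> 3 \<le> card (through v)")
    case True
    then obtain v where v: "v \<in> H" "v \<noteq> 0" "3 \<le> card (through v)"
      by blast
    have "card (through v) \<le> 5"
      using card_mono[OF finite_\<U> through_sub, of v] \<U>(3) by simp
    then consider "card (through v) = 3" | "card (through v) = 4" | "card (through v) = 5"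
      using v(3) by linarith
    then show ?thesis
    proof cases
      case 1
      then show ?thesis
        using bound[OF through_sub, of v 27 29] M_concurrent(1)[OF _ v(2)] M_le_29 by simp
    next
      case 3
      then show ?thesis
        using bound[OF through_sub, of v 28 29] M_concurrent(3)[OF _ v(2)] M_le_29 by simp
    next
      case 2
      show ?thesis
      proof (cases "\<exists>U\<in>\<U> - through v. 29 \<le> M U")
        case True
        then obtain U0 where "U0 \<in> \<U>" "v \<notin> U0" "29 \<le> M U0"
          by (auto simp: through_def)
        then show ?thesis
          using bound[OF through_sub, of v 27 29] M_four_outside[OF v(1,2) 2] M_le_29 2 by simp
      next
        case False
        have "M U \<le> 28" if "U \<in> \<U> - through v" for U
        proof (rule ccontr)
          assume "\<not> M U \<le> 28"
          then have "29 \<le> M U"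
            by simp
          then show False
            using False that by blast
        qed
        then show ?thesis
          using bound[OF through_sub, of v 28 28] M_concurrent(2)[OF _ v(2) 2] 2 by simp
      qed
    qed
  next
    case False
    then have gen: "card (through v) \<le> 2" if "v \<in> H" "v \<noteq> 0" for v
      using that by (metis not_less_eq_eq numeral_2_eq_2 numeral_3_eq_3)
    show ?thesis
    proof (cases "\<exists>U\<in>\<U>. 29 \<le> M U")
      case False
      have "M U \<le> 28" if "U \<in> \<U>" for U
      proof (rule ccontr)
        assume "\<not> M U \<le> 28"
        then have "29 \<le> M U"
          by simp
        then show False
          using False that by blast
      qed
      then show ?thesis
        using bound[of "{}" 0 28] by simp
    next
      case True
      then obtain U1 where U1: "U1 \<in> \<U>" "29 \<le> M U1"
        by blast
      show ?thesis
      proof (cases "\<exists>U\<in>\<U> - {U1}. 28 \<le> M U")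
        case False
        have "M U \<le> 27" if "U \<in> \<U> - {U1}" for U
        proof (rule ccontr)
          assume "\<not> M U \<le> 27"
          then have "28 \<le> M U"
            by simp
          then show False
            using False that by blast
        qed
        then show ?thesis
          using bound[of "{U1}" 29 27] U1 M_le_29 by simp
      next
        case True
        then obtain U2 where U2: "U2 \<in> \<U>" "U2 \<noteq> U1" "28 \<le> M U2"
          by blast
        have "M U \<le> 27" if "U \<in> \<U> - {U1, U2}" for U
        proof (rule ccontr)
          assume "\<not> M U \<le> 27"
          then have "28 \<le> M U"
            by simp
          then show False
            using generic_three[OF gen U1(1) U2(1), of U] U1 U2 that by auto
        qed
        then show ?thesis
          using bound[of "{U1, U2}" 29 27, OF _ M_le_29] U1 U2 by force
      qed
    qed
  qed
qed

lemma card_surface_lines: "finite surface_lines" "card surface_lines \<le> 125"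
proof -
  have meets: "V \<in> lines_meeting U" if "U \<in> \<U>" "V \<in> \<U>" "V \<noteq> U" for U V
    using meet[OF that(1,2)] that \<U>(1) by (auto simp: lines_meeting_def)
  have cover: "L \<in> \<U> \<union> (\<Union>U\<in>\<U>. lines_meeting U - \<U>)" if L: "L \<in> surface_lines" for L
  proof (cases "L \<in> \<U>")
    case False
    have sL: "vec.subspace L" "vec.dim L = 2" "\<And>v. v \<in> L \<Longrightarrow> f v = 0"
      using L by (auto simp: surface_lines_def)
    define S where "S = {x + y |x y. x \<in> L \<and> y \<in> H}"
    have "vec.dim S \<le> 4"
      using vec.dim_subset[of S UNIV] unfolding vec_dim_card by simp
    moreover have "vec.dim S + vec.dim (L \<inter> H) = 2 + 3"
      using vec.dim_sums_Int[OF sL(1) H(1)] unfolding S_def sL(2) H(2) .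
    ultimately have "vec.dim (L \<inter> H) \<noteq> 0"
      by linarith
    then have "\<not> L \<inter> H \<subseteq> {0}"
      unfolding vec.dim_eq_0 .
    then obtain v where v: "v \<in> L" "v \<in> H" "v \<noteq> 0"
      by blast
    \<comment> \<open>Needed for a zero of \<open>f\<close> on the plane to lie on one of the five
      lines; \<open>c = 0\<close> would make \<open>A\<close> vanish identically in a chart.\<close>
    have "c \<noteq> 0"
    proof -
      obtain U where U: "U \<in> \<U>"
        using \<U>(3) by fastforce
      obtain u3 where u3: "u3 \<in> H" "u3 \<notin> U"
        by (rule H_minus_line[OF U])
      obtain u1 u2 \<phi> where pc: "plane_chart F H u4 \<U> lf c u1 u2 u3 \<phi> U"
        and fin: "finite (lines_meeting U)" and ne0: "\<forall>k. u1 \<noteq> k *s 0"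
        by (rule plane_chart[OF U u3])
      interpret K: plane_chart F H u4 \<U> lf c u1 u2 u3 \<phi> U
        by (rule pc)
      show ?thesis
        using K.scalar_nonzero by auto
    qed
    then have "(\<Prod>U\<in>\<U>. lf U v) = 0"
      using f_prod[OF v(2)] sL(3)[OF v(1)] by simp
    then obtain U where "U \<in> \<U>" "lf U v = 0"
      using finite_\<U> by (auto simp: prod_zero_iff)
    then have "U \<in> \<U>" "v \<in> U"
      using ker v(2) by auto
    then have "L \<in> lines_meeting U - \<U>"
      using L v False by (auto simp: lines_meeting_def)
    then show ?thesis
      using \<open>U \<in> \<U>\<close> by blast
  qed simp
  have fin: "finite (\<U> \<union> (\<Union>U\<in>\<U>. lines_meeting U - \<U>))"
    using finite_\<U> finite_lines_meeting by auto
  show "finite surface_lines"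
    using cover fin by (meson finite_subset subsetI)
  have "card (lines_meeting U - \<U>) + 4 \<le> M U" if U: "U \<in> \<U>" for U
  proof -
    have "card ((lines_meeting U - \<U>) \<union> (\<U> - {U})) = card (lines_meeting U - \<U>) + card (\<U> - {U})"
      using finite_\<U> finite_lines_meeting[OF U] by (intro card_Un_disjoint) auto
    moreover have "card (\<U> - {U}) = 4"
      using \<U>(3) U finite_\<U> by simp
    moreover have "card ((lines_meeting U - \<U>) \<union> (\<U> - {U})) \<le> M U"
      using meets[OF U] finite_lines_meeting[OF U] by (intro card_mono) auto
    ultimately show ?thesis
      by simp
  qed
  then have "(\<Sum>U\<in>\<U>. card (lines_meeting U - \<U>) + 4) \<le> (\<Sum>U\<in>\<U>. M U)"
    by (rule sum_mono)
  then have s: "(\<Sum>U\<in>\<U>. card (lines_meeting U - \<U>)) + 20 \<le> 140"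
    using sum_M \<U>(3) by (simp add: sum.distrib)
  have "card surface_lines \<le> card (\<U> \<union> (\<Union>U\<in>\<U>. lines_meeting U - \<U>))"
    using cover fin by (intro card_mono) auto
  also have "\<dots> \<le> card \<U> + card (\<Union>U\<in>\<U>. lines_meeting U - \<U>)"
    by (rule card_Un_le)
  also have "card (\<Union>U\<in>\<U>. lines_meeting U - \<U>) \<le> (\<Sum>U\<in>\<U>. card (lines_meeting U - \<U>))"
    by (rule card_UN_le[OF finite_\<U>])
  finally show "card surface_lines \<le> 125"
    using s \<U>(3) by simp
qed

end

section \<open>Factorization of the plane section\<close>

context quintic_surface
begin

lemma plane_coordinates:
  fixes H :: "('k ^ 4) set"
  assumes H: "vec.subspace H" and u4: "u4 \<notin> H" and u3: "u3 \<in> H" "u3 \<notin> U"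
    and U: "vec.subspace U" "vec.dim U = 2" "U \<subseteq> H"
  obtains \<mu> \<eta> where "lin \<mu>" "lin \<eta>" "\<mu> u4 = 0" "\<And>v. v \<in> H \<Longrightarrow> \<eta> v = 0"
    "\<And>v. v - \<eta> v *s u4 \<in> H" "\<And>v. v \<in> H \<Longrightarrow> \<mu> v = 0 \<longleftrightarrow> v \<in> U"
proof -
  obtain v1 v2 where v: "v1 \<in> U" "v2 \<in> U" and fr: "frame v1 v2 u3 u4"
    by (rule frame_exists[OF U H u3 u4])
  obtain \<mu> \<eta> where \<mu>: "lin \<mu>" and \<eta>: "lin \<eta>"
    and z: "\<And>x y z w. \<mu> (x *s v1 + y *s v2 + z *s u3 + w *s u4) = z"
    and w: "\<And>x y z w. \<eta> (x *s v1 + y *s v2 + z *s u3 + w *s u4) = w"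
    using frame_coordinate[OF fr] by metis
  have inU: "x *s v1 + y *s v2 \<in> U" for x y
    using U(1) v by (intro vec.subspace_add vec.subspace_scale)
  have inH: "x *s v1 + y *s v2 + z *s u3 \<in> H" for x y z
    using H inU U(3) u3(1) by (intro vec.subspace_add vec.subspace_scale) (use v in auto)
  have coord: "\<exists>x y z w. v = x *s v1 + y *s v2 + z *s u3 + w *s u4" for v
    using fr by (simp add: frame_def)
  have proj: "v - \<eta> v *s u4 \<in> H" for v
  proof -
    obtain x y z' w' where xy: "v = x *s v1 + y *s v2 + z' *s u3 + w' *s u4"
      using coord by blast
    have "\<eta> v = w'"
      unfolding xy by (rule w)
    then have "v - \<eta> v *s u4 = x *s v1 + y *s v2 + z' *s u3"
      by (simp add: xy)
    then show ?thesis
      using inH by simp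
  qed
  show ?thesis
  proof (rule that[OF \<mu> \<eta> _ _ proj])
    show "\<mu> u4 = 0"
      using z[of 0 0 0 1] by simp
    show \<eta>0: "\<eta> v = 0" if "v \<in> H" for v
    proof (rule ccontr)
      assume n: "\<eta> v \<noteq> 0"
      have "v - (v - \<eta> v *s u4) \<in> H"
        by (rule vec.subspace_diff[OF H that proj])
      then have "\<eta> v *s u4 \<in> H"
        by simp
      then have "(1 / \<eta> v) *s (\<eta> v *s u4) \<in> H"
        by (rule vec.subspace_scale[OF H])
      then show False
        using n u4 by simp
    qed
    show "\<mu> v = 0 \<longleftrightarrow> v \<in> U" if vH: "v \<in> H" for v
    proof -
      obtain x y z' w' where xy: "v = x *s v1 + y *s v2 + z' *s u3 + w' *s u4"
        using coord by blast
      have "\<eta> v = w'" and m: "\<mu> v = z'"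
        unfolding xy by (rule w, rule z)
      then have v_eq: "v = x *s v1 + y *s v2 + z' *s u3"
        using \<eta>0[OF vH] xy by simp
      show ?thesis
      proof
        assume "\<mu> v = 0"
        then show "v \<in> U"
          using m inU[of x y] v_eq by simp
      next
        assume vU: "v \<in> U"
        show "\<mu> v = 0"
        proof (rule ccontr)
          assume n: "\<mu> v \<noteq> 0"
          have "v - (x *s v1 + y *s v2) \<in> U"
            by (rule vec.subspace_diff[OF U(1) vU inU])
          then have "z' *s u3 \<in> U"
            by (simp add: v_eq)
          then have "(1 / z') *s (z' *s u3) \<in> U"
            by (rule vec.subspace_scale[OF U(1)])
          then show False
            using n m u3(2) by simp
        qed
      qed
    qed
  qed
qed

text \<open>The restriction of \<open>f\<close> to \<open>H\<close> is extended to the whole space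
  as the form \<open>g\<close> that is constant along \<open>u4\<close>, so that
  \<open>form_factor\<close> applies. Five linear factors exhaust the degree 5 and leave a
  constant.\<close>

lemma plane_section_exists:
  assumes H: "vec.subspace H" "vec.dim H = 3" and u4: "u4 \<notin> H"
    and \<U>: "\<And>U. U \<in> \<U> \<Longrightarrow> U \<in> surface_lines" "\<And>U. U \<in> \<U> \<Longrightarrow> U \<subseteq> H" "card \<U> = 5"
  obtains lf c where "plane_section F H u4 \<U> lf c"
proof -
  have sU: "vec.subspace U" "vec.dim U = 2" "U \<subseteq> H" "\<And>v. v \<in> U \<Longrightarrow> f v = 0" if "U \<in> \<U>" for U
    using \<U>(1,2)[OF that] by (auto simp: surface_lines_def)
  have out: "\<exists>u3. u3 \<in> H \<and> u3 \<notin> U" if "U \<in> \<U>" for U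
  proof (rule ccontr)
    assume "\<nexists>u3. u3 \<in> H \<and> u3 \<notin> U"
    then have "H \<subseteq> U"
      by blast
    then have "vec.dim H \<le> vec.dim U"
      by (rule vec.dim_subset)
    then show False
      using H(2) sU(2)[OF that] by simp
  qed
  have fin: "finite \<U>"
    using \<U>(3) by (intro card_ge_0_finite) simp
  have "\<exists>\<mu>. lin \<mu> \<and> \<mu> u4 = 0 \<and> (\<forall>v\<in>H. \<mu> v = 0 \<longleftrightarrow> v \<in> U)" if U: "U \<in> \<U>" for U
  proof -
    obtain u3 where u3: "u3 \<in> H" "u3 \<notin> U"
      using out[OF U] by blast
    show ?thesis
      by (rule plane_coordinates[OF H(1) u4 u3 sU(1-3)[OF U]]) blast
  qed
  then obtain lf where lf: "\<And>U. U \<in> \<U> \<Longrightarrow> lin (lf U)" "\<And>U. U \<in> \<U> \<Longrightarrow> lf U u4 = 0"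
    "\<And>U v. U \<in> \<U> \<Longrightarrow> v \<in> H \<Longrightarrow> lf U v = 0 \<longleftrightarrow> v \<in> U"
    by metis
  have "\<U> \<noteq> {}"
    using \<U>(3) by auto
  then obtain U0 where U0: "U0 \<in> \<U>"
    by blast
  obtain u3 where u3: "u3 \<in> H" "u3 \<notin> U0"
    using out[OF U0] by blast
  obtain \<eta> where \<eta>: "lin \<eta>" "\<forall>v\<in>H. \<eta> v = 0" "\<forall>v. v - \<eta> v *s u4 \<in> H"
    by (rule plane_coordinates[OF H(1) u4 u3 sU(1-3)[OF U0]]) blast
  define g where "g v = f (v - \<eta> v *s u4)" for v
  have inj: "inj_on lf \<U>"
  proof (rule inj_onI)
    fix U V
    assume UV: "U \<in> \<U>" "V \<in> \<U>" "lf U = lf V"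
    then have "v \<in> U \<longleftrightarrow> v \<in> V" if "v \<in> H" for v
      using lf(3)[OF UV(1) that] lf(3)[OF UV(2) that] by simp
    then show "U = V"
      using sU(3) UV(1,2) by blast
  qed
  have "\<exists>h. form 0 h \<and> (\<forall>v. g v = (\<Prod>\<mu>\<in>lf ` \<U>. \<mu> v) * h v)"
  proof (rule form_factor)
    show "finite (lf ` \<U>)"
      using fin by simp
    show "lin \<mu>" if "\<mu> \<in> lf ` \<U>" for \<mu>
      using that lf(1) by blast
    show "\<exists>e. \<mu> e \<noteq> 0" if "\<mu> \<in> lf ` \<U>" for \<mu>
      using that out lf(3) by blast
    show "\<exists>e. \<nu> e = 0 \<and> \<mu> e \<noteq> 0" if "\<mu> \<in> lf ` \<U>" "\<nu> \<in> lf ` \<U>" "\<mu> \<noteq> \<nu>" for \<mu> \<nu>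
    proof -
      obtain U V where UV: "U \<in> \<U>" "\<mu> = lf U" "V \<in> \<U>" "\<nu> = lf V"
        using \<open>\<mu> \<in> lf ` \<U>\<close> \<open>\<nu> \<in> lf ` \<U>\<close> by blast
      have "\<not> V \<subseteq> U"
      proof
        assume "V \<subseteq> U"
        then have "V = U"
          using vec.subspace_dim_equal[OF sU(1)[OF UV(3)] sU(1)[OF UV(1)]] sU(2) UV(1,3) by simp
        then show False
          using that(3) UV(2,4) by simp
      qed
      then obtain e where "e \<in> V" "e \<notin> U"
        by blast
      then show ?thesis
        using lf(3)[OF UV(1)] lf(3)[OF UV(3)] sU(3)[OF UV(3)] UV(2,4) by blast
    qed
    have "form 5 g"
      unfolding g_def by (rule form_compose[OF form_f lin_projection[OF \<eta>(1)]])
    then show "form (0 + card (lf ` \<U>)) g"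
      using card_image[OF inj] \<U>(3) by simp
    show "g v = 0" if \<mu>: "\<mu> \<in> lf ` \<U>" "\<mu> v = 0" for \<mu> v
    proof -
      obtain U where U: "U \<in> \<U>" "\<mu> = lf U"
        using \<mu>(1) by blast
      have "lf U (v - \<eta> v *s u4) = 0"
        using \<mu>(2) U(2) lf(2)[OF U(1)] by (simp add: lin_diff[OF lf(1)[OF U(1)]] lin_scale[OF lf(1)[OF U(1)]])
      then have "v - \<eta> v *s u4 \<in> U"
        using lf(3)[OF U(1)] \<eta>(3) by blast
      then show ?thesis
        unfolding g_def by (rule sU(4)[OF U(1)])
    qed
  qed
  then obtain h where h: "form 0 h" "\<And>v. g v = (\<Prod>\<mu>\<in>lf ` \<U>. \<mu> v) * h v"
    by blast
  have "f v = h 0 * (\<Prod>U\<in>\<U>. lf U v)" if "v \<in> H" for v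
  proof -
    have "f v = g v"
      using \<eta>(2) that by (simp add: g_def)
    also have "\<dots> = h 0 * (\<Prod>U\<in>\<U>. lf U v)"
      using h(2)[of v] form_0_const[OF h(1), of v 0] by (simp add: prod.reindex[OF inj])
    finally show ?thesis .
  qed
  then have "plane_section F H u4 \<U> lf (h 0)"
    using H u4 \<U> lf by unfold_locales auto
  then show ?thesis
    by (rule that)
qed

end

section \<open>Passage to projective space\<close>

lemma projectivization_subset:
  assumes U: "vec.subspace U" and W: "vec.subspace W" and "projectivization U \<subseteq> projectivization W"
  shows "U \<subseteq> W"
proof
  fix v
  assume v: "v \<in> U"
  show "v \<in> W"
  proof (cases "v = 0")
    case True
    then show ?thesis
      using vec.subspace_0[OF W] by simp
  next
    case False
    have "vec.span {v} \<in> projectivization U"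
      using v U False vec.dim_span_eq_card_independent[of "{v}"] vec.span_minimal[of "{v}" U]
      by (simp add: projectivization_def proj_space_def)
    then show ?thesis
      using assms(3) vec.span_base[of v "{v}"] by (auto simp: projectivization_def)
  qed
qed

theorem corollary6p1:
  fixes X :: "('k::{alg_closed_field, field_char_0} ^ 4) set set"
  assumes "smooth_hypersurface 5 X"
    and "\<exists>S. S \<subseteq> lines_in X \<and> card S = 5 \<and> coplanar_lines S"
  shows "finite (lines_in X) \<and> card (lines_in X) \<le> 125"
proof -
  obtain F :: "(4, 'k) mpolynomial" where F: "homogeneous_form 5 F" "X = zero_locus F"
    "\<And>P v. P \<in> X \<Longrightarrow> v \<in> P \<Longrightarrow> v \<noteq> 0 \<Longrightarrow> \<exists>i. mpoly_eval (mpoly_pderiv i F) v \<noteq> 0"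
    using assms(1) unfolding smooth_hypersurface_def by blast
  have scale: "mpoly_eval F (c *s v) = c ^ 5 * mpoly_eval F v" for c v
    by (rule form_scale[OF form_mpoly_eval[OF F(1)]])
  \<comment> \<open>The smoothness hypothesis speaks of points of \<open>X\<close>; homogeneity
    makes every nonzero vector zero of \<open>F\<close> span such a point.\<close>
  have point: "vec.span {v} \<in> X" if v: "v \<noteq> 0" "mpoly_eval F v = 0" for v
  proof -
    have "mpoly_eval F w = 0" if "w \<in> vec.span {v}" for w
      using that v(2) scale by (auto simp: vec.span_singleton)
    then show ?thesis
      using v(1) vec.dim_span_eq_card_independent[of "{v}"]
      by (simp add: F(2) zero_locus_def proj_space_def)
  qed
  interpret quintic_surface F
  proof
    show "homogeneous_form 5 F"
      by (rule F(1))
    fix v :: "'k ^ 4"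
    assume v: "v \<noteq> 0" "mpoly_eval F v = 0"
    obtain i where "mpoly_eval (mpoly_pderiv i F) v \<noteq> 0"
      using F(3)[OF point[OF v] vec.span_base v(1)] by blast
    moreover have "dir_deriv F v (axis i 1) = mpoly_eval (mpoly_pderiv i F) v"
      unfolding dir_deriv_def axis_def by (simp add: if_distrib[of "\<lambda>x. x * _"] sum.delta cong: if_cong)
    ultimately show "\<exists>e. dir_deriv F v e \<noteq> 0"
      by metis
  qed
  have line: "\<exists>U\<in>surface_lines. L = projectivization U" if L: "L \<in> lines_in X" for L
  proof -
    obtain U where U: "vec.subspace U" "vec.dim U = 2" "L = projectivization U"
      using L by (auto simp: lines_in_def proj_linear_subspace_def)
    have "f v = 0" if "v \<in> U" for v
    proof (cases "v = 0")
      case True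
      then show ?thesis
        using f_scale[of 0 v] by simp
    next
      case False
      have "vec.span {v} \<in> L"
        using that U False vec.dim_span_eq_card_independent[of "{v}"] vec.span_minimal[of "{v}" U]
        by (simp add: projectivization_def proj_space_def)
      then show ?thesis
        using L vec.span_base[of v "{v}"] by (auto simp: lines_in_def F(2) zero_locus_def)
    qed
    then show ?thesis
      using U by (auto simp: surface_lines_def)
  qed
  then have sub: "lines_in X \<subseteq> projectivization ` surface_lines"
    by blast
  obtain S where S: "S \<subseteq> lines_in X" "card S = 5" "coplanar_lines S"
    using assms(2) by blast
  then obtain H where H: "vec.subspace H" "vec.dim H = 3" "\<And>L. L \<in> S \<Longrightarrow> L \<subseteq> projectivization H"
    by (auto simp: coplanar_lines_def proj_linear_subspace_def)
  have "\<forall>L\<in>S. \<exists>U. U \<in> surface_lines \<and> L = projectivization U"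
    using line S(1) by blast
  then obtain p where p: "\<And>L. L \<in> S \<Longrightarrow> p L \<in> surface_lines \<and> L = projectivization (p L)"
    by metis
  have "inj_on p S"
    using p by (metis inj_onI)
  then have "card (p ` S) = 5"
    using S(2) by (simp add: card_image)
  have "H \<noteq> UNIV"
    using H(2) vec_dim_card[where 'a = 'k and 'n = 4] by auto
  then obtain u4 where u4: "u4 \<notin> H"
    by blast
  obtain lf c where "plane_section F H u4 (p ` S) lf c"
  proof (rule plane_section_exists[OF H(1,2) u4])
    show "U \<in> surface_lines" if "U \<in> p ` S" for U
      using that p by blast
    show "U \<subseteq> H" if "U \<in> p ` S" for U
    proof -
      obtain L where L: "L \<in> S" "U = p L"
        using \<open>U \<in> p ` S\<close> by blast
      then have "vec.subspace U" "projectivization U \<subseteq> projectivization H"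
        using p[OF L(1)] H(3)[OF L(1)] by (auto simp: surface_lines_def)
      then show ?thesis
        using projectivization_subset[OF _ H(1)] by blast
    qed
    show "card (p ` S) = 5"
      by fact
  qed
  then interpret plane_section F H u4 "p ` S" lf c .
  have "card (lines_in X) \<le> card (projectivization ` surface_lines)"
    using sub card_surface_lines(1) by (intro card_mono) auto
  also have "\<dots> \<le> card surface_lines"
    by (rule card_image_le[OF card_surface_lines(1)])
  finally show ?thesis
    using sub card_surface_lines finite_subset by fastforce
qed

end
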